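(* Let $k>2$ be a fixed real number. Then there exist constants $T_0=T_0(k)$ and $c=c(k)>0$ such that for all $T\ge T_0$ and all real $x$ with $2\le x\le T^{1/2}$, \[ \frac{1}{T}\int_T^{2T}\left|\sum_{n\le x}n^{-it}\right|^{2k}\,dt\;\ge\; c\,x^k(\log x)^{(k-1)^2}. \]
   Context: The sum runs over positive integers $n\le x$, and $n^{-it}=e^{-it\log n}$. The paper writes the conclusion as $\gg_k x^k(\log x)^{(k-1)^2}$ for "$T$ sufficiently large", with $k$ fixed. *)

theory Defs
  imports "HOL-Analysis.Analysis"
begin

end

theory Submission
  imports Defs "HOL-Real_Asymp.Real_Asymp"
begin

text \<open>
  Write \<open>D(t)\<close> for the sum, \<open>\<alpha> = k - 1\<close>, \<open>L = ln x\<close>. The inequality of Hoelder bounds the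
  \<open>2k\<close>-th moment of \<open>D\<close> from below by \<open>A^k / B^(k-1)\<close>, where \<open>A\<close> is the integral of \<open>|D|^2 g\<close> and \<open>B\<close>
  that of \<open>g^(k/(k-1))\<close>. As \<open>D\<close> is large at \<open>t\<close> when the Euler product over \<open>p \<le> x\<close> is large at
  \<open>1/2 + i(t+u)\<close> for some small \<open>u\<close>, the weight is \<open>g(t) = \<Sum>\<^sub>u |R(t+u)|^2\<close> with \<open>u\<close> running over the
  multiples of \<open>1/L\<close> in \<open>[0,1)\<close> and \<open>R\<close> a short Dirichlet polynomial imitating the \<open>\<alpha>\<close>-th power of this product.

  To take the \<open>1/\<alpha>\<close>-th power of \<open>|R|^2\<close>, the primes are cut into blocks \<open>2^j/2 < ln p \<le> 2^j\<close>, \<open>j \<le> J\<close>,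
  and with \<open>P\<^sub>j(t)\<close> the sum of \<open>p^(-1/2-it)\<close> over a block, \<open>R\<close> is the product of \<open>(1 + P\<^sub>j/b\<^sub>j)^n\<^sub>j\<close>
  where \<open>n\<^sub>j\<close> is the integer part of \<open>\<alpha> b\<^sub>j\<close>. The exponent \<open>n\<^sub>j/\<alpha>\<close> lies between the integers \<open>b\<^sub>j - 1\<close> and \<open>b\<^sub>j\<close>,
  so weighted AM-GM leads back to Dirichlet polynomials. A block costs a factor \<open>1 + O(1/b\<^sub>j)\<close>; the
  choice \<open>b\<^sub>j = (J-j+1)^2\<close> makes the total loss bounded while \<open>R\<close> still has length \<open>x^(1/10)\<close>.

  Since \<open>1/\<alpha> < 1\<close>, \<open>g^(1+1/\<alpha>)\<close> is at most the double sum of \<open>|R(t+u)|^2 |R(t+v)|^(2/\<alpha>)\<close>, whose mean is of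
  size \<open>L^(\<alpha>^2+1) min(L, 1/|u-v|)^(2\<alpha>)\<close>, so that \<open>B\<close> is \<open>O(T L^(k^2+1))\<close>. For \<open>A\<close>, the Cauchy-Schwarz
  inequality against \<open>R(t+u)\<close> times a longer zeta sum at the point \<open>1/2+i(t+u)\<close> produces a sum over greatest common divisors with
  nonnegative terms only, and shows that \<open>A\<close> is at least a constant times \<open>T x L^(k^2-1)\<close>.
\<close>

section \<open>Sums of complex powers and mean values\<close>

text \<open>The average over shifts is worth exactly one logarithm. With the single weight |R(t)|^2
  the bounds for A and B would be of size T x L^(k^2-2) and T L^(k^2), so A^k / B^(k-1) would carry
  only L^((k-1)^2 - 1). About L shifts spaced by 1/L multiply both bounds by L, because the cross
  terms in B decay like |i-j|^(-2\<alpha>) and are summable; the quotient then gains L^(k-(k-1)) =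
  L. The exponents agree by k(k^2-1) - (k^2+1)(k-1) = (k-1)^2.

  The obstacle is that a bounded factor lost in each of about ln L blocks would already be a power
  of L. Every estimate for a block is therefore sharp up to 1 + O(1/b) and keeps the exact
  exponential or Euler product as its main term. Two demands meet in b: the sum of 1/b over the
  blocks must stay bounded, and so must the sum of b 2^j / 2^J, which measures the length. Small
  primes can afford a large b, and squares of the distance to the top block meet both.

  The range of x enters through x^(11/10) <= T^(11/20), which leaves ample room in the mean value
  theorem for the product of D and R.\<close>

definition npow :: "complex \<Rightarrow> real \<Rightarrow> complex" where
  "npow s v = exp (- s * of_real (ln v))"

lemma norm_npow: "norm (npow s v) = exp (- Re s * ln v)"
  by (simp add: npow_def)

lemma npow_has_vector_derivative:
  assumes "v > 0"
  shows "(npow s has_vector_derivative - s * npow (s + 1) v) (at v within A)"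
proof -
  have ln': "((\<lambda>v. - s * complex_of_real (ln v)) has_vector_derivative - s * of_real (1 / v)) (at v within A)"
    using assms
    by (intro has_vector_derivative_mult_right has_vector_derivative_of_real)
       (auto intro!: derivative_eq_intros simp: has_real_derivative_iff_has_vector_derivative[symmetric] field_simps)
  have "((exp \<circ> (\<lambda>v. - s * complex_of_real (ln v))) has_vector_derivative
      (- s * of_real (1 / v)) * exp (- s * complex_of_real (ln v))) (at v within A)"
    by (rule field_vector_diff_chain_within[OF ln']) (auto intro!: derivative_eq_intros)
  moreover have "npow (s + 1) v = of_real (1 / v) * npow s v"
    using assms by (simp add: npow_def algebra_simps exp_diff exp_of_real exp_minus divide_inverse)
  ultimately show ?thesis
    by (simp add: npow_def[abs_def] o_def mult_ac)
qed

lemma norm_diff_le_vector_derivative: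
  fixes f :: "real \<Rightarrow> 'a :: real_normed_vector"
  assumes "a \<le> b" "\<And>v. a \<le> v \<Longrightarrow> v \<le> b \<Longrightarrow> (f has_vector_derivative f' v) (at v within {a..b})"
    "\<And>v. a \<le> v \<Longrightarrow> v \<le> b \<Longrightarrow> norm (f' v) \<le> B"
  shows "norm (f b - f a) \<le> B * (b - a)"
proof -
  have "norm (f b - f a) \<le> B * norm (b - a)"
  proof (rule differentiable_bound[where S = "{a..b}" and f' = "\<lambda>v h. h *\<^sub>R f' v"])
    show "(f has_derivative (\<lambda>h. h *\<^sub>R f' v)) (at v within {a..b})" if "v \<in> {a..b}" for v
      using assms(2)[of v] that by (simp add: has_vector_derivative_def)
    show "onorm (\<lambda>h. h *\<^sub>R f' v) \<le> B" if "v \<in> {a..b}" for v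
      using assms(3)[of v] that by (intro onorm_le) (auto simp: mult.commute[of B] intro!: mult_left_mono)
  qed (use assms(1) in auto)
  thus ?thesis using assms(1) by simp
qed

lemma norm_npow_mono:
  assumes "0 < m" "m \<le> v" "Re s \<ge> 0"
  shows "norm (npow s v) \<le> norm (npow s m)"
  using assms by (simp add: norm_npow mult_left_mono ln_mono)

lemma npow_diff_bound:
  assumes "0 < m" "m \<le> v" "v \<le> m + 1" "Re s \<ge> 0"
  shows "norm (npow s v - npow s m) \<le> norm s * norm (npow (s + 1) m)"
proof -
  have "norm (npow s v - npow s m) \<le> (norm s * norm (npow (s + 1) m)) * (v - m)"
  proof (rule norm_diff_le_vector_derivative)
    show "(npow s has_vector_derivative - s * npow (s+1) w) (at w within {m..v})" if "m \<le> w" for w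
      using that assms by (intro npow_has_vector_derivative) auto
    show "norm (- s * npow (s+1) w) \<le> norm s * norm (npow (s + 1) m)" if "m \<le> w" for w
      using norm_npow_mono[of m w "s+1"] that assms by (simp add: norm_mult mult_left_mono)
  qed (use assms in auto)
  also have "... \<le> (norm s * norm (npow (s + 1) m)) * 1"
    using assms by (intro mult_left_mono) auto
  finally show ?thesis by simp
qed

definition npow_prim :: "complex \<Rightarrow> real \<Rightarrow> complex" where
  "npow_prim s v = npow (s - 1) v / (1 - s)"

lemma npow_prim_has_vector_derivative:
  assumes "v > 0" "s \<noteq> 1"
  shows "(npow_prim s has_vector_derivative npow s v) (at v within A)"
proof -
  have "((\<lambda>v. (1 / (1 - s)) * npow (s - 1) v) has_vector_derivative (1 / (1 - s)) * (- (s - 1) * npow ((s - 1) + 1) v)) (at v within A)"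
    by (intro has_vector_derivative_mult_right npow_has_vector_derivative assms)
  moreover have "(1 / (1 - s)) * (- (s - 1) * npow ((s - 1) + 1) v) = npow s v" using assms by simp
  moreover have "npow_prim s = (\<lambda>v. (1 / (1 - s)) * npow (s - 1) v)" by (auto simp: npow_prim_def)
  ultimately show ?thesis by metis
qed

lemma npow_prim_step:
  assumes "0 < m" "Re s \<ge> 0" "s \<noteq> 1"
  shows "norm (npow_prim s (m + 1) - npow_prim s m - npow s m) \<le> norm s * norm (npow (s + 1) m)"
proof -
  have "norm (npow_prim s (m + 1) - npow_prim s m - ((m+1) - m) *\<^sub>R npow s m) \<le> norm ((m+1) - m) * (norm s * norm (npow (s + 1) m))"
  proof (rule vector_differentiable_bound_linearization[where S="{m..m+1}" and f'="npow s"])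
    show "norm (npow s x - npow s m) \<le> norm s * norm (npow (s + 1) m)" if "x \<in> {m..m+1}" for x
      using that assms by (intro npow_diff_bound) auto
  qed (use assms in \<open>auto intro!: npow_prim_has_vector_derivative simp: closed_segment_eq_real_ivl\<close>)
  thus ?thesis by simp
qed

text \<open>The right-hand side is what telescopes: with a, b the square roots of consecutive
  integers, 1/a - 1/b = 1/(a b (a+b)) >= 1/(2 b^3).\<close>

lemma sum_exp_three_halves_aux:
  "(\<Sum>n=1..Suc N. exp (- (3/2) * ln (real n))) \<le> 3 - 2 * exp (- (1/2) * ln (real (Suc N)))"
proof (induction N)
  case (Suc N)
  define m where "m = real (Suc N)"
  have m: "m \<ge> 1" by (simp add: m_def)
  define a b where "a = exp (1/2 * ln m)" and "b = exp (1/2 * ln (m + 1))"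
  have sq: "a^2 = m" "b^2 = m + 1" using m unfolding a_def b_def exp_double[symmetric] by simp_all
  have ab: "a > 0" "b > a" "b > 0" using m by (simp_all add: a_def b_def)
  have e: "exp (- (1/2) * ln m) = 1 / a" "exp (- (1/2) * ln (m + 1)) = 1 / b"
    unfolding a_def b_def inverse_eq_divide[symmetric] exp_minus[symmetric] by simp_all
  have "b ^ 3 = exp (3 * (1/2 * ln (m+1)))"
    unfolding b_def by (subst exp_of_nat_mult[symmetric]) simp
  hence e3: "exp (- (3/2) * ln (m+1)) = 1 / b ^ 3" by (simp add: exp_minus inverse_eq_divide)
  have "(1 / a - 1 / b) * (a * b * (a + b)) = (b - a) * (a + b)" using ab by (simp add: field_simps)
  also have "... = 1" using sq by (simp add: power2_eq_square algebra_simps)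
  finally have d: "1 / a - 1 / b = 1 / (a * b * (a + b))" using ab by (subst nonzero_eq_divide_eq) auto
  have "a * b * (a + b) \<le> b * b * (b + b)" using ab by (intro mult_mono) auto
  also have "... = 2 * b ^ 3" by (simp add: power3_eq_cube)
  finally have "1 / (2 * b ^ 3) \<le> 1 / (a * b * (a + b))" using ab by (intro divide_left_mono) auto
  hence "1 / b ^ 3 \<le> 2 * (1 / a - 1 / b)" unfolding d using ab by (simp add: field_simps)
  hence le: "3 - 2 * (1 / a) + 1 / b ^ 3 \<le> 3 - 2 * (1 / b)" by argo
  have "(\<Sum>n=1..Suc (Suc N). exp (- (3/2) * ln (real n))) \<le> 3 - 2 * (1 / a) + 1 / b ^ 3"
    using Suc unfolding e[symmetric] e3[symmetric] by (simp add: m_def add.commute)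
  also note le
  also have "1 / b = exp (- (1/2) * ln (real (Suc (Suc N))))"
    unfolding e[symmetric] by (simp add: m_def add.commute)
  finally show ?case .
qed auto

lemma sum_exp_three_halves: "(\<Sum>n=1..N. exp (- (3/2) * ln (real n))) \<le> 3"
  using sum_exp_three_halves_aux[of "N - 1"] by (cases N) (auto intro: order_trans)

text \<open>The primitive telescopes, and step n costs |s| n^(-Re s - 1) <= |s| n^(-3/2). The bound
  is uniform in N and reaches down to Re s = 1/2, so it serves both for the pole of zeta and for
  zeta sums at the central line.\<close>

lemma sum_npow_approx:
  assumes "Re s \<ge> 1/2" "s \<noteq> 1"
  shows "norm ((\<Sum>n=1..N. npow s (real n)) - (npow_prim s (real N + 1) - npow_prim s 1)) \<le> 3 * norm s"
proof -
  have tel: "(\<Sum>n=1..N. npow_prim s (real n + 1) - npow_prim s (real n)) = npow_prim s (real N + 1) - npow_prim s 1"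
    by (induction N) (auto simp: add.commute)
  have "norm ((\<Sum>n=1..N. npow s (real n)) - (npow_prim s (real N + 1) - npow_prim s 1)) =
        norm (\<Sum>n=1..N. npow_prim s (real n + 1) - npow_prim s (real n) - npow s (real n))"
    unfolding tel[symmetric] by (subst norm_minus_commute) (simp add: sum_subtractf)
  also have "... \<le> (\<Sum>n=1..N. norm s * norm (npow (s + 1) (real n)))"
    using assms by (intro sum_norm_le npow_prim_step) auto
  also have "... \<le> (\<Sum>n=1..N. norm s * exp (- (3/2) * ln (real n)))"
  proof (intro sum_mono mult_left_mono)
    fix n assume "n \<in> {1..N}"
    hence "(- Re (s + 1)) * ln (real n) \<le> (- (3/2)) * ln (real n)" using assms by (intro mult_right_mono) auto
    thus "norm (npow (s + 1) (real n)) \<le> exp (- (3/2) * ln (real n))" by (simp only: norm_npow exp_le_cancel_iff)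
  qed auto
  also have "... = norm s * (\<Sum>n=1..N. exp (- (3/2) * ln (real n)))" by (simp add: sum_distrib_left)
  also have "... \<le> norm s * 3" by (intro mult_left_mono sum_exp_three_halves) auto
  finally show ?thesis by simp
qed

lemma norm_half_sub_ge: "norm (1/2 + \<i> * of_real u) \<ge> 1/2"
  using abs_Re_le_cmod[of "1/2 + \<i> * of_real u"] by simp

text \<open>The main term is taken at the real endpoint \<open>v\<close> and not at its integer
  part, because it then scales exactly when \<open>v\<close> is divided by an integer;
  \<open>twisted_norm_lower\<close> relies on this.\<close>

lemma sum_npow_half:
  assumes "\<bar>u\<bar> \<le> 1" "v \<ge> 1"
  defines "s \<equiv> 1/2 - \<i> * of_real u"
  shows "norm ((\<Sum>n=1..nat \<lfloor>v\<rfloor>. npow s (real n)) - npow_prim s v) \<le> 9"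
proof -
  define N where "N = nat \<lfloor>v\<rfloor>"
  have N: "real N \<le> v" "v \<le> real N + 1" "N \<ge> 1" using assms by (simp_all add: N_def) linarith+
  have s: "Re s = 1/2" "s \<noteq> 1" by (auto simp: s_def complex_eq_iff)
  let ?D = "((\<Sum>n=1..N. npow s (real n)) - (npow_prim s (real N + 1) - npow_prim s 1))"
  have "norm s \<le> 1/2 + 1"
    using norm_triangle_ineq4[of "1/2" "\<i> * of_real u"] assms by (simp add: s_def norm_mult)
  hence "3 * norm s \<le> 3 * (3/2)" by simp
  moreover have "norm ?D \<le> 3 * norm s"
    using s by (intro sum_npow_approx) auto
  moreover have "norm (npow_prim s 1) \<le> 2"
    using norm_half_sub_ge[of u] by (simp add: npow_prim_def npow_def s_def norm_divide divide_le_eq)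
  \<comment> \<open>Moving the endpoint from N + 1 to v costs at most 1, as the derivative has norm
    at most 1 there. The total 9/2 + 1 + 2 is below 9.\<close>
  moreover have "norm (npow_prim s (real N + 1) - npow_prim s v) \<le> 1 * (real N + 1 - v)"
  proof (rule norm_diff_le_vector_derivative)
    show "(npow_prim s has_vector_derivative npow s w) (at w within {v..real N + 1})" if "v \<le> w" for w
      using that N s by (intro npow_prim_has_vector_derivative) auto
    show "norm (npow s w) \<le> 1" if "v \<le> w" for w
      using that N s by (simp add: norm_npow)
  qed (use N in auto)
  moreover have "norm ((\<Sum>n=1..N. npow s (real n)) - npow_prim s v) \<le> 
      norm ?D + norm (npow_prim s (real N + 1) - npow_prim s v)
      + norm (npow_prim s 1)"
  proof -
    have "(\<Sum>n=1..N. npow s (real n)) - npow_prim s v = 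
       ?D + (npow_prim s (real N + 1) - npow_prim s v) - npow_prim s 1"
      by simp
    also have "norm ... \<le> norm (?D + (npow_prim s (real N + 1) - npow_prim s v)) + norm (npow_prim s 1)"
      by (rule norm_triangle_ineq4)
    finally show ?thesis using norm_triangle_ineq order_trans add_right_mono by smt
  qed
  ultimately have "norm ((\<Sum>n=1..N. npow s (real n)) - npow_prim s v) \<le> 3 * (3/2) + 1 * (real N + 1 - v) + 2"
    by (meson add_mono order_trans mult_left_mono zero_le_numeral order.refl dual_order.trans)
  also have "... \<le> 9" using N by simp
  finally show ?thesis unfolding N_def .
qed

section \<open>Mean values of Dirichlet polynomials over [T, 2T]\<close>

lemma norm_integral_cis:
  assumes "\<theta> \<noteq> 0" "a \<le> b"
  shows "norm (integral {a..b} (\<lambda>t. cis (t * \<theta>))) \<le> 2 / \<bar>\<theta>\<bar>"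
proof -
  have "((\<lambda>t. cis (t * \<theta>)) has_integral (cis (b * \<theta>) / (\<i> * \<theta>) - cis (a * \<theta>) / (\<i> * \<theta>))) {a..b}"
  proof (rule fundamental_theorem_of_calculus)
    fix t
    have "((\<lambda>t. exp (\<i> * (t * \<theta>)) / (\<i> * \<theta>)) has_vector_derivative (exp (\<i> * (t * \<theta>)))) (at t within {a..b})"
      using assms by (auto intro!: derivative_eq_intros has_vector_derivative_real_field simp: field_simps)
    thus "((\<lambda>t. cis (t * \<theta>) / (\<i> * \<theta>)) has_vector_derivative cis (t * \<theta>)) (at t within {a..b})"
      by (simp add: cis_conv_exp)
  qed fact
  hence "integral {a..b} (\<lambda>t. cis (t * \<theta>)) = (cis (b * \<theta>) - cis (a * \<theta>)) / (\<i> * \<theta>)"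
    by (simp add: integral_unique diff_divide_distrib)
  also have "norm ... \<le> (1 + 1) / \<bar>\<theta>\<bar>"
    unfolding norm_divide
    by (intro frac_le order_trans[OF norm_triangle_ineq4]) (use assms in \<open>auto simp: norm_mult\<close>)
  finally show ?thesis by simp
qed

lemma harm_le_ln: "N \<ge> 1 \<Longrightarrow> harm N \<le> 1 + ln (real N)"
proof -
  have "decseq (\<lambda>n. harm (Suc n) - ln (Suc n))" by (rule decseq_harm_diff_ln)
  hence "harm (Suc n) - ln (Suc n) \<le> harm (Suc 0) - ln (Suc 0)" for n :: nat
    by (rule decseqD) simp
  from this[of "N - 1"] show "N \<ge> 1 \<Longrightarrow> harm N \<le> 1 + ln (real N)" by (cases N) (auto simp: harm_expand)
qed

lemma sum_inverse_dist:
  fixes S :: "nat set"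
  assumes "finite S" "\<And>n. n \<in> S \<Longrightarrow> 1 \<le> n \<and> n \<le> N" "m \<in> S"
  shows "(\<Sum>n\<in>S - {m}. 1 / \<bar>real m - real n\<bar>) \<le> 2 * harm N"
proof -
  have m: "1 \<le> m" "m \<le> N" using assms by auto
  have "(\<Sum>n\<in>S - {m}. 1 / \<bar>real m - real n\<bar>) \<le> (\<Sum>n\<in>{1..<m} \<union> {m<..N}. 1 / \<bar>real m - real n\<bar>)"
    using assms(2) by (intro sum_mono2) fastforce+
  also have "... = (\<Sum>n\<in>{1..<m}. 1 / \<bar>real m - real n\<bar>) + (\<Sum>n\<in>{m<..N}. 1 / \<bar>real m - real n\<bar>)"
    by (intro sum.union_disjoint) auto
  also have "(\<Sum>n\<in>{1..<m}. 1 / \<bar>real m - real n\<bar>) = (\<Sum>d\<in>{1..<m}. 1 / real d)"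
    by (rule sum.reindex_bij_witness[where i="\<lambda>d. m - d" and j="\<lambda>d. m - d"]) (auto simp: of_nat_diff)
  also have "... \<le> (\<Sum>d\<in>{1..N}. 1 / real d)" using m by (intro sum_mono2) auto
  also have "(\<Sum>n\<in>{m<..N}. 1 / \<bar>real m - real n\<bar>) = (\<Sum>d\<in>{1..N - m}. 1 / real d)"
    by (rule sum.reindex_bij_witness[where i="\<lambda>d. m + d" and j="\<lambda>d. d - m"]) (auto simp: of_nat_diff)
  also have "... \<le> (\<Sum>d\<in>{1..N}. 1 / real d)" using m by (intro sum_mono2) auto
  finally show ?thesis by (simp add: harm_def divide_inverse)
qed

lemma ln_diff_lower:
  assumes "1 \<le> m" "1 \<le> n" "real m \<le> Y" "real n \<le> Y"
  shows "\<bar>real m - real n\<bar> / Y \<le> \<bar>ln (real m) - ln (real n)\<bar>"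
proof -
  have *: "(a - b) / Y \<le> ln a - ln b" if "0 < b" "b \<le> a" "a \<le> Y" for a b :: real
  proof -
    have "ln (b / a) \<le> b / a - 1" using that by (intro ln_le_minus_one) auto
    hence "ln a - ln b \<ge> (a - b) / a" using that by (simp add: ln_div diff_divide_distrib)
    moreover have "(a - b) / a \<ge> (a - b) / Y" using that by (intro divide_left_mono) auto
    ultimately show ?thesis by linarith
  qed
  show ?thesis
    using *[of "real n" "real m"] *[of "real m" "real n"] assms
    by (cases "n \<le> m") (auto simp: abs_if ln_mono)
qed

text \<open>The diagonal gives the main term. Off the diagonal the integral is at most 2/|ln m - ln
  n| <= 2Y/|m-n|; then 2|a m||a n| <= |a m|^2 + |a n|^2 leaves a harmonic sum. The resulting
  logarithm is harmless, since the lengths in use are at most T^(11/20).\<close>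

theorem dirichlet_mean_value:
  fixes a :: "nat \<Rightarrow> complex"
  assumes S: "finite S" "\<And>n. n \<in> S \<Longrightarrow> 1 \<le> n \<and> real n \<le> Y" and T: "T > 0"
  shows "\<bar>integral {T..2*T} (\<lambda>t. (norm (\<Sum>n\<in>S. a n * cis (- t * ln (real n))))^2) - T * (\<Sum>n\<in>S. (norm (a n))^2)\<bar>
    \<le> 4 * Y * (1 + ln Y) * (\<Sum>n\<in>S. (norm (a n))^2)"
proof (cases "S = {}")
  case False
  then obtain n0 where "n0 \<in> S" by auto
  hence Y: "Y \<ge> 1" using S(2)[of n0] by linarith
  let ?q = "(\<Sum>n\<in>S. (norm (a n))^2)"
  let ?A = "(\<lambda>t. (norm (\<Sum>n\<in>S. a n * cis (- t * ln (real n))))^2)"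
  define N where "N = nat \<lfloor>Y\<rfloor>"
  have N: "N \<ge> 1" "real N \<le> Y" using Y by (auto simp: N_def) linarith+
  have SN: "1 \<le> n \<and> n \<le> N" if "n \<in> S" for n using S(2)[OF that] by (simp add: N_def le_nat_floor)
  have harmN: "harm N \<le> 1 + ln Y" 
    using harm_le_ln[of N] N ln_mono[of "real N" Y] by linarith
  define \<theta> where "\<theta> m n = ln (real n) - ln (real m)" for m n :: nat
  define I where "I m n = integral {T..2*T} (\<lambda>t. cis (t * \<theta> m n))" for m n
  have sq: "of_real ((norm (\<Sum>n\<in>S. a n * cis (- t * ln (real n))))^2) = 
     (\<Sum>m\<in>S. \<Sum>n\<in>S. a m * cnj (a n) * cis (t * \<theta> m n))" for t
    unfolding complex_norm_square
    by (simp add: sum_product cis_cnj mult_ac cis_mult \<theta>_def algebra_simps flip: sum_distrib_left)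
  have "((\<lambda>t. \<Sum>m\<in>S. \<Sum>n\<in>S. a m * cnj (a n) * cis (t * \<theta> m n)) has_integral (\<Sum>m\<in>S. \<Sum>n\<in>S. a m * cnj (a n) * I m n)) {T..2*T}"
    unfolding I_def
    by (intro has_integral_sum S(1) has_integral_mult_right integrable_integral integrable_continuous_real continuous_intros)
  hence 1: "((\<lambda>t. complex_of_real ((norm (\<Sum>n\<in>S. a n * cis (- t * ln (real n))))^2)) has_integral (\<Sum>m\<in>S. \<Sum>n\<in>S. a m * cnj (a n) * I m n)) {T..2*T}"
    by (simp only: sq)
  have 2: "?A integrable_on {T..2*T}"
    by (intro integrable_continuous_real continuous_intros)
  define J where "J = integral {T..2*T} ?A"
  have "((\<lambda>t. complex_of_real ((norm (\<Sum>n\<in>S. a n * cis (- t * ln (real n))))^2)) has_integral of_real J) {T..2*T}"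
    unfolding J_def by (rule has_integral_of_real) (rule integrable_integral[OF 2])
  with 1 have J: "of_real J = (\<Sum>m\<in>S. \<Sum>n\<in>S. a m * cnj (a n) * I m n)"
    by (rule has_integral_unique[rotated])
  have Idiag: "I m m = of_real T" for m using T by (simp add: I_def \<theta>_def scaleR_conv_of_real)
  have Ioff: "norm (I m n) \<le> 2 * Y / \<bar>real m - real n\<bar>" if "m \<in> S" "n \<in> S - {m}" for m n
  proof -
    have ne: "\<bar>real m - real n\<bar> > 0" using that by auto
    have l: "\<bar>real m - real n\<bar> / Y \<le> \<bar>\<theta> m n\<bar>"
      using ln_diff_lower[of m n Y] S(2) that by (auto simp: \<theta>_def abs_minus_commute)
    hence "\<bar>\<theta> m n\<bar> > 0" using ne Y by (smt (verit) divide_pos_pos)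
    hence "norm (I m n) \<le> 2 / \<bar>\<theta> m n\<bar>" unfolding I_def using T by (intro norm_integral_cis) auto
    also have "... \<le> 2 / (\<bar>real m - real n\<bar> / Y)" using l ne Y \<open>\<bar>\<theta> m n\<bar> > 0\<close> by (intro divide_left_mono mult_pos_pos divide_pos_pos) auto
    finally show ?thesis by simp
  qed
  have "of_real (J - T * ?q) = (\<Sum>m\<in>S. (\<Sum>n\<in>S. a m * cnj (a n) * I m n) - a m * cnj (a m) * I m m)"
  proof -
    have "of_real (T * ?q) = (\<Sum>m\<in>S. a m * cnj (a m) * I m m)"
      unfolding Idiag sum_distrib_right[symmetric] of_real_mult of_real_sum complex_norm_square by (rule mult.commute)
    thus ?thesis by (simp only: of_real_diff J sum_subtractf)
  qed
  also have "... = (\<Sum>m\<in>S. \<Sum>n\<in>S-{m}. a m * cnj (a n) * I m n)"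
    by (intro sum.cong refl) (simp add: sum.remove[OF S(1)])
  finally have *: "complex_of_real (J - T * ?q) = (\<Sum>m\<in>S. \<Sum>n\<in>S-{m}. a m * cnj (a n) * I m n)" .
  have "\<bar>J - T * ?q\<bar> = norm (\<Sum>m\<in>S. \<Sum>n\<in>S-{m}. a m * cnj (a n) * I m n)"
    by (simp only: *[symmetric] norm_of_real)
  also have "... \<le> (\<Sum>m\<in>S. \<Sum>n\<in>S-{m}. ((norm (a m))^2 + (norm (a n))^2) * (Y / \<bar>real m - real n\<bar>))"
  proof (intro sum_norm_le)
    fix m n assume mn: "m \<in> S" "n \<in> S - {m}"
    have "norm (a m * cnj (a n) * I m n) = norm (a m) * norm (a n) * norm (I m n)" by (simp add: norm_mult)
    also have "... \<le> norm (a m) * norm (a n) * (2 * Y / \<bar>real m - real n\<bar>)"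
      using mn by (intro mult_left_mono Ioff) auto
    also have "... = (2 * norm (a m) * norm (a n)) * (Y / \<bar>real m - real n\<bar>)" by simp
    also have "... \<le> ((norm (a m))^2 + (norm (a n))^2) * (Y / \<bar>real m - real n\<bar>)"
      using Y by (intro mult_right_mono sum_squares_bound) auto
    finally show "norm (a m * cnj (a n) * I m n) \<le> ..." .
  qed
  also have "... = (\<Sum>m\<in>S. \<Sum>n\<in>S-{m}. (norm (a m))^2 * (Y / \<bar>real m - real n\<bar>)) + (\<Sum>m\<in>S. \<Sum>n\<in>S-{m}. (norm (a n))^2 * (Y / \<bar>real m - real n\<bar>))"
    by (simp only: distrib_right sum.distrib)
  also have "(\<Sum>m\<in>S. \<Sum>n\<in>S-{m}. (norm (a n))^2 * (Y / \<bar>real m - real n\<bar>)) = (\<Sum>n\<in>S. \<Sum>m\<in>S-{n}. (norm (a n))^2 * (Y / \<bar>real n - real m\<bar>))"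
  proof -
    have "(\<Sum>m\<in>S. \<Sum>n\<in>{n. n \<in> S \<and> n \<noteq> m}. (norm (a n))^2 * (Y / \<bar>real m - real n\<bar>)) = (\<Sum>n\<in>S. \<Sum>m\<in>{m. m \<in> S \<and> n \<noteq> m}. (norm (a n))^2 * (Y / \<bar>real m - real n\<bar>))"
      by (rule sum.swap_restrict) (use S in auto)
    moreover have "{n. n \<in> S \<and> n \<noteq> m} = S - {m}" "{n. n \<in> S \<and> m \<noteq> n} = S - {m}" for m by auto
    ultimately show ?thesis by (simp add: abs_minus_commute)
  qed
  also have "(\<Sum>m\<in>S. \<Sum>n\<in>S-{m}. (norm (a m))^2 * (Y / \<bar>real m - real n\<bar>)) + ... = 2 * Y * (\<Sum>m\<in>S. (norm (a m))^2 * (\<Sum>n\<in>S-{m}. 1 / \<bar>real m - real n\<bar>))"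
    by (simp add: sum_distrib_left mult_ac)
  also have "... \<le> 2 * Y * (\<Sum>m\<in>S. (norm (a m))^2 * (2 * (1 + ln Y)))"
  proof (intro mult_left_mono sum_mono)
    fix m assume "m \<in> S"
    hence "(\<Sum>n\<in>S-{m}. 1 / \<bar>real m - real n\<bar>) \<le> 2 * harm N" using S(1) SN by (intro sum_inverse_dist) auto
    also have "... \<le> 2 * (1 + ln Y)" using harmN by simp
    finally show "(\<Sum>n\<in>S-{m}. 1 / \<bar>real m - real n\<bar>) \<le> 2 * (1 + ln Y)" .
  qed (use Y in auto)
  also have "... = 4 * Y * (1 + ln Y) * ?q" unfolding sum_distrib_right[symmetric] by simp
  finally show ?thesis unfolding J_def .
qed auto

text \<open>Hoelder's inequality by way of Young's inequality for the product (s f)(g/s), so that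
  only integrals of continuous functions occur and one-sided bounds \<open>A\<close>,
  \<open>B\<close> can stand for the two integrals.\<close>

theorem moment_lower_bound:
  fixes f g :: "real \<Rightarrow> real"
  assumes k: "k > 1" and cont: "continuous_on {a..b} f" "continuous_on {a..b} g"
    and nonneg: "\<And>t. f t \<ge> 0" "\<And>t. g t \<ge> 0"
    and AB: "A > 0" "B > 0" "integral {a..b} (\<lambda>t. f t * g t) \<ge> A"
      "integral {a..b} (\<lambda>t. g t powr (k / (k - 1))) \<le> B"
  shows "A powr k / B powr (k - 1) \<le> integral {a..b} (\<lambda>t. f t powr k)"
proof -
  define q where "q = k / (k - 1)"
  have q: "q > 1" "1 / k + 1 / q = 1" using k by (auto simp: q_def field_simps)
  \<comment> \<open>This scale makes s^(-q) B = A: the g-term is then at most A/q, and A (1 - 1/q) =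
    A/k is left for the f-term.\<close>
  define s where "s = (A / B) powr (- 1 / q)"
  have s: "s > 0" using AB by (simp add: s_def)
  have int: "(\<lambda>t. f t powr k) integrable_on {a..b}" "(\<lambda>t. g t powr q) integrable_on {a..b}" "(\<lambda>t. f t * g t) integrable_on {a..b}"
    using cont nonneg k q by (auto intro!: integrable_continuous_real continuous_intros continuous_on_powr')
  have int': "(\<lambda>t. c * f t powr k) integrable_on {a..b}" "(\<lambda>t. c * g t powr q) integrable_on {a..b}" for c
    using integrable_on_cmult_left[OF int(1), of c] integrable_on_cmult_left[OF int(2), of c] by simp_all
  have "A \<le> integral {a..b} (\<lambda>t. f t * g t)" by fact
  also have "... \<le> integral {a..b} (\<lambda>t. (s powr k / k) * f t powr k + (s powr (-q) / q) * g t powr q)"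
  proof (rule integral_le)
    fix t
    have "f t * g t = (s * f t) * (g t / s)" using s by simp
    also have "... \<le> (s * f t) powr k / k + (g t / s) powr q / q"
      by (rule Youngs_inequality) (use k q s nonneg in auto)
    also have "... = (s powr k / k) * f t powr k + (s powr (-q) / q) * g t powr q"
      using s nonneg by (simp add: powr_mult powr_divide powr_minus field_simps)
    finally show "f t * g t \<le> (s powr k / k) * f t powr k + (s powr (-q) / q) * g t powr q" .
  qed (rule int(3), rule integrable_add[OF int'(1) int'(2)])
  also have "... = (s powr k / k) * integral {a..b} (\<lambda>t. f t powr k) + (s powr (-q) / q) * integral {a..b} (\<lambda>t. g t powr q)"
    by (subst integral_add[OF int'(1) int'(2)]) (simp only: integral_mult_right)
  also have "(s powr (-q) / q) * integral {a..b} (\<lambda>t. g t powr q) \<le> (s powr (-q) / q) * B"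
    using AB(4) q(1) unfolding q_def[symmetric] by (intro mult_left_mono) auto
  also have "s powr (-q) = A / B" using AB q by (simp add: s_def powr_powr)
  finally have "A * (1 - 1 / q) \<le> (s powr k / k) * integral {a..b} (\<lambda>t. f t powr k)"
    using AB by (simp add: algebra_simps)
  also have "1 - 1 / q = 1 / k" using q by simp
  finally have "A * s powr (-k) \<le> integral {a..b} (\<lambda>t. f t powr k)"
    using k s by (simp add: powr_minus field_simps)
  moreover have "s powr (-k) = (A / B) powr (k - 1)"
    using k AB by (simp add: s_def powr_powr q_def)
  moreover have "A * (A / B) powr (k - 1) = A powr k / B powr (k - 1)"
    using AB k by (simp add: powr_divide powr_diff)
  ultimately show ?thesis by simp
qed

section \<open>Sums over primes\<close>

definition primes_upto :: "real \<Rightarrow> nat set" where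
  "primes_upto z = {p. prime p \<and> real p \<le> z}"

lemma finite_primes_upto [simp]: "finite (primes_upto z)"
proof (rule finite_subset)
  show "primes_upto z \<subseteq> {..nat \<lceil>z\<rceil>}" by (auto simp: primes_upto_def) linarith
qed auto

lemma primes_uptoD: "p \<in> primes_upto z \<Longrightarrow> prime p" by (simp add: primes_upto_def)

lemma primes_upto_ge_1: "p \<in> primes_upto z \<Longrightarrow> p \<ge> 1"
  using prime_ge_1_nat primes_uptoD by blast

lemma npow_mult: "m > 0 \<Longrightarrow> n > 0 \<Longrightarrow> npow s (real (m * n)) = npow s (real m) * npow s (real n)"
  by (simp add: npow_def ln_mult distrib_left exp_add[symmetric])

abbreviation nsum :: "complex \<Rightarrow> nat set \<Rightarrow> complex" where
  "nsum s A \<equiv> infsum (\<lambda>n. npow s (real n)) A"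

abbreviation eprod :: "complex \<Rightarrow> real \<Rightarrow> complex" where
  "eprod s z \<equiv> \<Prod>p\<in>primes_upto z. 1 - npow s (real p)"

lemma npow_1 [simp]: "npow s 1 = 1" by (simp add: npow_def)

lemma summable_on_norm_npow:
  assumes "Re s > 1" "A \<subseteq> {1..}"
  shows "(\<lambda>n. norm (npow s (real n))) summable_on A"
proof -
  have "summable (\<lambda>n. real n powr (- Re s))" using assms by (simp add: summable_real_powr_iff)
  hence "(\<lambda>n. real n powr (- Re s)) summable_on UNIV"
    by (intro norm_summable_imp_summable_on) auto
  hence "(\<lambda>n. real n powr (- Re s)) summable_on A" by (rule summable_on_subset_banach) auto
  also have "?this \<longleftrightarrow> (\<lambda>n. norm (npow s (real n))) summable_on A"
    using assms by (intro summable_on_cong) (auto simp: norm_npow powr_def)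
  finally show ?thesis .
qed

lemma summable_on_npow:
  assumes "Re s > 1" "A \<subseteq> {1..}"
  shows "(\<lambda>n. npow s (real n)) summable_on A"
  using summable_on_norm_npow[OF assms] by (rule abs_summable_summable)

section \<open>Sieving by primes and the Euler product\<close>

definition rough :: "nat set \<Rightarrow> nat set" where
  "rough A = {n. n > 0 \<and> (\<forall>p\<in>A. \<not> p dvd n)}"

text \<open>One step of the sieve of Eratosthenes: the multiples of \<open>p\<close> in
  \<open>rough A\<close> are \<open>p\<close> times the elements of \<open>rough A\<close>, since no
  prime of \<open>A\<close> divides \<open>p\<close>.\<close>

lemma infsum_rough_insert:
  assumes "Re s > 1" "prime p" "p \<notin> A" "\<And>q. q \<in> A \<Longrightarrow> prime q"
  shows "nsum s (rough (insert p A)) = (1 - npow s (real p)) * nsum s (rough A)"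
proof -
  have p: "p > 0" using assms(2) by (simp add: prime_gt_0_nat)
  have eq: "rough A = rough (insert p A) \<union> (\<lambda>n. p * n) ` rough A"
  proof (intro equalityI subsetI)
    fix n assume n: "n \<in> rough A"
    show "n \<in> rough (insert p A) \<union> (\<lambda>n. p * n) ` rough A"
    proof (cases "p dvd n")
      case True
      then obtain m where m: "n = p * m" by auto
      hence "m \<in> rough A" using n p by (auto simp: rough_def)
      thus ?thesis using m by auto
    qed (use n in \<open>auto simp: rough_def\<close>)
  next
    fix n assume "n \<in> rough (insert p A) \<union> (\<lambda>n. p * n) ` rough A"
    thus "n \<in> rough A"
    proof
      assume "n \<in> (\<lambda>n. p * n) ` rough A"
      then obtain m where m: "n = p * m" "m \<in> rough A" by auto
      have "\<not> q dvd p" if "q \<in> A" for q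
        using assms(3) assms(4)[OF that] assms(2) that primes_dvd_imp_eq by blast
      thus ?thesis using m p assms(4) by (auto simp: rough_def prime_dvd_mult_iff)
    qed (auto simp: rough_def)
  qed
  have sub: "rough B \<subseteq> {1..}" for B by (auto simp: rough_def)
  have sub': "(\<lambda>n. p * n) ` rough A \<subseteq> {1..}" using p by (auto simp: rough_def)
  have "nsum s (rough A) = nsum s (rough (insert p A)) +
     nsum s ((\<lambda>n. p * n) ` rough A)"
    by (subst eq, rule infsum_Un_disjoint)
       (use sub sub' assms in \<open>auto intro!: summable_on_npow simp: rough_def\<close>)
  also have "nsum s ((\<lambda>n. p * n) ` rough A) = infsum (\<lambda>n. npow s (real (p * n))) (rough A)"
    by (subst infsum_reindex) (use p in \<open>auto simp: inj_on_def o_def\<close>)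
  also have "... = infsum (\<lambda>n. npow s (real p) * npow s (real n)) (rough A)"
    by (intro infsum_cong npow_mult) (use p in \<open>auto simp: rough_def\<close>)
  also have "... = npow s (real p) * nsum s (rough A)"
    by (rule infsum_cmult_right')
  finally show ?thesis by (simp add: algebra_simps)
qed

lemma infsum_rough:
  assumes "Re s > 1" "finite A" "\<And>q. q \<in> A \<Longrightarrow> prime q"
  shows "nsum s (rough A) = (\<Prod>p\<in>A. 1 - npow s (real p)) * nsum s {1..}"
  using assms(2,3)
proof (induction A)
  case empty
  have "rough {} = {1..}" by (auto simp: rough_def)
  thus ?case by simp
next
  case (insert p A)
  thus ?case using infsum_rough_insert[OF assms(1), of p A] by simp
qed

text \<open>Sieving by the primes up to z removes every n with 1 < n <= z, as n has a prime factor
  up to z. Once z passes the maximum of a finite set \<open>X\<close> carrying all but 1/2 of the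
  absolute sum, only 1 and a tail below 1/2 survive. Existence of z0 suffices because later sums are
  extended to a z as large as needed.\<close>

lemma euler_product_limit:
  assumes "Re s > 1"
  shows "\<exists>z0. \<forall>z\<ge>z0. norm (eprod s z * nsum s {1..} - 1) \<le> 1/2"
proof -
  define f where "f n = norm (npow s (real n))" for n :: nat
  have sf: "f summable_on {1..}" unfolding f_def using assms by (intro summable_on_norm_npow) auto
  have "(f has_sum infsum f {1..}) {1..}" using sf by (rule has_sum_infsum)
  hence "\<forall>\<^sub>F X in finite_subsets_at_top {1..}. dist (sum f X) (infsum f {1..}) < 1/2"
    unfolding has_sum_def by (rule tendstoD) auto
  then obtain X where X: "finite X" "X \<subseteq> {1..}" "dist (sum f X) (infsum f {1..}) < 1/2"
    unfolding eventually_finite_subsets_at_top by blast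
  define z0 where "z0 = real (Max (insert 1 X))"
  show ?thesis
  proof (intro exI[of _ z0] allI impI)
    fix z assume z: "z \<ge> z0"
    let ?A = "primes_upto z"
    have A: "1 \<in> rough ?A" by (auto simp: rough_def primes_upto_def)
    have disj: "n \<notin> X" if "n \<in> rough ?A - {1}" for n
    proof
      assume "n \<in> X"
      hence "n \<le> Max (insert 1 X)" using X by auto
      hence "real n \<le> z" using z by (simp add: z0_def)
      have "n \<noteq> 1" using that by auto
      then obtain p where "prime p" "p dvd n" using prime_factor_nat by blast
      moreover from this have "p \<le> n" using that by (auto simp: rough_def intro: dvd_imp_le)
      ultimately show False using that \<open>real n \<le> z\<close> by (auto simp: rough_def primes_upto_def)
    qed
    have rs: "rough ?A \<subseteq> {1..}" by (auto simp: rough_def)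
    have "eprod s z * nsum s {1..} = nsum s (rough ?A)"
      using assms by (intro infsum_rough[symmetric]) (auto dest: primes_uptoD)
    also have "rough ?A = {1} \<union> (rough ?A - {1})" using A by auto
    also have "nsum s ... = nsum s {1} + nsum s (rough ?A - {1})"
      by (rule infsum_Un_disjoint) (use rs assms in \<open>auto intro!: summable_on_npow\<close>)
    finally have "norm (eprod s z * nsum s {1..} - 1) = norm (nsum s (rough ?A - {1}))"
      by simp
    also have "... \<le> infsum f (rough ?A - {1})"
      unfolding f_def by (rule norm_infsum_bound) (rule summable_on_subset_banach[OF sf[unfolded f_def]], use rs in auto)
    also have "... \<le> infsum f ({1..} - X)"
    proof (rule infsum_mono_neutral)
      show "f summable_on rough ?A - {1}" "f summable_on {1..} - X"
        by (rule summable_on_subset_banach[OF sf], use rs in auto)+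
    qed (use rs disj in \<open>auto simp: f_def\<close>)
    also have "... = infsum f {1..} - infsum f X"
      by (rule infsum_Diff) (use sf X in \<open>auto intro: summable_on_subset_banach\<close>)
    also have "... \<le> 1/2" using X by (simp add: dist_real_def abs_if split: if_splits)
    finally show "norm (eprod s z * nsum s {1..} - 1) \<le> 1/2" .
  qed
qed

lemma zeta_approx:
  assumes "Re s > 1"
  shows "norm (nsum s {1..} - 1 / (s - 1)) \<le> 3 * norm s"
proof -
  have s: "s \<noteq> 1" using assms by auto
  have hs: "((\<lambda>n. npow s (real n)) has_sum nsum s {1..}) {1..}"
    using assms by (intro has_sum_infsum summable_on_npow) auto
  have "((\<lambda>n. npow s (real n)) has_sum nsum s {1..}) {1..} \<longleftrightarrow>
    ((\<lambda>n. npow s (real (Suc n))) has_sum nsum s {1..}) UNIV"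
    by (rule has_sum_reindex_bij_witness[where i=Suc and j = "\<lambda>n. n - 1"]) auto
  with hs have "((\<lambda>n. npow s (real (Suc n))) has_sum nsum s {1..}) UNIV" by blast
  hence "(\<lambda>n. npow s (real (Suc n))) sums nsum s {1..}" by (rule has_sum_imp_sums)
  hence "(\<lambda>N. \<Sum>n<N. npow s (real (Suc n))) \<longlonglongrightarrow> nsum s {1..}" by (simp add: sums_def)
  moreover have "(\<Sum>n<N. npow s (real (Suc n))) = (\<Sum>n=1..N. npow s (real n))" for N
    by (rule sum.reindex_bij_witness[where i="\<lambda>n. n - 1" and j = Suc]) auto
  ultimately have l1: "(\<lambda>N. \<Sum>n=1..N. npow s (real n)) \<longlonglongrightarrow> nsum s {1..}" by simp
  have "(\<lambda>N. exp (- (Re s - 1) * ln (real N + 1))) \<longlonglongrightarrow> 0"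
    using assms by real_asymp
  hence "(\<lambda>N. norm (npow (s - 1) (real N + 1))) \<longlonglongrightarrow> 0" by (simp add: norm_npow)
  hence "(\<lambda>N. npow (s - 1) (real N + 1)) \<longlonglongrightarrow> 0" by (rule tendsto_norm_zero_cancel)
  hence l2: "(\<lambda>N. npow_prim s (real N + 1)) \<longlonglongrightarrow> 0 / (1 - s)" unfolding npow_prim_def
    using s by (intro tendsto_divide tendsto_const) auto
  have "(\<lambda>N. norm ((\<Sum>n=1..N. npow s (real n)) - (npow_prim s (real N + 1) - npow_prim s 1))) \<longlonglongrightarrow>
      norm (nsum s {1..} - (0 / (1 - s) - npow_prim s 1))"
    by (intro tendsto_intros l1 l2)
  hence "norm (nsum s {1..} - (0 / (1 - s) - npow_prim s 1)) \<le> 3 * norm s"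
    by (rule LIMSEQ_le_const2) (intro exI allI impI sum_npow_approx, use assms s in auto)
  moreover have "0 / (1 - s) - npow_prim s 1 = 1 / (s - 1)" using s by (simp add: npow_prim_def field_simps)
  ultimately show ?thesis by metis
qed

text \<open>Only n^(-2) <= n^(-3/2) is used, so any positive integers are allowed;
  \<open>sum_inverse_bden\<close> and \<open>sum_inverse_max_squares\<close> apply it to sums over
  all integers of a range.\<close>

lemma sum_inverse_squares_primes: "finite A \<Longrightarrow> (\<And>p. p \<in> A \<Longrightarrow> p \<ge> 1) \<Longrightarrow> (\<Sum>p\<in>A. 1 / (real p)^2) \<le> 3"
proof -
  assume A: "finite A" "\<And>p. p \<in> A \<Longrightarrow> p \<ge> 1"
  define N where "N = Max (insert 1 A)"
  have "(\<Sum>p\<in>A. 1 / (real p)^2) \<le> (\<Sum>p\<in>A. exp (- (3/2) * ln (real p)))"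
  proof (intro sum_mono)
    fix p assume p: "p \<in> A"
    hence "ln (real p) \<ge> 0" using A(2)[OF p] by simp
    hence "- (2 * ln (real p)) \<le> - (3/2) * ln (real p)" by simp
    hence "exp (- (2 * ln (real p))) \<le> exp (- (3/2) * ln (real p))" by (simp only: exp_le_cancel_iff)
    moreover have "exp (- (2 * ln (real p))) = 1 / (real p)^2"
      using A(2)[OF p] by (simp add: exp_minus exp_double inverse_eq_divide)
    ultimately show "1 / (real p)^2 \<le> exp (- (3/2) * ln (real p))" by simp
  qed
  also have "... \<le> (\<Sum>n=1..N. exp (- (3/2) * ln (real n)))"
    using A by (intro sum_mono2) (auto simp: N_def)
  also have "... \<le> 3" by (rule sum_exp_three_halves)
  finally show ?thesis .
qed

text \<open>From |1-z|^2 = 1 - 2 Re z + |z|^2 <= exp (- 2 Re z + |z|^2), which avoids choosing a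
  branch of the complex logarithm.\<close>

lemma exp_sum_Re_mult_norm_prod_le: 
  fixes f :: "'a \<Rightarrow> complex"
  assumes "finite A" "\<And>p. p \<in> A \<Longrightarrow> norm (f p) < 1"
  shows "exp (\<Sum>p\<in>A. Re (f p)) * norm (\<Prod>p\<in>A. 1 - f p) \<le> exp ((\<Sum>p\<in>A. (norm (f p))^2) / 2)"
proof -
  have *: "exp (Re z) * norm (1 - z) \<le> exp ((norm z)^2 / 2)" for z :: complex
  proof -
    have "(norm (1 - z))^2 = 1 + (- 2 * Re z + (norm z)^2)"
      unfolding cmod_power2 by (simp add: power2_eq_square algebra_simps)
    also have "... \<le> exp (- 2 * Re z + (norm z)^2)" by (rule exp_ge_add_one_self)
    also have "... = (exp (- Re z + (norm z)^2 / 2))^2" by (simp flip: exp_double)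
    finally have "norm (1 - z) \<le> exp (- Re z + (norm z)^2 / 2)" by (rule power2_le_imp_le) simp
    hence "exp (Re z) * norm (1 - z) \<le> exp (Re z) * exp (- Re z + (norm z)^2 / 2)" by (intro mult_left_mono) auto
    thus ?thesis by (simp flip: exp_add)
  qed
  have "exp (\<Sum>p\<in>A. Re (f p)) * norm (\<Prod>p\<in>A. 1 - f p) = (\<Prod>p\<in>A. exp (Re (f p)) * norm (1 - f p))"
    using assms(1) by (simp add: exp_sum prod_norm prod.distrib)
  also have "... \<le> (\<Prod>p\<in>A. exp ((norm (f p))^2 / 2))" by (intro prod_mono conjI *) auto
  also have "... = exp ((\<Sum>p\<in>A. (norm (f p))^2) / 2)" using assms(1) by (simp add: exp_sum sum_divide_distrib)
  finally show ?thesis .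
qed

section \<open>Prime sums with the smooth weight p^(-\<tau>)\<close>

definition pexp :: "real \<Rightarrow> nat \<Rightarrow> real" where
  "pexp \<tau> p = exp (- (1 + \<tau>) * ln (real p))"

text \<open>\<open>pexp \<tau> p\<close> is p^(-1-\<tau>), and \<open>pdec \<tau> p\<close> =
  p^(-\<tau>) acts as a smooth cutoff: for \<tau> = 1/l it is at least 1/e up to ln p = l and at
  most 1/e beyond.\<close>

definition pdec :: "real \<Rightarrow> nat \<Rightarrow> real" where
  "pdec \<tau> p = exp (- \<tau> * ln (real p))"

lemma pexp_nonneg [simp]: "pexp \<tau> p \<ge> 0" by (simp add: pexp_def)

lemma pexp_eq: "p \<ge> 1 \<Longrightarrow> pexp \<tau> p = pdec \<tau> p / real p"
proof -
  assume "p \<ge> 1"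
  hence "exp (- ln (real p)) = 1 / real p" by (simp add: exp_minus inverse_eq_divide)
  moreover have "pexp \<tau> p = exp (- ln (real p)) * exp (- \<tau> * ln (real p))"
    unfolding pexp_def by (simp add: algebra_simps flip: exp_add)
  ultimately show ?thesis by (simp add: pdec_def)
qed

lemma pexp_mult_pdec: "pexp \<tau> p * pdec \<tau> p = pexp (2 * \<tau>) p"
  by (simp add: pexp_def pdec_def algebra_simps flip: exp_add)

lemma pdec_le_1: "p \<ge> 1 \<Longrightarrow> \<tau> \<ge> 0 \<Longrightarrow> pdec \<tau> p \<le> 1"
  by (simp add: pdec_def)

lemma pexp_le_inverse: "p \<ge> 1 \<Longrightarrow> \<tau> \<ge> 0 \<Longrightarrow> pexp \<tau> p \<le> 1 / real p"
  using pdec_le_1[of p \<tau>] by (simp add: pexp_eq divide_right_mono)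

lemma sum_norm_npow_primes:
  assumes "Re s \<ge> 1"
  shows "(\<Sum>p\<in>primes_upto z. (norm (npow s (real p)))^2) \<le> 3"
proof -
  let ?P = "primes_upto z"
  have "(\<Sum>p\<in>?P. (norm (npow s (real p)))^2) \<le> (\<Sum>p\<in>?P. 1 / (real p)^2)"
  proof (intro sum_mono)
    fix p assume "p \<in> ?P"
    hence p: "p \<ge> 1" by (rule primes_upto_ge_1)
    have "norm (npow s (real p)) \<le> 1 / real p" using pexp_le_inverse[OF p, of "Re s - 1"] assms by (simp add: norm_npow pexp_def)
    hence "(norm (npow s (real p)))^2 \<le> (1 / real p)^2" by (intro power_mono) auto
    thus "(norm (npow s (real p)))^2 \<le> 1 / (real p)^2" by (simp add: power_divide)
  qed
  also have "... \<le> 3" by (rule sum_inverse_squares_primes) (auto dest: primes_upto_ge_1)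
  finally show ?thesis .
qed

text \<open>An upper bound for the prime sum needs a lower bound for the finite product
  \<open>E\<close> of 1 - p^(-s). As E times zeta is near 1, this is an upper bound for zeta, and
  the pole term 1/(s-1) supplies it while |s-1| stays bounded.\<close>

lemma prime_sum_cos_upper:
  assumes "0 < \<sigma>" "\<sigma> \<le> 2" "\<bar>w\<bar> \<le> 1"
  shows "\<exists>z0. \<forall>z\<ge>z0. (\<Sum>p\<in>primes_upto z. pexp \<sigma> p * cos (w * ln (real p))) \<le> - ln (norm (Complex \<sigma> w)) + 80"
proof -
  define s where "s = Complex (1 + \<sigma>) w"
  have s: "Re s > 1" using assms by (simp add: s_def)
  define Z where "Z = nsum s {1..}"
  obtain z0 where z0: "\<And>z. z \<ge> z0 \<Longrightarrow> norm (eprod s z * Z - 1) \<le> 1/2"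
    using euler_product_limit[OF s] unfolding Z_def by blast
  have s1: "s - 1 = Complex \<sigma> w" by (simp add: s_def complex_eq_iff)
  have pos: "norm (Complex \<sigma> w) > 0" using assms by (simp add: complex_eq_iff)
  have n3: "norm (Complex \<sigma> w) \<le> 3" using cmod_le[of "Complex \<sigma> w"] assms by simp
  have "norm s \<le> 4" using cmod_le[of s] assms by (simp add: s_def)
  hence "norm (Z - 1 / (s - 1)) \<le> 12" using zeta_approx[OF s] by (simp add: Z_def)
  hence "norm Z \<le> 1 / norm (s - 1) + 12"
    using norm_triangle_sub[of Z "1 / (s - 1)"] by (simp add: norm_divide)
  \<comment> \<open>37 = 1 + 12 * 3, with 12 the error in zeta and 3 the bound for |s-1|; the 74
    below is its double.\<close>
  also have "... \<le> 37 / norm (Complex \<sigma> w)" unfolding s1 using pos n3 by (simp add: field_simps)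
  finally have Z: "norm Z \<le> 37 / norm (Complex \<sigma> w)" .
  show ?thesis
  proof (intro exI[of _ z0] allI impI)
    fix z assume "z \<ge> z0"
    let ?P = "primes_upto z"
    define E where "E = eprod s z"
    have "norm (E * Z - 1) \<le> 1/2" using z0[OF \<open>z \<ge> z0\<close>] by (simp add: E_def)
    moreover have "1 \<le> norm (E * Z) + norm (E * Z - 1)"
      using norm_triangle_ineq4[of "E * Z" "E * Z - 1"] by simp
    ultimately have "1/2 \<le> norm E * norm Z" by (simp add: norm_mult)
    also have "... \<le> norm E * (37 / norm (Complex \<sigma> w))" using Z by (intro mult_left_mono) auto
    finally have E: "norm (Complex \<sigma> w) / 74 \<le> norm E" using pos by (simp add: field_simps)
    have re: "Re (npow s (real p)) = pexp \<sigma> p * cos (w * ln (real p))" for p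
      by (simp add: npow_def s_def Re_exp pexp_def algebra_simps)
    have "exp (\<Sum>p\<in>?P. Re (npow s (real p))) * norm E \<le> exp ((\<Sum>p\<in>?P. (norm (npow s (real p)))^2) / 2)"
      unfolding E_def
    proof (rule exp_sum_Re_mult_norm_prod_le)
      fix p assume "p \<in> ?P"
      hence "ln (real p) > 0" using prime_gt_1_nat[of p] by (simp add: primes_upto_def)
      thus "norm (npow s (real p)) < 1" using s by (simp add: norm_npow)
    qed auto
    also have "... \<le> exp (3 / 2)" using sum_norm_npow_primes[of s z] s by simp
    finally have "exp (\<Sum>p\<in>?P. Re (npow s (real p))) * norm E \<le> exp (3/2)" .
    hence "exp (\<Sum>p\<in>?P. Re (npow s (real p))) * (norm (Complex \<sigma> w) / 74) \<le> exp (3/2)"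
      using E by (meson exp_ge_zero mult_left_mono order_trans)
    also have "exp (3/2 :: real) \<le> exp 80 / 74"
    proof -
      have "74 \<le> exp (157/2 :: real)" using exp_ge_add_one_self[of "157/2"] by linarith
      hence "exp (3/2) * 74 \<le> exp (3/2) * exp (157/2 :: real)" by simp
      thus ?thesis by (simp flip: exp_add)
    qed
    finally have "exp (\<Sum>p\<in>?P. Re (npow s (real p))) \<le> exp 80 / norm (Complex \<sigma> w)" using pos by (simp add: field_simps)
    hence "ln (exp (\<Sum>p\<in>?P. Re (npow s (real p)))) \<le> ln (exp 80 / norm (Complex \<sigma> w))" using pos by (subst ln_le_cancel_iff) auto
    also have "... = 80 - ln (norm (Complex \<sigma> w))" using pos by (subst ln_div) auto
    finally show "(\<Sum>p\<in>?P. pexp \<sigma> p * cos (w * ln (real p))) \<le> - ln (norm (Complex \<sigma> w)) + 80"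
      by (simp add: re)
  qed
qed


lemma zeta_real_lower:
  assumes "0 < \<tau>" "\<tau> \<le> 2"
  shows "norm (nsum (of_real (1 + \<tau>)) {1..}) \<ge> 1 / (10 * \<tau>)"
proof -
  define s where "s = complex_of_real (1 + \<tau>)"
  define Z where "Z = nsum s {1..}"
  have s: "Re s > 1" using assms by (simp add: s_def)
  have eq: "npow s (real n) = of_real (pexp \<tau> n)" for n by (simp add: npow_def s_def pexp_def flip: exp_of_real)
  have sm: "(\<lambda>n. pexp \<tau> n) summable_on {1..}"
    using summable_on_norm_npow[OF s, of "{1..}"] by (simp add: norm_npow s_def pexp_def)
  have "norm (Z - 1 / (s - 1)) \<le> 3 * norm s" unfolding Z_def by (rule zeta_approx[OF s])
  also have "norm s = 1 + \<tau>" using assms unfolding s_def norm_of_real by simp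
  finally have "norm (1 / (s - 1)) \<le> norm Z + 3 * (1 + \<tau>)"
    using norm_triangle_ineq4[of Z "Z - 1 / (s - 1)"] by simp
  moreover have "norm (1 / (s - 1)) = 1 / \<tau>" using assms by (simp add: s_def norm_divide)
  ultimately have 1: "norm Z \<ge> 1 / \<tau> - 9" using assms by simp
  have "Z = of_real (infsum (\<lambda>n. pexp \<tau> n) {1..})"
    unfolding Z_def eq using has_sum_of_real[OF has_sum_infsum[OF sm]] by (rule infsumI)
  moreover have "infsum (\<lambda>n. pexp \<tau> n) {1} \<le> infsum (\<lambda>n. pexp \<tau> n) {1..}"
    by (rule infsum_mono_neutral) (use sm in auto)
  ultimately have 2: "norm Z \<ge> 1" by (simp add: pexp_def)
  \<comment> \<open>The two bounds combine as 10 |Z| >= (1/\<tau> - 9) + 9 * 1 = 1/\<tau>; the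
    trivial one is there for \<tau> away from 0.\<close>
  have "1 / (10 * \<tau>) = (1 / \<tau>) / 10" by simp
  thus ?thesis using 1 2 unfolding Z_def s_def by linarith
qed

lemma prime_sum_lower:
  assumes "0 < \<tau>" "\<tau> \<le> 2"
  shows "\<exists>z0. \<forall>z\<ge>z0. (\<Sum>p\<in>primes_upto z. pexp \<tau> p) \<ge> - ln \<tau> - 20"
proof -
  define s where "s = complex_of_real (1 + \<tau>)"
  define Z where "Z = nsum s {1..}"
  have s: "Re s > 1" using assms by (simp add: s_def)
  have eq: "npow s (real n) = of_real (pexp \<tau> n)" for n by (simp add: npow_def s_def pexp_def flip: exp_of_real)
  obtain z0 where z0: "\<And>z. z \<ge> z0 \<Longrightarrow> norm (eprod s z * Z - 1) \<le> 1/2"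
    using euler_product_limit[OF s] unfolding Z_def by blast
  have Z: "norm Z \<ge> 1 / (10 * \<tau>)" unfolding Z_def s_def by (rule zeta_real_lower[OF assms])
  show ?thesis
  proof (intro exI[of _ z0] allI impI)
    fix z assume "z \<ge> z0"
    let ?P = "primes_upto z"
    define E where "E = (\<Prod>p\<in>?P. 1 - pexp \<tau> p)"
    have small: "0 \<le> pexp \<tau> p \<and> pexp \<tau> p \<le> 1/2" if "p \<in> ?P" for p
    proof -
      have p: "p \<ge> 2" using that by (auto simp: primes_upto_def prime_ge_2_nat)
      hence "pexp \<tau> p \<le> 1 / real p" using assms by (intro pexp_le_inverse) auto
      also have "... \<le> 1/2" using p by (intro divide_left_mono) auto
      finally show ?thesis by simp
    qed
    have E0: "E > 0" unfolding E_def by (intro prod_pos) (auto dest!: small)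
    have "eprod s z = of_real E" by (simp add: E_def eq)
    hence "norm (of_real E * Z - 1) \<le> 1/2" using z0[OF \<open>z \<ge> z0\<close>] by simp
    hence "norm (of_real E * Z) \<le> 3/2" using norm_triangle_sub[of "of_real E * Z" 1] by simp
    hence "E * norm Z \<le> 3/2" using E0 by (simp add: norm_mult)
    moreover have "E * norm Z \<ge> E * (1 / (10 * \<tau>))" using Z E0 by (intro mult_left_mono) auto
    ultimately have "E * (1 / (10 * \<tau>)) \<le> 3/2" by linarith
    hence E1: "E \<le> 15 * \<tau>" using assms by (simp add: field_simps)
    have "exp (- (\<Sum>p\<in>?P. pexp \<tau> p) - 2 * (\<Sum>p\<in>?P. (pexp \<tau> p)^2)) = (\<Prod>p\<in>?P. exp (- pexp \<tau> p - 2 * (pexp \<tau> p)^2))"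
      by (simp add: exp_sum[symmetric] sum_subtractf sum_negf sum_distrib_left)
    also have "... \<le> E" unfolding E_def
    proof (intro prod_mono conjI)
      fix p assume p: "p \<in> ?P"
      have "- pexp \<tau> p - 2 * (pexp \<tau> p)^2 \<le> ln (1 - pexp \<tau> p)"
        using small[OF p] by (intro ln_one_minus_pos_lower_bound) auto
      hence "exp (- pexp \<tau> p - 2 * (pexp \<tau> p)^2) \<le> exp (ln (1 - pexp \<tau> p))" by (simp only: exp_le_cancel_iff)
      thus "exp (- pexp \<tau> p - 2 * (pexp \<tau> p)^2) \<le> 1 - pexp \<tau> p" using small[OF p] by (subst (asm) exp_ln) auto
    qed auto
    finally have "exp (- (\<Sum>p\<in>?P. pexp \<tau> p) - 2 * (\<Sum>p\<in>?P. (pexp \<tau> p)^2)) \<le> 15 * \<tau>" using E1 by linarith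
    hence "ln (exp (- (\<Sum>p\<in>?P. pexp \<tau> p) - 2 * (\<Sum>p\<in>?P. (pexp \<tau> p)^2))) \<le> ln (15 * \<tau>)" using assms by (subst ln_le_cancel_iff) auto
    also have "... = ln 15 + ln \<tau>" using assms by (simp add: ln_mult)
    also have "ln 15 \<le> (14::real)" using ln_le_minus_one[of 15] by simp
    finally have 1: "- (\<Sum>p\<in>?P. pexp \<tau> p) - 2 * (\<Sum>p\<in>?P. (pexp \<tau> p)^2) \<le> 14 + ln \<tau>" by simp
    have "(\<Sum>p\<in>?P. (pexp \<tau> p)^2) = (\<Sum>p\<in>?P. (norm (npow s (real p)))^2)" by (simp add: eq)
    also have "... \<le> 3" using s by (intro sum_norm_npow_primes) auto
    finally show "(\<Sum>p\<in>?P. pexp \<tau> p) \<ge> - ln \<tau> - 20" using 1 by simp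
  qed
qed

lemma primes_upto_mono: "y \<le> z \<Longrightarrow> primes_upto y \<subseteq> primes_upto z"
  by (auto simp: primes_upto_def)

lemma ln_prime_pos: "p \<in> primes_upto z \<Longrightarrow> ln (real p) > 0"
  using prime_gt_1_nat[of p] by (auto simp: primes_upto_def)

text \<open>In the difference of the prime sums at \<sigma> and 2\<sigma> the logarithms cancel up
  to ln 2. Hence this weight, concentrated where ln p is about 1/\<sigma>, has bounded mass; the
  estimates with a sharp cutoff below compare with it. The terms are nonnegative, so z may be
  enlarged until both asymptotic bounds apply.\<close>

lemma prime_sum_diff:
  assumes "0 < \<sigma>" "\<sigma> \<le> 1"
  shows "(\<Sum>p\<in>primes_upto z. pexp \<sigma> p * (1 - pdec \<sigma> p)) \<le> 101"
proof -
  have eq: "pexp \<sigma> p * (1 - pdec \<sigma> p) = pexp \<sigma> p - pexp (2 * \<sigma>) p" for p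
    by (simp add: right_diff_distrib pexp_mult_pdec)
  obtain z1 where z1: "\<And>z. z \<ge> z1 \<Longrightarrow> (\<Sum>p\<in>primes_upto z. pexp \<sigma> p) \<le> - ln \<sigma> + 80"
    using prime_sum_cos_upper[of \<sigma> 0] assms by (auto simp: complex_norm)
  obtain z2 where z2: "\<And>z. z \<ge> z2 \<Longrightarrow> (\<Sum>p\<in>primes_upto z. pexp (2 * \<sigma>) p) \<ge> - ln (2 * \<sigma>) - 20"
    using prime_sum_lower[of "2 * \<sigma>"] assms by auto
  define Z where "Z = max z (max z1 z2)"
  have "(\<Sum>p\<in>primes_upto z. pexp \<sigma> p - pexp (2 * \<sigma>) p) \<le> (\<Sum>p\<in>primes_upto Z. pexp \<sigma> p - pexp (2 * \<sigma>) p)"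
  proof (intro sum_mono2 primes_upto_mono)
    fix p assume "p \<in> primes_upto Z - primes_upto z"
    hence "ln (real p) > 0" using ln_prime_pos by blast
    hence "(- (1 + 2 * \<sigma>)) * ln (real p) \<le> (- (1 + \<sigma>)) * ln (real p)" using assms by (intro mult_right_mono) auto
    thus "0 \<le> pexp \<sigma> p - pexp (2 * \<sigma>) p" by (simp add: pexp_def)
  qed (auto simp: Z_def)
  also have "... = (\<Sum>p\<in>primes_upto Z. pexp \<sigma> p) - (\<Sum>p\<in>primes_upto Z. pexp (2 * \<sigma>) p)" by (rule sum_subtractf)
  also have "... \<le> - ln \<sigma> + 80 - (- ln (2 * \<sigma>) - 20)" using z1[of Z] z2[of Z] by (intro diff_mono) (auto simp: Z_def)
  also have "... = 100 + ln 2" using assms by (simp add: ln_mult)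
  also have "ln 2 \<le> (1::real)" using ln_le_minus_one[of 2] by simp
  finally show ?thesis by (simp add: eq)
qed

lemma exp_neg_one_le_half: "exp (-1 :: real) \<le> 1/2"
  using exp_ge_add_one_self[of 1] by (simp add: exp_minus field_simps)

section \<open>Mertens estimates with a sharp cutoff\<close>

context
  fixes l :: real
  assumes l: "l \<ge> 1"
begin

lemma inverse_l_bounds: "0 < 1 / l" "1 / l \<le> 2" using l by (auto simp: field_simps)

lemma prime_sum_tail: "(\<Sum>p\<in>primes_upto z - primes_upto (exp l). pexp (1 / l) p) \<le> 202"
proof -
  have "(\<Sum>p\<in>primes_upto z - primes_upto (exp l). pexp (1 / l) p) \<le> (\<Sum>p\<in>primes_upto z - primes_upto (exp l). 2 * (pexp (1 / l) p * (1 - pdec (1 / l) p)))"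
  proof (intro sum_mono)
    fix p assume p: "p \<in> primes_upto z - primes_upto (exp l)"
    hence "real p > exp l" "real p > 0" by (auto simp: primes_upto_def prime_gt_0_nat)
    hence "ln (real p) \<ge> l" by (simp add: ln_ge_iff)
    hence "- (1 / l) * ln (real p) \<le> - 1" using l by (simp add: field_simps)
    hence "pdec (1 / l) p \<le> exp (-1)" by (simp only: pdec_def exp_le_cancel_iff)
    hence "1 \<le> 2 * (1 - pdec (1 / l) p)" using exp_neg_one_le_half by argo
    from mult_left_mono[OF this, of "pexp (1/l) p"] show "pexp (1 / l) p \<le> 2 * (pexp (1 / l) p * (1 - pdec (1 / l) p))" by (simp add: algebra_simps)
  qed
  also have "... \<le> (\<Sum>p\<in>primes_upto z. 2 * (pexp (1 / l) p * (1 - pdec (1 / l) p)))"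
    using l by (intro sum_mono2) (auto intro!: mult_nonneg_nonneg pdec_le_1 dest: primes_upto_ge_1)
  also have "... = 2 * (\<Sum>p\<in>primes_upto z. (pexp (1 / l) p * (1 - pdec (1 / l) p)))" by (rule sum_distrib_left[symmetric])
  also have "... \<le> 2 * 101" using l by (intro mult_left_mono prime_sum_diff) auto
  finally show ?thesis by simp
qed

lemma inverse_le_pexp:
  assumes "p \<in> primes_upto (exp l)"
  shows "1 / real p \<le> 3 * pexp (1 / l) p"
proof -
  have p: "real p > 0" "real p \<le> exp l" using assms by (auto simp: primes_upto_def prime_gt_0_nat)
  have "ln (real p) \<le> ln (exp l)" using p by (subst ln_le_cancel_iff) auto
  hence "ln (real p) / l \<le> 1" using l by simp
  hence "exp (- 1) \<le> pdec (1 / l) p" by (simp add: pdec_def)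
  moreover have "exp (-1::real) \<ge> 1/3" using exp_le by (simp add: exp_minus field_simps)
  ultimately have "1 \<le> 3 * pdec (1 / l) p" by linarith
  hence "(1 / real p) * 1 \<le> (1 / real p) * (3 * pdec (1 / l) p)" by (intro mult_left_mono) auto
  thus ?thesis using p by (simp add: pexp_eq)
qed

lemma prime_sum_head: "(\<Sum>p\<in>primes_upto (exp l). 1 / real p - pexp (1 / l) p) \<le> 303"
proof -
  have "(\<Sum>p\<in>primes_upto (exp l). 1 / real p - pexp (1 / l) p) \<le> (\<Sum>p\<in>primes_upto (exp l). 3 * (pexp (1 / l) p * (1 - pdec (1 / l) p)))"
  proof (intro sum_mono)
    fix p assume p: "p \<in> primes_upto (exp l)"
    hence p0: "real p > 0" by (auto simp: primes_upto_def prime_gt_0_nat)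
    have "1 / real p - pexp (1 / l) p = (1 / real p) * (1 - pdec (1 / l) p)"
      using p0 by (simp add: pexp_eq algebra_simps)
    also have "... \<le> (3 * pexp (1 / l) p) * (1 - pdec (1 / l) p)"
      using inverse_le_pexp[OF p] primes_upto_ge_1[OF p] l by (intro mult_right_mono) (auto intro: pdec_le_1)
    finally show "1 / real p - pexp (1 / l) p \<le> 3 * (pexp (1 / l) p * (1 - pdec (1 / l) p))" by simp
  qed
  also have "... = 3 * (\<Sum>p\<in>primes_upto (exp l). (pexp (1 / l) p * (1 - pdec (1 / l) p)))" by (rule sum_distrib_left[symmetric])
  also have "... \<le> 3 * 101" using l by (intro mult_left_mono prime_sum_diff) auto
  finally show ?thesis by simp
qed

text \<open>The cutoff at exp l is exchanged for the weight p^(-1/l), whose full prime sum is known: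
  this costs 303 on the primes up to exp l and 202 beyond, and 80 + 303 + 202 = 585. The main term
  is ln (min l (1/|w|)) up to a constant.\<close>

theorem prime_cos_sum_upper:
  assumes "\<bar>w\<bar> \<le> 1"
  shows "(\<Sum>p\<in>primes_upto (exp l). cos (w * ln (real p)) / real p) \<le> - ln (norm (Complex (1 / l) w)) + 585"
proof -
  obtain z0 where z0: "\<And>z. z \<ge> z0 \<Longrightarrow> (\<Sum>p\<in>primes_upto z. pexp (1/l) p * cos (w * ln (real p))) \<le> - ln (norm (Complex (1/l) w)) + 80"
    using prime_sum_cos_upper[of "1/l" w] assms inverse_l_bounds by blast
  define z where "z = max z0 (exp l)"
  let ?A = "primes_upto (exp l)" and ?B = "primes_upto z"
  have AB: "?A \<subseteq> ?B" by (intro primes_upto_mono) (simp add: z_def)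
  have "(\<Sum>p\<in>?A. cos (w * ln (real p)) / real p) = (\<Sum>p\<in>?A. pexp (1/l) p * cos (w * ln (real p))) + (\<Sum>p\<in>?A. (1 / real p - pexp (1/l) p) * cos (w * ln (real p)))"
    by (simp add: algebra_simps flip: sum.distrib)
  also have "(\<Sum>p\<in>?A. (1 / real p - pexp (1/l) p) * cos (w * ln (real p))) \<le> (\<Sum>p\<in>?A. (1 / real p - pexp (1/l) p) * 1)"
    using l pexp_le_inverse[of _ "1/l"] by (intro sum_mono mult_left_mono) (auto dest: primes_upto_ge_1)
  also have "... \<le> 303" using prime_sum_head by simp
  also have "(\<Sum>p\<in>?A. pexp (1/l) p * cos (w * ln (real p))) = (\<Sum>p\<in>?B. pexp (1/l) p * cos (w * ln (real p))) + (\<Sum>p\<in>?B - ?A. pexp (1/l) p * (- cos (w * ln (real p))))"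
    using AB by (subst sum.subset_diff[OF AB]) (auto simp: sum_negf)
  also have "(\<Sum>p\<in>?B - ?A. pexp (1/l) p * (- cos (w * ln (real p)))) \<le> (\<Sum>p\<in>?B - ?A. pexp (1/l) p * 1)"
    by (intro sum_mono mult_left_mono) (use cos_ge_minus_one in \<open>auto simp: minus_le_iff\<close>)
  also have "... \<le> 202" using prime_sum_tail[of z] by simp
  also have "(\<Sum>p\<in>?B. pexp (1/l) p * cos (w * ln (real p))) \<le> - ln (norm (Complex (1/l) w)) + 80"
    by (rule z0) (simp add: z_def)
  finally show ?thesis by simp
qed

theorem prime_inverse_sum_lower: "(\<Sum>p\<in>primes_upto (exp l). 1 / real p) \<ge> ln l - 222"
proof -
  obtain z0 where z0: "\<And>z. z \<ge> z0 \<Longrightarrow> (\<Sum>p\<in>primes_upto z. pexp (1/l) p) \<ge> - ln (1/l) - 20"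
    using prime_sum_lower[of "1/l"] inverse_l_bounds by blast
  define z where "z = max z0 (exp l)"
  let ?A = "primes_upto (exp l)" and ?B = "primes_upto z"
  have AB: "?A \<subseteq> ?B" by (intro primes_upto_mono) (simp add: z_def)
  have "ln l - 20 \<le> (\<Sum>p\<in>?B. pexp (1/l) p)" using z0[of z] l by (simp add: z_def ln_div)
  also have "... = (\<Sum>p\<in>?B - ?A. pexp (1/l) p) + (\<Sum>p\<in>?A. pexp (1/l) p)" by (rule sum.subset_diff[OF AB]) auto
  also have "(\<Sum>p\<in>?B - ?A. pexp (1/l) p) \<le> 202" by (rule prime_sum_tail)
  also have "(\<Sum>p\<in>?A. pexp (1/l) p) \<le> (\<Sum>p\<in>?A. 1 / real p)"
    using l by (intro sum_mono pexp_le_inverse) (auto dest: primes_upto_ge_1)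
  finally show ?thesis by simp
qed

text \<open>For ln p in (l/2, l] both p^(-1/l) and 1 - p^(-1/l) are at least 1/3, so 1/p is at most
  9 times the weight of \<open>prime_sum_diff\<close>, and 9 * 101 = 909. It bounds the mass of each
  block of primes uniformly.\<close>

theorem prime_inverse_sum_range: "(\<Sum>p | prime p \<and> l / 2 < ln (real p) \<and> ln (real p) \<le> l. 1 / real p) \<le> 909"
proof -
  let ?R = "{p. prime p \<and> l / 2 < ln (real p) \<and> ln (real p) \<le> l}"
  have R: "?R \<subseteq> primes_upto (exp l)"
    unfolding primes_upto_def by (safe, metis exp_le_cancel_iff exp_ln of_nat_0_less_iff prime_gt_0_nat)
  have "(\<Sum>p\<in>?R. 1 / real p) \<le> (\<Sum>p\<in>?R. 9 * (pexp (1 / l) p * (1 - pdec (1 / l) p)))"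
  proof (intro sum_mono)
    fix p assume p: "p \<in> ?R"
    hence "(1 / l) * ln (real p) \<ge> 1/2" using l by (simp add: field_simps)
    moreover have "1 + (1 / l) * ln (real p) \<le> exp ((1 / l) * ln (real p))" by (rule exp_ge_add_one_self)
    ultimately have "3/2 \<le> exp ((1 / l) * ln (real p))" by argo
    hence "pdec (1 / l) p \<le> 2/3" by (simp add: pdec_def exp_minus field_simps)
    hence 1: "1 \<le> 3 * (1 - pdec (1 / l) p)" by argo
    have "1 / real p \<le> 3 * pexp (1 / l) p" using p R by (intro inverse_le_pexp) auto
    also have "... \<le> 3 * pexp (1 / l) p * (3 * (1 - pdec (1 / l) p))"
      using mult_left_mono[OF 1, of "3 * pexp (1 / l) p"] by simp
    finally show "1 / real p \<le> 9 * (pexp (1 / l) p * (1 - pdec (1 / l) p))" by (simp add: algebra_simps)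
  qed
  also have "... \<le> (\<Sum>p\<in>primes_upto (exp l). 9 * (pexp (1 / l) p * (1 - pdec (1 / l) p)))"
    using l R by (intro sum_mono2) (auto intro!: mult_nonneg_nonneg pdec_le_1 dest: primes_upto_ge_1)
  also have "... = 9 * (\<Sum>p\<in>primes_upto (exp l). (pexp (1 / l) p * (1 - pdec (1 / l) p)))" by (rule sum_distrib_left[symmetric])
  also have "... \<le> 9 * 101" using l by (intro mult_left_mono prime_sum_diff) auto
  finally show ?thesis by simp
qed

end

section \<open>Dirichlet polynomials and their coefficient norms\<close>

text \<open>This is n^(-it). By \<open>chi_add\<close> a shift of t moves into the
  coefficients.\<close>

definition chi :: "real \<Rightarrow> nat \<Rightarrow> complex" where
  "chi t n = cis (- t * ln (real n))"

lemma norm_chi [simp]: "norm (chi t n) = 1" by (simp add: chi_def)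

lemma chi_1 [simp]: "chi t 1 = 1" "chi t (Suc 0) = 1" by (simp_all add: chi_def)

lemma chi_mult: "m > 0 \<Longrightarrow> n > 0 \<Longrightarrow> chi t (m * n) = chi t m * chi t n"
  by (simp add: chi_def ln_mult cis_mult distrib_left)

lemma chi_add: "chi (t + u) n = chi t n * chi u n"
  by (simp add: chi_def cis_mult algebra_simps)

text \<open>The coefficients are hidden: an upper bound by the mean value theorem asks only for a
  set containing the support and for a bound \<open>K\<close> on their l2-norm.\<close>

definition dpoly :: "nat set \<Rightarrow> real \<Rightarrow> (real \<Rightarrow> complex) \<Rightarrow> bool" where
  "dpoly S K A \<longleftrightarrow> finite S \<and> (\<forall>n\<in>S. n > 0) \<and> K \<ge> 0 \<and>
     (\<exists>a. (\<forall>t. A t = (\<Sum>n\<in>S. a n * chi t n)) \<and> (\<Sum>n\<in>S. (norm (a n))^2) \<le> K^2)"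

lemma dpolyI:
  assumes "finite S" "\<And>n. n \<in> S \<Longrightarrow> n > 0" "K \<ge> 0" "(\<Sum>n\<in>S. (norm (a n))^2) \<le> K^2"
  shows "dpoly S K (\<lambda>t. \<Sum>n\<in>S. a n * chi t n)"
  using assms unfolding dpoly_def by blast

lemma dpolyE:
  assumes "dpoly S K A"
  obtains a where "finite S" "\<And>n. n \<in> S \<Longrightarrow> n > 0" "K \<ge> 0" "A = (\<lambda>t. \<Sum>n\<in>S. a n * chi t n)" "(\<Sum>n\<in>S. (norm (a n))^2) \<le> K^2"
  using assms unfolding dpoly_def by (metis ext)

lemma dpoly_mono:
  assumes "dpoly S K A" "K \<le> K'" "S \<subseteq> S'" "finite S'" "\<And>n. n \<in> S' \<Longrightarrow> n > 0"
  shows "dpoly S' K' A"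
proof -
  from dpolyE[OF assms(1)] obtain a where a: "finite S" "K \<ge> 0" "A = (\<lambda>t. \<Sum>n\<in>S. a n * chi t n)" "(\<Sum>n\<in>S. (norm (a n))^2) \<le> K^2"
    by metis
  define a' where "a' n = (if n \<in> S then a n else 0)" for n
  have A: "A = (\<lambda>t. \<Sum>n\<in>S'. a' n * chi t n)"
    unfolding a(3) by (intro ext sum.mono_neutral_cong_left) (use assms in \<open>auto simp: a'_def\<close>)
  moreover have "(\<Sum>n\<in>S'. (norm (a' n))^2) = (\<Sum>n\<in>S. (norm (a n))^2)"
    by (rule sum.mono_neutral_cong_right) (use assms in \<open>auto simp: a'_def\<close>)
  moreover have "K^2 \<le> K'^2" using a(2) assms(2) by (intro power_mono) auto
  ultimately have "(\<Sum>n\<in>S'. (norm (a' n))^2) \<le> K'^2" using a(4) by linarith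
  thus ?thesis unfolding A using assms(2,4,5) a(2) by (auto intro!: dpolyI)
qed

lemma dpoly_mono': "dpoly S K A \<Longrightarrow> K \<le> K' \<Longrightarrow> dpoly S K' A"
  by (rule dpoly_mono) (auto simp: dpoly_def)

lemma dpoly_zero: "finite S \<Longrightarrow> (\<And>n. n \<in> S \<Longrightarrow> n > 0) \<Longrightarrow> dpoly S 0 (\<lambda>t. 0)"
  using dpolyI[of S 0 "\<lambda>_. 0"] by simp

lemma dpoly_add:
  assumes "dpoly S K A" "dpoly S K' B"
  shows "dpoly S (K + K') (\<lambda>t. A t + B t)"
proof -
  obtain a where a: "finite S" "\<And>n. n \<in> S \<Longrightarrow> n > 0" "K \<ge> 0" "A = (\<lambda>t. \<Sum>n\<in>S. a n * chi t n)" "(\<Sum>n\<in>S. (norm (a n))^2) \<le> K^2"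
    by (rule dpolyE[OF assms(1)]) blast
  obtain b where b: "K' \<ge> 0" "B = (\<lambda>t. \<Sum>n\<in>S. b n * chi t n)" "(\<Sum>n\<in>S. (norm (b n))^2) \<le> K'^2"
    by (rule dpolyE[OF assms(2)]) blast
  have "L2_set (\<lambda>n. norm (a n + b n)) S \<le> L2_set (\<lambda>n. norm (a n) + norm (b n)) S"
    by (intro L2_set_mono norm_triangle_ineq) auto
  also have "... \<le> L2_set (\<lambda>n. norm (a n)) S + L2_set (\<lambda>n. norm (b n)) S" by (rule L2_set_triangle_ineq)
  also have "... \<le> K + K'" using a b by (intro add_mono) (auto simp: L2_set_def intro!: real_le_lsqrt sum_nonneg)
  finally have "sqrt (\<Sum>n\<in>S. (norm (a n + b n))^2) \<le> K + K'" by (simp add: L2_set_def)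
  hence "(\<Sum>n\<in>S. (norm (a n + b n))^2) \<le> (K + K')^2" by (rule sqrt_le_D)
  thus ?thesis using dpolyI[of S "K + K'" "\<lambda>n. a n + b n"] a b by (simp add: distrib_right sum.distrib)
qed

lemma dpoly_scale:
  assumes "dpoly S K A"
  shows "dpoly S (norm c * K) (\<lambda>t. c * A t)"
proof -
  obtain a where a: "finite S" "\<And>n. n \<in> S \<Longrightarrow> n > 0" "K \<ge> 0" "A = (\<lambda>t. \<Sum>n\<in>S. a n * chi t n)" "(\<Sum>n\<in>S. (norm (a n))^2) \<le> K^2"
    by (rule dpolyE[OF assms]) blast
  have "(\<Sum>n\<in>S. (norm (c * a n))^2) = (norm c)^2 * (\<Sum>n\<in>S. (norm (a n))^2)"
    by (simp add: norm_mult power_mult_distrib sum_distrib_left)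
  also have "... \<le> (norm c)^2 * K^2" using a by (intro mult_left_mono) auto
  finally show ?thesis using dpolyI[of S "norm c * K" "\<lambda>n. c * a n"] a
    by (simp add: mult.assoc sum_distrib_left power_mult_distrib)
qed

lemma dpoly_sum:
  assumes "finite S" "\<And>n. n \<in> S \<Longrightarrow> n > 0" "\<And>i. i \<in> I \<Longrightarrow> dpoly S (K i) (A i)"
  shows "dpoly S (\<Sum>i\<in>I. K i) (\<lambda>t. \<Sum>i\<in>I. A i t)"
  using assms(3)
  by (induction I rule: infinite_finite_induct) (auto intro!: dpoly_zero dpoly_add assms(1,2))

text \<open>Pythagoras in place of the triangle inequality of \<open>dpoly_add\<close>. It keeps the
  norm of a truncated exponential series, cut into layers, below exp (W/2) with no constant in
  front.\<close>

lemma dpoly_disjoint_add: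
  assumes "dpoly S K A" "dpoly S' K' B" "S \<inter> S' = {}"
  shows "dpoly (S \<union> S') (sqrt (K^2 + K'^2)) (\<lambda>t. A t + B t)"
proof -
  obtain a where a: "finite S" "\<And>n. n \<in> S \<Longrightarrow> n > 0" "K \<ge> 0" "A = (\<lambda>t. \<Sum>n\<in>S. a n * chi t n)" "(\<Sum>n\<in>S. (norm (a n))^2) \<le> K^2"
    by (rule dpolyE[OF assms(1)]) blast
  obtain b where b: "finite S'" "\<And>n. n \<in> S' \<Longrightarrow> n > 0" "K' \<ge> 0" "B = (\<lambda>t. \<Sum>n\<in>S'. b n * chi t n)" "(\<Sum>n\<in>S'. (norm (b n))^2) \<le> K'^2"
    by (rule dpolyE[OF assms(2)]) blast
  define c where "c n = (if n \<in> S then a n else b n)" for n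
  have [simp]: "n \<in> S' \<Longrightarrow> c n = b n" "n \<in> S \<Longrightarrow> c n = a n" for n using assms(3) by (auto simp: c_def)
  have "(\<Sum>n\<in>S \<union> S'. c n * chi t n) = A t + B t" "(\<Sum>n\<in>S \<union> S'. (norm (c n))^2) \<le> K^2 + K'^2" for t
    using assms(3) a b by (simp_all add: sum.union_disjoint)
  thus ?thesis using dpolyI[of "S \<union> S'" "sqrt (K^2 + K'^2)" c] a b by auto
qed

lemma dpoly_disjoint_sum:
  assumes "finite I" "\<And>i. i \<in> I \<Longrightarrow> dpoly (S i) (K i) (A i)" "\<And>i j. i \<in> I \<Longrightarrow> j \<in> I \<Longrightarrow> i \<noteq> j \<Longrightarrow> S i \<inter> S j = {}"
  shows "dpoly (\<Union>i\<in>I. S i) (sqrt (\<Sum>i\<in>I. (K i)^2)) (\<lambda>t. \<Sum>i\<in>I. A i t)"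
  using assms
proof (induction I)
  case empty
  show ?case using dpoly_zero[of "{}"] by simp
next
  case (insert i I)
  have "dpoly (S i \<union> (\<Union>i\<in>I. S i)) (sqrt ((K i)^2 + (sqrt (\<Sum>i\<in>I. (K i)^2))^2)) (\<lambda>t. A i t + (\<Sum>i\<in>I. A i t))"
  proof (rule dpoly_disjoint_add)
    show "S i \<inter> (\<Union>i\<in>I. S i) = {}" using insert.prems(2)[of i] insert.hyps by blast
  qed (use insert in auto)
  thus ?case using insert.hyps by (simp add: sum_nonneg)
qed

lemma dpoly_one: "dpoly {1} 1 (\<lambda>t. 1)"
  using dpolyI[of "{1}" 1 "\<lambda>_. 1"] by simp

text \<open>If each number has at most \<open>C\<close> representations as a product, Cauchy-Schwarz over these costs a factor \<open>sqrt C\<close>.\<close>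
lemma dpoly_mult:
  assumes "dpoly S K A" "dpoly S' K' B" "\<And>N. card {x \<in> S \<times> S'. fst x * snd x = N} \<le> C"
  shows "dpoly ((\<lambda>(m, n). m * n) ` (S \<times> S')) (sqrt (real C) * K * K') (\<lambda>t. A t * B t)"
proof -
  obtain a where a: "finite S" "\<And>n. n \<in> S \<Longrightarrow> n > 0" "K \<ge> 0" "A = (\<lambda>t. \<Sum>n\<in>S. a n * chi t n)" "(\<Sum>n\<in>S. (norm (a n))^2) \<le> K^2"
    by (rule dpolyE[OF assms(1)]) blast
  obtain b where b: "finite S'" "\<And>n. n \<in> S' \<Longrightarrow> n > 0" "K' \<ge> 0" "B = (\<lambda>t. \<Sum>n\<in>S'. b n * chi t n)" "(\<Sum>n\<in>S'. (norm (b n))^2) \<le> K'^2"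
    by (rule dpolyE[OF assms(2)]) blast
  let ?T = "(\<lambda>(m, n). m * n) ` (S \<times> S')"
  let ?F = "\<lambda>N. {x \<in> S \<times> S'. fst x * snd x = N}"
  define h where "h x = a (fst x) * b (snd x)" for x
  define d where "d N = (\<Sum>x\<in>?F N. h x)" for N
  have group: "(\<Sum>N\<in>?T. \<Sum>x\<in>?F N. f x) = (\<Sum>x\<in>S \<times> S'. f x)" for f :: "nat \<times> nat \<Rightarrow> 'a :: comm_monoid_add"
    by (rule sum.group) (use a b in auto)
  have "A t * B t = (\<Sum>N\<in>?T. d N * chi t N)" for t
  proof -
    have "A t * B t = (\<Sum>x\<in>S \<times> S'. (a (fst x) * chi t (fst x)) * (b (snd x) * chi t (snd x)))"
      by (simp add: a b sum_product sum.cartesian_product case_prod_unfold)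
    also have "... = (\<Sum>x\<in>S \<times> S'. h x * chi t (fst x * snd x))"
      using a(2) b(2) by (intro sum.cong refl) (auto simp: h_def chi_mult)
    also have "... = (\<Sum>N\<in>?T. d N * chi t N)"
      unfolding group[symmetric] d_def sum_distrib_right by (intro sum.cong refl) auto
    finally show ?thesis .
  qed
  moreover have "(\<Sum>N\<in>?T. (norm (d N))^2) \<le> (sqrt (real C) * K * K')^2"
  proof -
    have "(\<Sum>N\<in>?T. (norm (d N))^2) \<le> (\<Sum>N\<in>?T. C * (\<Sum>x\<in>?F N. (norm (h x))^2))"
    proof (intro sum_mono)
      fix N
      have "norm (d N) \<le> (\<Sum>x\<in>?F N. 1 * norm (h x))" unfolding d_def by (simp add: norm_sum)
      hence "(norm (d N))^2 \<le> (\<Sum>x\<in>?F N. 1 * norm (h x))^2" by (intro power_mono) auto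
      also have "... \<le> (\<Sum>x\<in>?F N. 1^2) * (\<Sum>x\<in>?F N. (norm (h x))^2)" by (rule Cauchy_Schwarz_ineq_sum)
      also have "... \<le> C * (\<Sum>x\<in>?F N. (norm (h x))^2)"
        using assms(3)[of N] by (intro mult_right_mono) (auto intro!: sum_nonneg)
      finally show "(norm (d N))^2 \<le> C * (\<Sum>x\<in>?F N. (norm (h x))^2)" .
    qed
    also have "... = C * ((\<Sum>n\<in>S. (norm (a n))^2) * (\<Sum>n\<in>S'. (norm (b n))^2))"
      unfolding sum_distrib_left[symmetric] group
      by (simp add: h_def norm_mult power_mult_distrib sum_product sum.cartesian_product case_prod_unfold)
    also have "... \<le> C * (K^2 * K'^2)" using a b by (intro mult_left_mono mult_mono) (auto intro: sum_nonneg)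
    also have "... = (sqrt (real C) * K * K')^2" by (simp add: power_mult_distrib)
    finally show ?thesis .
  qed
  moreover have "finite ?T" "0 < N" if "N \<in> ?T" for N using a b that by auto
  ultimately show ?thesis using dpolyI[of ?T "sqrt (real C) * K * K'" d] a b by simp
qed

section \<open>Integers with a given number of prime factors, and products of blocks\<close>

fun layer :: "nat set \<Rightarrow> nat \<Rightarrow> nat set" where
  "layer I 0 = {1}"
| "layer I (Suc M) = (\<lambda>(p, n). p * n) ` (I \<times> layer I M)"

definition smooth_upto :: "nat set \<Rightarrow> real \<Rightarrow> nat set" where
  "smooth_upto I Y = {n. n > 0 \<and> (\<forall>p. prime p \<longrightarrow> p dvd n \<longrightarrow> p \<in> I) \<and> real n \<le> Y}"

lemma finite_smooth_upto [simp]: "finite (smooth_upto I Y)"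
proof (rule finite_subset)
  show "smooth_upto I Y \<subseteq> {..nat \<lceil>Y\<rceil>}" by (auto simp: smooth_upto_def) linarith
qed auto

lemma smooth_upto_pos: "n \<in> smooth_upto I Y \<Longrightarrow> n > 0" by (simp add: smooth_upto_def)

lemma smooth_upto_mono: "Y \<le> Y' \<Longrightarrow> smooth_upto I Y \<subseteq> smooth_upto I Y'"
  by (auto simp: smooth_upto_def)

text \<open>With primes from disjoint sets the factorisation N = m n is unique, so
  \<open>dpoly_mult\<close> applies with C = 1 and the norms of different blocks multiply without
  loss.\<close>

lemma dpoly_mult_coprime:
  assumes "dpoly (smooth_upto I Y) K A" "dpoly (smooth_upto I' Y') K' B" "I \<inter> I' = {}"
  shows "dpoly (smooth_upto (I \<union> I') (Y * Y')) (K * K') (\<lambda>t. A t * B t)"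
proof (rule dpoly_mono[OF dpoly_mult[OF assms(1,2), where C = 1]])
  have cop: "coprime m n" if "m \<in> smooth_upto I Y" "n \<in> smooth_upto I' Y'" for m n
  proof (rule ccontr)
    assume "\<not> coprime m n"
    then obtain p where "prime p" "p dvd m" "p dvd n" 
      using prime_factor_nat[of "gcd m n"] by (auto simp: coprime_iff_gcd_eq_1)
    thus False using that assms(3) by (auto simp: smooth_upto_def)
  qed
  show "card {x \<in> smooth_upto I Y \<times> smooth_upto I' Y'. fst x * snd x = N} \<le> 1" for N
  proof (rule card_le_Suc0_iff_eq[THEN iffD2, folded One_nat_def]; clarsimp)
    fix m n m' n' assume *: "m \<in> smooth_upto I Y" "n \<in> smooth_upto I' Y'" "m' \<in> smooth_upto I Y" "n' \<in> smooth_upto I' Y'" "m' * n' = m * n"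
    have "m dvd m' * n'" "m' dvd m * n" using *(5) by (metis dvd_triv_left)+
    hence "m dvd m'" "m' dvd m" using cop[OF *(1,4)] cop[OF *(3,2)] by (simp_all only: coprime_dvd_mult_left_iff)
    hence "m = m'" by (rule dvd_antisym)
    with * show "m = m' \<and> n = n'" by (auto dest: smooth_upto_pos)
  qed
  show "(\<lambda>(m, n). m * n) ` (smooth_upto I Y \<times> smooth_upto I' Y') \<subseteq> smooth_upto (I \<union> I') (Y * Y')"
    by (auto simp: smooth_upto_def prime_dvd_mult_iff intro!: mult_mono)
qed (auto dest: smooth_upto_pos)

lemma dpoly_prod:
  assumes "finite J" "\<And>j. j \<in> J \<Longrightarrow> dpoly (smooth_upto (I j) (Y j)) (K j) (A j)" "\<And>i j. i \<in> J \<Longrightarrow> j \<in> J \<Longrightarrow> i \<noteq> j \<Longrightarrow> I i \<inter> I j = {}"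
  shows "dpoly (smooth_upto (\<Union>j\<in>J. I j) (\<Prod>j\<in>J. Y j)) (\<Prod>j\<in>J. K j) (\<lambda>t. \<Prod>j\<in>J. A j t)"
  using assms
proof (induction J)
  case empty
  have "dpoly (smooth_upto {} 1) 1 (\<lambda>t. 1)"
  proof (rule dpoly_mono[OF dpoly_one])
    show "{1} \<subseteq> smooth_upto {} 1" by (auto simp: smooth_upto_def)
  qed (auto intro: smooth_upto_pos)
  thus ?case by simp
next
  case (insert i J)
  have "dpoly (smooth_upto (I i \<union> (\<Union>j\<in>J. I j)) (Y i * (\<Prod>j\<in>J. Y j))) (K i * (\<Prod>j\<in>J. K j)) (\<lambda>t. A i t * (\<Prod>j\<in>J. A j t))"
  proof (rule dpoly_mult_coprime)
    show "I i \<inter> (\<Union>j\<in>J. I j) = {}" using insert.prems(2)[of i] insert.hyps by blast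
  qed (use insert in auto)
  thus ?case using insert.hyps by simp
qed

context
  fixes I :: "nat set"
  assumes I: "finite I" "\<And>p. p \<in> I \<Longrightarrow> prime p"
begin

lemma finite_layer: "finite (layer I M)"
  by (induction M) (use I in auto)

lemma layer_pos: "n \<in> layer I M \<Longrightarrow> n > 0"
  by (induction M arbitrary: n) (use I in \<open>auto simp: prime_gt_0_nat\<close>)

lemma layer_size: "n \<in> layer I M \<Longrightarrow> size (prime_factorization n) = M"
proof (induction M arbitrary: n)
  case (Suc M)
  then obtain p m where n: "n = p * m" "p \<in> I" "m \<in> layer I M" by auto
  have "p \<noteq> 0" "m \<noteq> 0" using layer_pos[OF n(3)] I(2)[OF n(2)] by auto
  hence "prime_factorization n = prime_factorization p + prime_factorization m"
    using n by (simp add: prime_factorization_mult)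
  thus ?case using Suc.IH[OF n(3)] I(2)[OF n(2)] by (simp add: prime_factorization_prime)
qed auto

lemma layer_subset_smooth_upto:
  assumes "\<And>p. p \<in> I \<Longrightarrow> real p \<le> y"
  shows "layer I M \<subseteq> smooth_upto I (y ^ M)"
proof (induction M)
  case 0
  thus ?case by (auto simp: smooth_upto_def)
next
  case (Suc M)
  show ?case
  proof
    fix n assume "n \<in> layer I (Suc M)"
    then obtain p m where n: "n = p * m" "p \<in> I" "m \<in> layer I M" by auto
    hence m: "m \<in> smooth_upto I (y ^ M)" using Suc by auto
    have "real p * real m \<le> y * y ^ M" using m assms[OF n(2)] by (intro mult_mono) (auto simp: smooth_upto_def intro: order_trans[of _ "real p"])
    moreover have "q \<in> I" if "prime q" "q dvd p * m" for q
      using that m n(2) I(2)[OF n(2)] primes_dvd_imp_eq[of q p] by (auto simp: prime_dvd_mult_iff smooth_upto_def)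
    ultimately show "n \<in> smooth_upto I (y ^ Suc M)" using layer_pos[OF \<open>n \<in> layer I (Suc M)\<close>] n by (auto simp: smooth_upto_def)
  qed
qed

lemma card_set_mset_le_size: "card (set_mset A) \<le> size A"
  by (induction A) (auto simp: card_insert_if)

text \<open>An integer with M + 1 prime factors, counted with multiplicity, can be written as p m
  with p in I in at most M + 1 ways. Iteration costs sqrt (M!), which the coefficient 1/M! of an
  exponential series more than repays.\<close>

lemma dpoly_layer_mult:
  assumes "dpoly I \<kappa> X" "dpoly (layer I M) K B"
  shows "dpoly (layer I (Suc M)) (sqrt (Suc M) * \<kappa> * K) (\<lambda>t. X t * B t)"
  unfolding layer.simps
proof (rule dpoly_mult[OF assms])
  fix N
  let ?F = "{x \<in> I \<times> layer I M. fst x * snd x = N}"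
  show "card ?F \<le> Suc M"
  proof (cases "N \<in> layer I (Suc M)")
    case True
    hence N: "N > 0" by (rule layer_pos)
    have "card ?F \<le> card (prime_factors N)"
    proof (rule card_inj_on_le)
      have "0 \<notin> I" using I(2)[of 0] by auto
      thus "inj_on fst ?F" by (auto intro!: inj_onI)
      show "fst ` ?F \<subseteq> prime_factors N" using I(2) N by (auto simp: in_prime_factors_iff)
    qed auto
    also have "... \<le> size (prime_factorization N)" by (rule card_set_mset_le_size)
    also have "... = Suc M" using True by (rule layer_size)
    finally show ?thesis .
  next
    case False
    hence "?F = {}" by force
    thus ?thesis by (simp only: card.empty)
  qed
qed

lemma dpoly_layer_power_mult:
  assumes "dpoly I \<kappa> X" "dpoly (layer I M) (sqrt (fact M) * \<kappa> ^ M) B"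
  shows "dpoly (layer I (M + i)) (sqrt (fact (M + i)) * \<kappa> ^ (M + i)) (\<lambda>t. X t ^ i * B t)"
proof (induction i)
  case (Suc i)
  have K: "sqrt (Suc (M + i)) * \<kappa> * (sqrt (fact (M + i)) * \<kappa> ^ (M + i)) = sqrt (fact (M + Suc i)) * \<kappa> ^ (M + Suc i)"
    by (simp add: real_sqrt_mult del: of_nat_Suc)
  show ?case using dpoly_layer_mult[OF assms(1) Suc] unfolding K by (simp add: mult.assoc del: layer.simps)
qed (use assms in simp)

lemma dpoly_layer_power:
  assumes "dpoly I \<kappa> X"
  shows "dpoly (layer I M) (sqrt (fact M) * \<kappa> ^ M) (\<lambda>t. X t ^ M)"
  using dpoly_layer_power_mult[OF assms, of 0 "\<lambda>_. 1" M] dpoly_one by simp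

end

section \<open>The upper bound for one block of primes\<close>

text \<open>The falling factorial n(n-1)...(n-i+1) over b^i. A further division by i! gives the
  coefficient of X^i in (1 + X/b)^n, to be compared with \<alpha>^i / i! in exp (\<alpha>
  X).\<close>

definition bcoef :: "nat \<Rightarrow> nat \<Rightarrow> nat \<Rightarrow> real" where
  "bcoef n b i = real (n choose i) * fact i / real b ^ i"

lemma bcoef_nonneg: "bcoef n b i \<ge> 0" by (simp add: bcoef_def)

lemma bcoef_0 [simp]: "bcoef n b 0 = 1" by (simp add: bcoef_def)

lemma bcoef_eq_0: "i > n \<Longrightarrow> bcoef n b i = 0" by (simp add: bcoef_def)

lemma bcoef_Suc:
  assumes "b > 0"
  shows "bcoef n b (Suc i) = bcoef n b i * ((real n - real i) / real b)"
proof (cases "i \<le> n")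
  case True
  have "Suc i * (n choose Suc i) = (n choose i) * (n - i)"
    by (metis binomial_absorb_comp binomial_absorption mult.commute)
  hence "real (Suc i) * real (n choose Suc i) = real (n choose i) * (real n - real i)"
    using True by (metis of_nat_diff of_nat_mult)
  hence "real (n choose Suc i) * fact (Suc i) = real (n choose i) * (real n - real i) * fact i"
    by (simp only: fact_Suc of_nat_mult) (simp add: mult_ac)
  thus ?thesis using assms by (simp only: bcoef_def power_Suc) (simp add: field_simps)
qed (simp add: bcoef_eq_0)

lemma bcoef_le:
  assumes "b > 0" "real n \<le> \<alpha> * real b" "\<alpha> \<ge> 0"
  shows "bcoef n b i \<le> \<alpha> ^ i"
proof (induction i)
  case (Suc i)
  have "(real n - real i) / real b \<le> \<alpha>" using assms by (simp add: field_simps)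
  hence "bcoef n b i * ((real n - real i) / real b) \<le> bcoef n b i * \<alpha>" by (intro mult_left_mono bcoef_nonneg)
  also have "... \<le> \<alpha> ^ i * \<alpha>" using Suc assms by (intro mult_right_mono) auto
  finally show ?case using bcoef_Suc[OF assms(1)] by (simp add: mult.commute)
qed auto

text \<open>The factor (n-i)/b of the falling factorial is at least \<alpha> (1 - (i+1)/b), the
  rounding of n being absorbed by \<alpha> >= 1, and 1 + 2 + ... + i <= i^2. Where i^2 >= b the
  claim only says that \<open>bcoef\<close> is nonnegative.\<close>

lemma bcoef_ge:
  assumes "b > 0" "real n \<ge> \<alpha> * real b - 1" "\<alpha> \<ge> 1"
  shows "bcoef n b i \<ge> \<alpha> ^ i * (1 - (real i)^2 / real b)"
proof (induction i)
  case (Suc i)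
  show ?case
  proof (cases "(real (Suc i))^2 \<ge> real b")
    case True
    hence "\<alpha> ^ Suc i * (1 - (real (Suc i))^2 / real b) \<le> 0"
      using assms by (intro mult_nonneg_nonpos) (auto simp: field_simps)
    thus ?thesis using bcoef_nonneg[of n b "Suc i"] by linarith
  next
    case False
    have "real (Suc i) * 1 \<le> real (Suc i) * real (Suc i)" by (intro mult_left_mono) auto
    also have "... < real b" using False by (simp only: not_le power2_eq_square)
    finally have lt: "real (Suc i) < real b" by simp
    have i2: "(real i)^2 < real b" using False by (simp add: power2_eq_square algebra_simps)
    have 1: "\<alpha> * (1 - real (Suc i) / real b) \<le> (real n - real i) / real b"
    proof -
      have "\<alpha> * (1 - real (Suc i) / real b) = (\<alpha> * real b - \<alpha> * real (Suc i)) / real b" using assms by (simp add: field_simps)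
      also have "... \<le> (real n - real i) / real b"
      proof (intro divide_right_mono)
        have "1 * real (Suc i) \<le> \<alpha> * real (Suc i)" using assms by (intro mult_right_mono) auto
        thus "\<alpha> * real b - \<alpha> * real (Suc i) \<le> real n - real i" using assms(2) of_nat_Suc[of i, where ?'a = real] by argo
      qed auto
      finally show ?thesis .
    qed
    have "\<alpha> ^ Suc i * (1 - (real (Suc i))^2 / real b) \<le> \<alpha> ^ Suc i * ((1 - (real i)^2 / real b) * (1 - real (Suc i) / real b))"
    proof (intro mult_left_mono)
      have "(1 - x) * (1 - y) \<ge> 1 - (x + y)" if "x \<ge> 0" "y \<ge> 0" for x y :: real using that by (simp add: algebra_simps)
      from this[of "(real i)^2 / real b" "real (Suc i) / real b"]
      have "(1 - (real i)^2 / real b) * (1 - real (Suc i) / real b) \<ge> 1 - ((real i)^2 + real (Suc i)) / real b" by (simp add: add_divide_distrib)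
      moreover have "((real i)^2 + real (Suc i)) / real b \<le> (real (Suc i))^2 / real b" by (intro divide_right_mono) (auto simp: power2_eq_square algebra_simps)
      ultimately show "1 - (real (Suc i))^2 / real b \<le> (1 - (real i)^2 / real b) * (1 - real (Suc i) / real b)" by argo
    qed (use assms in auto)
    also have "... = (\<alpha> ^ i * (1 - (real i)^2 / real b)) * (\<alpha> * (1 - real (Suc i) / real b))" by (simp add: mult_ac)
    also have "... \<le> bcoef n b i * ((real n - real i) / real b)"
    proof (intro mult_mono Suc 1 bcoef_nonneg)
      show "0 \<le> \<alpha> * (1 - real (Suc i) / real b)" using lt assms by (intro mult_nonneg_nonneg) auto
    qed
    finally show ?thesis using bcoef_Suc[OF assms(1)] by simp
  qed
qed auto

lemma bcoef_mult_ge: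
  assumes "b > 0" "\<alpha> * real b - 1 \<le> real n" "\<alpha> \<ge> 1" "\<beta> * real b - 1 \<le> real m" "\<beta> \<ge> 1"
  shows "\<alpha> ^ i * \<beta> ^ j * (1 - ((real i)^2 / real b + (real j)^2 / real b)) \<le> bcoef n b i * bcoef m b j"
proof -
  define r s where "r = (real i)^2 / real b" and "s = (real j)^2 / real b"
  have ge: "\<alpha> ^ i * (1 - r) \<le> bcoef n b i" "\<beta> ^ j * (1 - s) \<le> bcoef m b j"
    unfolding r_def s_def using assms by (auto intro!: bcoef_ge)
  have rs: "r \<ge> 0" "s \<ge> 0" by (simp_all add: r_def s_def)
  show ?thesis unfolding r_def[symmetric] s_def[symmetric]
  proof (cases "r \<le> 1 \<and> s \<le> 1")
    case True
    have "\<alpha> ^ i * \<beta> ^ j * (1 - (r + s)) \<le> \<alpha> ^ i * \<beta> ^ j * ((1 - r) * (1 - s))"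
      using rs assms by (intro mult_left_mono) (auto simp: algebra_simps)
    also have "... = (\<alpha> ^ i * (1 - r)) * (\<beta> ^ j * (1 - s))" by simp
    also have "... \<le> bcoef n b i * bcoef m b j" using ge True assms bcoef_nonneg by (intro mult_mono) auto
    finally show "\<alpha> ^ i * \<beta> ^ j * (1 - (r + s)) \<le> bcoef n b i * bcoef m b j" .
  next
    case False
    hence "\<alpha> ^ i * \<beta> ^ j * (1 - (r + s)) \<le> 0" using rs assms by (intro mult_nonneg_nonpos) auto
    thus "\<alpha> ^ i * \<beta> ^ j * (1 - (r + s)) \<le> bcoef n b i * bcoef m b j"
      using bcoef_nonneg by (meson mult_nonneg_nonneg order_trans)
  qed
qed

lemma power_eq_sum_bcoef:
  fixes X :: complex
  shows "(1 + X / of_nat b) ^ n = (\<Sum>i\<le>n. of_real (bcoef n b i / fact i) * X ^ i)"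
  unfolding add.commute[of 1] binomial_ring
  by (intro sum.cong refl) (simp add: bcoef_def power_divide)

text \<open>Doubling c pays for a geometric series: the square of (2c)^M / sqrt (M!) is a single
  term of the series for exp (4 c^2).\<close>

lemma sum_power_div_sqrt_fact:
  assumes "c \<ge> 0"
  shows "(\<Sum>M\<le>D. c ^ M / sqrt (fact M)) \<le> 2 * exp (2 * c^2)"
proof -
  have *: "c ^ M / sqrt (fact M) \<le> exp (2 * c^2) * (1/2) ^ M" for M
  proof -
    have "((2 * c) ^ M)^2 = ((2 * c)^2) ^ M" by (simp only: power_mult[symmetric] mult.commute)
    hence "((2 * c) ^ M / sqrt (fact M))^2 = (4 * c^2) ^ M / fact M"
      by (simp add: power_divide power_mult_distrib)
    also have "... \<le> exp (4 * c^2)"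
    proof -
      have "(\<lambda>n. (4 * c^2) ^ n /\<^sub>R fact n) sums exp (4 * c^2)" by (rule exp_converges)
      from sum_le_suminf[OF sums_summable[OF this], of "{M}"] sums_unique[OF this]
      show ?thesis by (simp add: divide_inverse mult.commute)
    qed
    also have "... = (exp (2 * c^2))^2" by (simp flip: exp_double)
    finally have "(2 * c) ^ M / sqrt (fact M) \<le> exp (2 * c^2)" by (rule power2_le_imp_le) simp
    hence "(2 * c) ^ M / sqrt (fact M) * (1/2)^M \<le> exp (2 * c^2) * (1/2)^M" by (intro mult_right_mono) auto
    thus ?thesis by (simp add: power_mult_distrib power_one_over)
  qed
  have "(\<Sum>M\<le>D. c ^ M / sqrt (fact M)) \<le> (\<Sum>M\<le>D. exp (2 * c^2) * (1/2) ^ M)" by (intro sum_mono *)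
  also have "... = exp (2 * c^2) * (\<Sum>M\<le>D. (1/2) ^ M)" by (simp add: sum_distrib_left)
  also have "(\<Sum>M\<le>D. (1/2) ^ M) \<le> (2::real)" by (simp add: sum_gp0 atMost_atLeast0[symmetric] sum_gp)
  finally show ?thesis by (simp add: mult.commute)
qed

lemma square_le_two_power: "(real M)^2 \<le> 2 * 2 ^ M"
proof -
  have "M^2 \<le> 2 * 2 ^ M"
  proof (cases "M < 4")
    case True
    hence "M \<in> {0,1,2,3}" by auto
    thus ?thesis by auto
  next
    case False
    hence "M \<ge> 4" by simp
    thus ?thesis
    proof (induction M rule: dec_induct)
      case (step M)
      have "(Suc M)^2 = M^2 + (2 * M + 1)" by (simp add: power2_eq_square)
      also have "2 * M + 1 \<le> M^2"
      proof -
        have "4 * M \<le> M * M" using step.hyps(1) by (intro mult_right_mono) auto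
        hence "2 * M + 1 \<le> M * M" using step.hyps(1) by linarith
        thus ?thesis by (simp only: power2_eq_square)
      qed
      finally show ?case using step by simp
    qed auto
  qed
  hence "real (M^2) \<le> real (2 * 2 ^ M)" by (simp only: of_nat_le_iff)
  thus ?thesis by simp
qed

definition psum :: "nat set \<Rightarrow> real \<Rightarrow> complex" where
  "psum I t = (\<Sum>p\<in>I. of_real (1 / sqrt (real p)) * chi t p)"

context
  fixes I :: "nat set"
  assumes I: "finite I" "\<And>p. p \<in> I \<Longrightarrow> prime p"
begin

lemma psum_shift: "psum I (t + u) = (\<Sum>p\<in>I. (of_real (1 / sqrt (real p)) * chi u p) * chi t p)"
  by (simp add: psum_def chi_add mult_ac)

lemma norm2_sqrt: "p \<in> I \<Longrightarrow> (norm (of_real (1 / sqrt (real p)) * (c :: complex)))^2 = (norm c)^2 / real p"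
  by (simp add: norm_mult norm_divide power_mult_distrib power_divide)

lemma disjoint_layer: "M \<noteq> M' \<Longrightarrow> layer I M \<inter> layer I M' = {}"
  using layer_size[OF I] by auto

text \<open>
  With \<open>X\<close>, \<open>Y\<close> the two shifts of the prime sum, \<open>(1 + X/b)^n (1 + Y/b)^m\<close> is compared with the truncation
  \<open>U\<close> of \<open>exp (\<alpha> X + Y)\<close>. The layers of \<open>U\<close> are orthogonal, which gives \<open>exp (W/2)\<close>; the difference
  has coefficients of size \<open>O(1/b)\<close> in the monomials \<open>X^i Y^l\<close>.
\<close>
theorem dpoly_block_power:
  fixes u v :: real
  assumes V: "(\<Sum>p\<in>I. 1 / real p) \<le> V" and \<alpha>: "\<alpha> \<ge> 1" and b: "b > 0"
    and n: "\<alpha> * real b - 1 \<le> real n" "real n \<le> \<alpha> * real b"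
    and m: "real b - 1 \<le> real m" "real m \<le> real b"
  defines "W \<equiv> (\<Sum>p\<in>I. (\<alpha>^2 + 1 + 2 * \<alpha> * cos ((u - v) * ln (real p))) / real p)"
  defines "K \<equiv> 4 * exp (8 * ((\<alpha> + 1) * sqrt V)^2)"
  shows "dpoly (\<Union>M\<le>n+m. layer I M) (exp (W / 2) + K / real b) (\<lambda>t. (1 + psum I (t + u) / of_nat b) ^ n * (1 + psum I (t + v) / of_nat b) ^ m)"
proof -
  define X where "X t = psum I (t + u)" for t
  define Y where "Y t = psum I (t + v)" for t
  define D where "D = n + m"
  define S where "S = (\<Union>M\<le>D. layer I M)"
  have S: "finite S" "\<And>n. n \<in> S \<Longrightarrow> n > 0" unfolding S_def using finite_layer[OF I] layer_pos[OF I] by auto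
  have V0: "V \<ge> 0" by (rule order_trans[OF _ V]) (auto intro: sum_nonneg)
  have lin: "dpoly I (sqrt V) (\<lambda>t. psum I (t + u))" for u
    unfolding psum_shift
  proof (rule dpolyI)
    have "(\<Sum>p\<in>I. (norm (of_real (1 / sqrt (real p)) * chi u p))^2) = (\<Sum>p\<in>I. 1 / real p)"
      by (intro sum.cong refl) (simp only: norm2_sqrt norm_chi power_one)
    thus "(\<Sum>p\<in>I. (norm (of_real (1 / sqrt (real p)) * chi u p))^2) \<le> (sqrt V)^2" using V V0 by simp
  qed (use I V0 in \<open>auto simp: prime_gt_0_nat\<close>)
  have mono: "dpoly (layer I (l + i)) (sqrt (fact (l + i)) * sqrt V ^ (l + i)) (\<lambda>t. X t ^ i * Y t ^ l)" for i l
    unfolding X_def Y_def by (intro dpoly_layer_power_mult[OF I] dpoly_layer_power[OF I] lin)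
  \<comment> \<open>The amount by which the coefficient of X^i Y^l falls short of that of exp
    (\<alpha> X + Y); it is nonnegative and of relative size (i+l)^2 / b.\<close>
  define e where "e i l = \<alpha> ^ i / (fact i * fact l) - bcoef n b i * bcoef m b l / (fact i * fact l)" for i l
  have e: "0 \<le> e i l" "e i l \<le> \<alpha> ^ i / (fact i * fact l) * ((real (i + l))^2 / real b)" for i l
  proof -
    have 1: "bcoef n b i \<le> \<alpha> ^ i" "bcoef m b l \<le> 1 ^ l" using b n m \<alpha> by (auto intro!: bcoef_le simp del: power_one)
    have "bcoef n b i * bcoef m b l \<le> \<alpha> ^ i * 1"
      using 1 bcoef_nonneg \<alpha> by (intro mult_mono) auto
    thus "0 \<le> e i l" unfolding e_def by (simp add: divide_right_mono flip: diff_divide_distrib)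
    have "\<alpha> ^ i * (1 - ((real i)^2 / real b + (real l)^2 / real b)) \<le> bcoef n b i * bcoef m b l"
      using bcoef_mult_ge[of b \<alpha> n 1 m i l] b n m \<alpha> by simp
    also have "\<alpha> ^ i * (1 - ((real i)^2 / real b + (real l)^2 / real b)) = \<alpha> ^ i - \<alpha> ^ i * (((real i)^2 + (real l)^2) / real b)"
      by (simp add: algebra_simps add_divide_distrib)
    finally have "\<alpha> ^ i - bcoef n b i * bcoef m b l \<le> \<alpha> ^ i * (((real i)^2 + (real l)^2) / real b)" by simp
    also have "... \<le> \<alpha> ^ i * ((real (i + l))^2 / real b)"
      using \<alpha> by (intro mult_left_mono divide_right_mono) (auto simp: power2_eq_square algebra_simps)
    finally have "(\<alpha> ^ i - bcoef n b i * bcoef m b l) / (fact i * fact l) \<le> \<alpha> ^ i * ((real (i + l))^2 / real b) / (fact i * fact l)"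
      by (intro divide_right_mono) auto
    thus "e i l \<le> \<alpha> ^ i / (fact i * fact l) * ((real (i + l))^2 / real b)" unfolding e_def by (simp add: diff_divide_distrib mult_ac)
  qed
  define E where "E t = (\<Sum>M\<le>D. \<Sum>i\<le>M. of_real (e i (M - i)) * (X t ^ i * Y t ^ (M - i)))" for t
  define U where "U t = (\<Sum>M\<le>D. (of_real \<alpha> * X t + Y t) ^ M / fact M)" for t
  have DPE: "dpoly S (\<Sum>M\<le>D. \<Sum>i\<le>M. e i (M - i) * (sqrt (fact M) * sqrt V ^ M)) E"
    unfolding E_def
  proof (intro dpoly_sum S)
    fix M i assume Mi: "M \<in> {..D}" "i \<in> {..M}"
    have "dpoly S (sqrt (fact M) * sqrt V ^ M) (\<lambda>t. X t ^ i * Y t ^ (M - i))"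
      using mono[of "M - i" i] Mi S by (intro dpoly_mono[OF mono[of "M - i" i, simplified]]) (auto simp: S_def)
    from dpoly_scale[OF this, of "of_real (e i (M - i))"]
    show "dpoly S (e i (M - i) * (sqrt (fact M) * sqrt V ^ M)) (\<lambda>t. of_real (e i (M - i)) * (X t ^ i * Y t ^ (M - i)))"
      using e(1) by simp
  qed
  have err: "(\<Sum>M\<le>D. \<Sum>i\<le>M. e i (M - i) * (sqrt (fact M) * sqrt V ^ M)) \<le> K / real b"
  proof -
    have inner: "(\<Sum>i\<le>M. e i (M - i) * (sqrt (fact M) * sqrt V ^ M)) \<le> (2 / real b) * ((2 * ((\<alpha> + 1) * sqrt V)) ^ M / sqrt (fact M))" for M
    proof -
      have "(\<Sum>i\<le>M. e i (M - i)) \<le> (\<Sum>i\<le>M. \<alpha> ^ i / (fact i * fact (M - i)) * ((real M)^2 / real b))"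
        using e(2)[of i "M - i" for i] by (intro sum_mono) (metis atMost_iff le_add_diff_inverse)
      also have "... = (\<Sum>i\<le>M. of_nat (M choose i) * \<alpha> ^ i * 1 ^ (M - i)) / fact M * ((real M)^2 / real b)"
        unfolding sum_divide_distrib sum_distrib_right
        by (intro sum.cong refl) (simp add: binomial_fact)
      also have "... = (\<alpha> + 1) ^ M / fact M * ((real M)^2 / real b)" by (simp add: binomial_ring)
      \<comment> \<open>The polynomial factor M^2 is traded for a doubled base;
        \<open>sum_power_div_sqrt_fact\<close> then gives 2 * 2^2 = 8 in the exponent of
        \<open>K\<close>.\<close>
      also have "... \<le> (\<alpha> + 1) ^ M / fact M * ((2 * 2 ^ M) / real b)"
        using \<alpha> square_le_two_power by (intro mult_left_mono divide_right_mono) auto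
      finally have "(\<Sum>i\<le>M. e i (M - i)) * (sqrt (fact M) * sqrt V ^ M) \<le> (\<alpha> + 1) ^ M / fact M * ((2 * 2 ^ M) / real b) * (sqrt (fact M) * sqrt V ^ M)"
        using V0 by (intro mult_right_mono) auto
      also have "... = (2 / real b) * ((2 * ((\<alpha> + 1) * sqrt V)) ^ M * (sqrt (fact M) / fact M))"
        by (simp only: power_mult_distrib) (simp add: mult_ac)
      also have "sqrt (fact M) / fact M = 1 / sqrt (fact M :: real)" by (simp add: divide_simps)
      finally show ?thesis by (simp add: sum_distrib_right)
    qed
    have "(\<Sum>M\<le>D. \<Sum>i\<le>M. e i (M - i) * (sqrt (fact M) * sqrt V ^ M)) \<le> (\<Sum>M\<le>D. (2 / real b) * ((2 * ((\<alpha> + 1) * sqrt V)) ^ M / sqrt (fact M)))"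
      by (intro sum_mono inner)
    also have "... = (2 / real b) * (\<Sum>M\<le>D. (2 * ((\<alpha> + 1) * sqrt V)) ^ M / sqrt (fact M))" by (simp only: sum_distrib_left)
    also have "... \<le> (2 / real b) * (2 * exp (2 * (2 * ((\<alpha> + 1) * sqrt V))^2))"
      using \<alpha> V0 by (intro mult_left_mono sum_power_div_sqrt_fact) auto
    also have "... = K / real b" by (simp add: K_def power_mult_distrib)
    finally show ?thesis .
  qed
  have DPU: "dpoly S (exp (W / 2)) U"
  proof -
    define c where "c p = of_real (1 / sqrt (real p)) * (of_real \<alpha> * chi u p + chi v p)" for p
    have XY: "(\<lambda>t. of_real \<alpha> * X t + Y t) = (\<lambda>t. \<Sum>p\<in>I. c p * chi t p)"
      by (simp add: X_def Y_def psum_shift c_def sum_distrib_left algebra_simps sum.distrib)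
    have cn: "(norm (c p))^2 = (\<alpha>^2 + 1 + 2 * \<alpha> * cos ((u - v) * ln (real p))) / real p" if "p \<in> I" for p
    proof -
      define a b c d where abcd: "a = cos (u * ln (real p))" "b = sin (u * ln (real p))" "c = cos (v * ln (real p))" "d = sin (v * ln (real p))"
      have "(norm (of_real \<alpha> * chi u p + chi v p))^2 = (\<alpha> * a + c)^2 + (- (\<alpha> * b) - d)^2"
        unfolding cmod_power2 chi_def abcd by simp
      also have "... = \<alpha>^2 * (a^2 + b^2) + (c^2 + d^2) + 2 * \<alpha> * (a * c + b * d)"
        by (simp add: power2_eq_square algebra_simps)
      also have "... = \<alpha>^2 + 1 + 2 * \<alpha> * cos ((u - v) * ln (real p))"
        by (simp only: abcd sin_cos_squared_add2 mult_1_right left_diff_distrib cos_diff)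
      finally show ?thesis unfolding c_def norm2_sqrt[OF that] by simp
    qed
    have csum: "(\<Sum>p\<in>I. (norm (c p))^2) = W" unfolding W_def by (intro sum.cong refl cn)
    have W0: "W \<ge> 0" unfolding csum[symmetric] by (intro sum_nonneg) auto
    have "dpoly (layer I M) (sqrt (W ^ M / fact M)) (\<lambda>t. (of_real \<alpha> * X t + Y t) ^ M / fact M)" for M
    proof -
      have "dpoly I (sqrt W) (\<lambda>t. of_real \<alpha> * X t + Y t)"
        unfolding XY using I W0 csum by (intro dpolyI) (auto simp: prime_gt_0_nat)
      hence "dpoly (layer I M) (sqrt (fact M) * sqrt W ^ M) (\<lambda>t. (of_real \<alpha> * X t + Y t) ^ M)"
        using dpoly_layer_power[OF I] by blast
      from dpoly_scale[OF this, of "1 / fact M"]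
      have "dpoly (layer I M) (1 / fact M * (sqrt (fact M) * sqrt W ^ M)) (\<lambda>t. (of_real \<alpha> * X t + Y t) ^ M / fact M)" by (simp add: norm_divide)
      moreover have "1 / fact M * (sqrt (fact M) * sqrt W ^ M) = sqrt (W ^ M / fact M)"
        by (simp add: real_sqrt_divide real_sqrt_power real_div_sqrt divide_simps)
      ultimately show ?thesis by simp
    qed
    hence "dpoly S (sqrt (\<Sum>M\<le>D. (sqrt (W ^ M / fact M))^2)) U"
      unfolding S_def U_def by (intro dpoly_disjoint_sum disjoint_layer) auto
    moreover have "(\<Sum>M\<le>D. (sqrt (W ^ M / fact M))^2) \<le> exp W"
    proof -
      have sm: "(\<lambda>n. W ^ n /\<^sub>R fact n) sums exp W" by (rule exp_converges)
      from sum_le_suminf[OF sums_summable[OF this], of "{..D}"] sums_unique[OF this] W0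
      show ?thesis by (simp add: divide_inverse mult.commute)
    qed
    hence "sqrt (\<Sum>M\<le>D. (sqrt (W ^ M / fact M))^2) \<le> exp (W / 2)"
      by (intro real_le_lsqrt) (simp_all flip: exp_double)
    ultimately show ?thesis by (rule dpoly_mono')
  qed
  have id: "(1 + X t / of_nat b) ^ n * (1 + Y t / of_nat b) ^ m = U t + (-1) * E t" for t
  proof -
    let ?A = "\<lambda>i. of_real (bcoef n b i / fact i) * X t ^ i" and ?B = "\<lambda>l. of_real (bcoef m b l / fact l) * Y t ^ l"
    \<comment> \<open>Read as polynomials evaluated at 1, the two sums are regrouped by the total
      degree M = i + l; coefficients beyond n and m vanish, as \<open>polynomial_product\<close>
      demands.\<close>
    have "(1 + X t / of_nat b) ^ n * (1 + Y t / of_nat b) ^ m = (\<Sum>i\<le>n. ?A i * 1 ^ i) * (\<Sum>l\<le>m. ?B l * 1 ^ l)"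
      by (simp add: power_eq_sum_bcoef)
    also have "... = (\<Sum>M\<le>n+m. (\<Sum>i\<le>M. ?A i * ?B (M - i)) * 1 ^ M)"
      by (rule polynomial_product) (simp_all add: bcoef_eq_0)
    also have "... = (\<Sum>M\<le>D. \<Sum>i\<le>M. of_real (\<alpha> ^ i / (fact i * fact (M - i)) - e i (M - i)) * (X t ^ i * Y t ^ (M - i)))"
      unfolding D_def by (simp add: e_def mult_ac)
    also have "... = (\<Sum>M\<le>D. \<Sum>i\<le>M. of_real (\<alpha> ^ i / (fact i * fact (M - i))) * (X t ^ i * Y t ^ (M - i))) + (-1) * E t"
      by (simp add: E_def left_diff_distrib sum_subtractf)
    also have "(\<Sum>M\<le>D. \<Sum>i\<le>M. of_real (\<alpha> ^ i / (fact i * fact (M - i))) * (X t ^ i * Y t ^ (M - i))) = U t"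
      unfolding U_def binomial_ring sum_divide_distrib
      by (intro sum.cong refl) (simp add: binomial_fact power_mult_distrib)
    finally show ?thesis .
  qed
  have "dpoly S (exp (W / 2) + norm (-1 :: complex) * (K / real b)) (\<lambda>t. U t + (-1) * E t)"
    by (intro dpoly_add DPU dpoly_scale dpoly_mono'[OF DPE err])
  also have "(\<lambda>t. U t + (-1) * E t) = (\<lambda>t. (1 + psum I (t + u) / of_nat b) ^ n * (1 + psum I (t + v) / of_nat b) ^ m)"
    by (intro ext) (simp only: id[symmetric] X_def Y_def)
  finally show ?thesis by (simp add: S_def D_def)
qed

end

section \<open>Sums over greatest common divisors and the lower bound\<close>

definition upto_real :: "real \<Rightarrow> nat set" where
  "upto_real Y = {n. n > 0 \<and> real n \<le> Y}"

lemma upto_real_eq: "upto_real Y = {1..nat \<lfloor>Y\<rfloor>}"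
proof -
  have "n > 0 \<Longrightarrow> real n \<le> Y \<longleftrightarrow> n \<le> nat \<lfloor>Y\<rfloor>" for n by linarith
  thus ?thesis by (auto simp: upto_real_def)
qed

lemma finite_upto_real [simp]: "finite (upto_real Y)" by (simp add: upto_real_eq)

lemma upto_real_pos: "n \<in> upto_real Y \<Longrightarrow> n > 0" by (simp add: upto_real_def)

lemma upto_real_mult: "m \<in> upto_real X \<Longrightarrow> n \<in> upto_real Y \<Longrightarrow> m * n \<in> upto_real (X * Y)"
  by (auto simp: upto_real_def intro!: mult_mono)

lemma sum_multiples:
  assumes "a > 0"
  shows "(\<Sum>m\<in>{m \<in> upto_real Z. a dvd m}. f m) = (\<Sum>k\<in>upto_real (Z / real a). f (a * k))"
  by (rule sum.reindex_bij_witness[where i = "\<lambda>k. a * k" and j = "\<lambda>m. m div a"])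
     (use assms in \<open>auto simp: upto_real_def field_simps\<close>)

text \<open>The kernel left over when a zeta sum at 1/2 is summed over the common multiples of m and
  n: it equals sqrt (m n) / lcm m n.\<close>

definition gcdk :: "nat \<Rightarrow> nat \<Rightarrow> real" where
  "gcdk m n = real (gcd m n) / sqrt (real m * real n)"

lemma gcdk_nonneg: "gcdk m n \<ge> 0" by (simp add: gcdk_def)

text \<open>The gcd is supermultiplicative. With nonnegative coefficients this makes lower bounds
  for \<open>gcdsum\<close> multiply in \<open>gpoly_mult\<close> without any coprimality
  condition.\<close>

lemma gcdk_mult:
  assumes "m > 0" "n > 0" "m' > 0" "n' > 0"
  shows "gcdk m m' * gcdk n n' \<le> gcdk (m * n) (m' * n')"
proof -
  have "gcd m m' * gcd n n' dvd gcd (m * n) (m' * n')" by (intro gcd_greatest mult_dvd_mono) auto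
  hence "gcd m m' * gcd n n' \<le> gcd (m * n) (m' * n')" using assms by (intro dvd_imp_le) auto
  hence "real (gcd m m') * real (gcd n n') \<le> real (gcd (m * n) (m' * n'))" by (metis of_nat_le_iff of_nat_mult)
  hence "real (gcd m m') * real (gcd n n') / sqrt (real (m * n) * real (m' * n')) \<le> gcdk (m * n) (m' * n')"
    unfolding gcdk_def by (intro divide_right_mono) auto
  moreover have "gcdk m m' * gcdk n n' = real (gcd m m') * real (gcd n n') / sqrt (real (m * n) * real (m' * n'))"
    by (simp add: gcdk_def real_sqrt_mult mult_ac)
  ultimately show ?thesis by simp
qed

definition gcdsum :: "real \<Rightarrow> (nat \<Rightarrow> real) \<Rightarrow> real" where
  "gcdsum Y r = (\<Sum>m\<in>upto_real Y. \<Sum>n\<in>upto_real Y. r m * r n * gcdk m n)"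

definition gpoly :: "real \<Rightarrow> real \<Rightarrow> (real \<Rightarrow> complex) \<Rightarrow> bool" where
  "gpoly Y s A \<longleftrightarrow> (\<exists>r. (\<forall>n. r n \<ge> 0) \<and> (\<forall>t. A t = (\<Sum>n\<in>upto_real Y. of_real (r n) * chi t n)) \<and> s \<le> gcdsum Y r)"

lemma gpoly_mono:
  assumes "gpoly Y s A" "Y \<le> Y'" "s' \<le> s"
  shows "gpoly Y' s' A"
proof -
  from assms obtain r where r: "\<And>n. r n \<ge> 0" "\<And>t. A t = (\<Sum>n\<in>upto_real Y. of_real (r n) * chi t n)" "s \<le> gcdsum Y r"
    unfolding gpoly_def by blast
  define r' where "r' n = (if n \<in> upto_real Y then r n else 0)" for n
  have sub: "upto_real Y \<subseteq> upto_real Y'" using assms(2) by (auto simp: upto_real_def)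
  have "gcdsum Y' r' = gcdsum Y r" unfolding gcdsum_def
    by (intro sum.mono_neutral_cong_right) (use sub in \<open>auto simp: r'_def\<close>)
  moreover have "(\<Sum>n\<in>upto_real Y'. of_real (r' n) * chi t n) = A t" for t unfolding r(2)
    by (intro sum.mono_neutral_cong_right) (use sub in \<open>auto simp: r'_def\<close>)
  moreover have "\<forall>n. r' n \<ge> 0" using r(1) by (simp add: r'_def)
  ultimately show ?thesis using r(3) assms(3) unfolding gpoly_def by (intro exI[of _ r']) auto
qed

lemma gpoly_one: "gpoly 1 1 (\<lambda>t. 1)"
proof -
  have "upto_real 1 = {1}" by (auto simp: upto_real_eq)
  thus ?thesis unfolding gpoly_def gcdsum_def by (intro exI[of _ "\<lambda>_. 1"]) (auto simp: gcdk_def)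
qed

lemma sum_group_mult:
  fixes h :: "nat \<Rightarrow> nat \<Rightarrow> 'a :: comm_semiring_0"
  shows "(\<Sum>N\<in>upto_real (X * Y). (\<Sum>(m,n)\<in>{x \<in> upto_real X \<times> upto_real Y. fst x * snd x = N}. h m n) * \<phi> N)
       = (\<Sum>m\<in>upto_real X. \<Sum>n\<in>upto_real Y. h m n * \<phi> (m * n))"
proof -
  let ?P = "upto_real X \<times> upto_real Y"
  have "(\<Sum>N\<in>upto_real (X * Y). (\<Sum>(m,n)\<in>{x \<in> ?P. fst x * snd x = N}. h m n) * \<phi> N)
     = (\<Sum>N\<in>upto_real (X * Y). \<Sum>x\<in>{x \<in> ?P. fst x * snd x = N}. h (fst x) (snd x) * \<phi> (fst x * snd x))"
    unfolding sum_distrib_right by (intro sum.cong refl) auto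
  also have "... = (\<Sum>x\<in>?P. h (fst x) (snd x) * \<phi> (fst x * snd x))"
    by (rule sum.group) (auto intro: upto_real_mult)
  finally show ?thesis by (simp add: sum.cartesian_product case_prod_unfold)
qed

lemma gpoly_mult:
  assumes "gpoly Y s A" "gpoly Y' s' B" "s \<ge> 0" "s' \<ge> 0"
  shows "gpoly (Y * Y') (s * s') (\<lambda>t. A t * B t)"
proof -
  from assms obtain r r' where r: "\<And>n. r n \<ge> 0" "\<And>t. A t = (\<Sum>n\<in>upto_real Y. of_real (r n) * chi t n)" "s \<le> gcdsum Y r"
     and r': "\<And>n. r' n \<ge> 0" "\<And>t. B t = (\<Sum>n\<in>upto_real Y'. of_real (r' n) * chi t n)" "s' \<le> gcdsum Y' r'"
    unfolding gpoly_def by blast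
  define q where "q N = (\<Sum>(m,n)\<in>{x \<in> upto_real Y \<times> upto_real Y'. fst x * snd x = N}. r m * r' n)" for N
  have q: "(\<Sum>N\<in>upto_real (Y * Y'). q N * \<phi> N) = (\<Sum>m\<in>upto_real Y. \<Sum>n\<in>upto_real Y'. (r m * r' n) * \<phi> (m * n))" for \<phi> :: "nat \<Rightarrow> real"
    unfolding q_def by (rule sum_group_mult)
  have "A t * B t = (\<Sum>N\<in>upto_real (Y * Y'). of_real (q N) * chi t N)" for t
  proof -
    have "(\<Sum>N\<in>upto_real (Y * Y'). of_real (q N) * chi t N) = 
       (\<Sum>N\<in>upto_real (Y * Y'). (\<Sum>(m,n)\<in>{x \<in> upto_real Y \<times> upto_real Y'. fst x * snd x = N}. of_real (r m) * of_real (r' n)) * chi t N)"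
      by (simp add: q_def case_prod_unfold)
    also have "... = (\<Sum>m\<in>upto_real Y. \<Sum>n\<in>upto_real Y'. of_real (r m) * of_real (r' n) * chi t (m * n))"
      by (rule sum_group_mult)
    also have "... = (\<Sum>m\<in>upto_real Y. \<Sum>n\<in>upto_real Y'. (of_real (r m) * chi t m) * (of_real (r' n) * chi t n))"
      by (intro sum.cong refl) (simp add: chi_mult upto_real_pos)
    finally show ?thesis by (simp add: r r' sum_product)
  qed
  moreover have "q N \<ge> 0" for N unfolding q_def using r(1) r'(1) by (intro sum_nonneg) (auto simp: case_prod_unfold)
  moreover have "s * s' \<le> gcdsum (Y * Y') q"
  proof -
    have "s * s' \<le> gcdsum Y r * gcdsum Y' r'" using assms r r' by (intro mult_mono) auto
    also have "... = (\<Sum>m\<in>upto_real Y. \<Sum>n\<in>upto_real Y'. \<Sum>m'\<in>upto_real Y. \<Sum>n'\<in>upto_real Y'. (r m * r m' * gcdk m m') * (r' n * r' n' * gcdk n n'))"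
      unfolding gcdsum_def sum_product by (intro sum.cong refl sum.swap)
    also have "... \<le> (\<Sum>m\<in>upto_real Y. \<Sum>n\<in>upto_real Y'. \<Sum>m'\<in>upto_real Y. \<Sum>n'\<in>upto_real Y'. (r m * r' n) * ((r m' * r' n') * gcdk (m * n) (m' * n')))"
    proof (intro sum_mono)
      fix m n m' n' assume "m \<in> upto_real Y" "n \<in> upto_real Y'" "m' \<in> upto_real Y" "n' \<in> upto_real Y'"
      hence "gcdk m m' * gcdk n n' \<le> gcdk (m * n) (m' * n')" by (intro gcdk_mult upto_real_pos)
      hence "((r m * r' n) * (r m' * r' n')) * (gcdk m m' * gcdk n n') \<le> ((r m * r' n) * (r m' * r' n')) * gcdk (m * n) (m' * n')"
        using r(1) r'(1) by (intro mult_left_mono) auto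
      thus "(r m * r m' * gcdk m m') * (r' n * r' n' * gcdk n n') \<le> (r m * r' n) * ((r m' * r' n') * gcdk (m * n) (m' * n'))"
        by (simp add: mult_ac)
    qed
    also have "... = (\<Sum>m\<in>upto_real Y. \<Sum>n\<in>upto_real Y'. (r m * r' n) * (\<Sum>N'\<in>upto_real (Y * Y'). q N' * gcdk (m * n) N'))"
      unfolding q by (simp add: sum_distrib_left)
    also have "... = (\<Sum>N\<in>upto_real (Y * Y'). q N * (\<Sum>N'\<in>upto_real (Y * Y'). q N' * gcdk N N'))"
      by (rule q[symmetric])
    also have "... = gcdsum (Y * Y') q" by (simp add: gcdsum_def sum_distrib_left mult_ac)
    finally show ?thesis .
  qed
  ultimately show ?thesis unfolding gpoly_def by blast
qed

lemma gpoly_prod: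
  assumes "finite J" "\<And>j. j \<in> J \<Longrightarrow> gpoly (Y j) (s j) (A j)" "\<And>j. j \<in> J \<Longrightarrow> s j \<ge> 0"
  shows "gpoly (\<Prod>j\<in>J. Y j) (\<Prod>j\<in>J. s j) (\<lambda>t. \<Prod>j\<in>J. A j t)"
  using assms by (induction J) (auto intro!: gpoly_one gpoly_mult prod_nonneg)

text \<open>
  Here \<open>c\<close> lists the coefficients of \<open>D(t) R(t+u)\<close>. The test sequence \<open>M \<mapsto> e M * chi u M\<close> has the coefficients of
  \<open>R(t+u)\<close> times the zeta sum of length \<open>X * Y\<close> at the point \<open>1/2 + i(t+u)\<close>. In the inner product the
  twists by \<open>u\<close> cancel up to the common factor \<open>\<kappa>\<close>.
\<close>
theorem twisted_norm_lower:
  fixes r :: "nat \<Rightarrow> real"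
  assumes r: "\<And>n. r n \<ge> 0" and u: "\<bar>u\<bar> \<le> 1" and Y: "Y \<ge> 1" "729 * Y \<le> X"
  defines "c \<equiv> \<lambda>M. \<Sum>(m,n)\<in>{x \<in> upto_real X \<times> upto_real Y. fst x * snd x = M}. of_real (r n) * chi u n"
  shows "gcdsum Y r * X / (9 * (1 + ln (X * Y))) \<le> (\<Sum>M\<in>upto_real (X * Y). (norm (c M))^2)"
proof -
  define T where "T = upto_real (X * Y)"
  define S where "S = gcdsum Y r"
  have X: "X \<ge> 1" using Y by simp
  have S0: "S \<ge> 0" unfolding S_def gcdsum_def using r gcdk_nonneg by (intro sum_nonneg) auto
  define L where "L = 1 + ln (X * Y)"
  have XY: "X * Y \<ge> 1" using X Y(1) mult_mono[of 1 X 1 Y] by simp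
  have L: "L \<ge> 1" using XY by (simp add: L_def)
  define e where "e M = (\<Sum>n\<in>upto_real Y. if n dvd M then r n * sqrt (real n / real M) else 0)" for M
  have e0: "e M \<ge> 0" for M unfolding e_def using r by (intro sum_nonneg) auto
  have enorm: "(\<Sum>M\<in>T. (e M)^2) \<le> S * L"
  proof -
    let ?F = "\<lambda>n n' M. if n dvd M \<and> n' dvd M then r n * r n' * (sqrt (real n / real M) * sqrt (real n' / real M)) else 0"
    have "(\<Sum>M\<in>T. (e M)^2) = (\<Sum>M\<in>T. \<Sum>n\<in>upto_real Y. \<Sum>n'\<in>upto_real Y. 
        ?F n n' M)"
      unfolding power2_eq_square e_def sum_product by (intro sum.cong refl) auto
    also have "... = (\<Sum>n\<in>upto_real Y. \<Sum>n'\<in>upto_real Y. \<Sum>M\<in>T. 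
        ?F n n' M)"
      by (subst sum.swap) (intro sum.cong refl sum.swap)
    also have "... \<le> (\<Sum>n\<in>upto_real Y. \<Sum>n'\<in>upto_real Y. r n * r n' * gcdk n n' * L)"
    proof (intro sum_mono)
      fix n n' assume n: "n \<in> upto_real Y" "n' \<in> upto_real Y"
      hence pos: "n > 0" "n' > 0" by (auto dest: upto_real_pos)
      \<comment> \<open>The common multiples are M = l g, and for these the two square roots give
        gcdk n n' / g; the harmonic sum over g is at most L.\<close>
      define l where "l = lcm n n'"
      have l: "l > 0" using pos by (simp add: l_def lcm_pos_nat)
      have "(\<Sum>M\<in>T. ?F n n' M)
         = (\<Sum>M\<in>{M \<in> T. l dvd M}. r n * r n' * (sqrt (real n / real M) * sqrt (real n' / real M)))"
        by (simp add: sum.If_cases T_def l_def Int_def)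
      also have "... = (\<Sum>g\<in>upto_real (X * Y / real l). r n * r n' * (gcdk n n' * (1 / real g)))"
        unfolding T_def sum_multiples[OF l]
      proof (intro sum.cong refl)
        fix g assume "g \<in> upto_real (X * Y / real l)"
        hence g: "g > 0" by (rule upto_real_pos)
        have gl: "real (gcd n n') * real l = real n * real n'" unfolding l_def by (metis of_nat_mult prod_gcd_lcm_nat)
        have "sqrt (x / z) * sqrt (y / z) = sqrt (x * y) / z" if "z \<ge> 0" for x y z :: real
          using that by (simp add: real_sqrt_divide real_sqrt_mult)
        hence "sqrt (real n / real (l * g)) * sqrt (real n' / real (l * g)) = sqrt (real n * real n') / real (l * g)"
          by simp
        also have "... = gcdk n n' * (1 / real g)"
        proof -
          have "sqrt (real n * real n') * sqrt (real n * real n') = real (gcd n n') * real l" using gl by simp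
          thus ?thesis using g l pos by (simp add: gcdk_def field_simps)
        qed
        finally show "r n * r n' * (sqrt (real n / real (l * g)) * sqrt (real n' / real (l * g))) = r n * r n' * (gcdk n n' * (1 / real g))"
          by simp
      qed
      also have "... = r n * r n' * gcdk n n' * (\<Sum>g\<in>upto_real (X * Y / real l). 1 / real g)"
        by (simp add: sum_distrib_left mult_ac)
      also have "... \<le> r n * r n' * gcdk n n' * L"
      proof (intro mult_left_mono)
        have "X * Y / real l \<le> X * Y / 1" using XY l by (intro divide_left_mono) auto
        hence "(\<Sum>g\<in>upto_real (X * Y / real l). 1 / real g) \<le> (\<Sum>g\<in>upto_real (X * Y). 1 / real g)"
          by (intro sum_mono2 finite_upto_real) (auto simp: upto_real_def)
        also have "... = harm (nat \<lfloor>X * Y\<rfloor>)" by (simp add: harm_def upto_real_eq inverse_eq_divide)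
        also have "... \<le> 1 + ln (real (nat \<lfloor>X * Y\<rfloor>))" using XY by (intro harm_le_ln) (simp add: le_nat_iff)
        also have "... \<le> L" unfolding L_def using XY by (intro add_left_mono ln_mono) (auto simp: le_nat_iff)
        finally show "(\<Sum>g\<in>upto_real (X * Y / real l). 1 / real g) \<le> L" .
      qed (use r gcdk_nonneg in auto)
      finally show "(\<Sum>M\<in>T. ?F n n' M) \<le> r n * r n' * gcdk n n' * L" .
    qed
    also have "... = S * L" by (simp add: S_def gcdsum_def sum_distrib_right)
    finally show ?thesis .
  qed
  define s where "s = 1/2 - \<i> * complex_of_real u"
  define \<kappa> where "\<kappa> = npow_prim s X"
  define h where "h n n' = (\<Sum>m\<in>upto_real X. if n' dvd m * n then cnj (chi u m) * of_real (sqrt (real n' / real (m * n))) else 0)" for n n'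
  have h: "norm (h n n' - \<kappa> * of_real (gcdk n n')) \<le> 9 * sqrt Y * gcdk n n'" if n: "n \<in> upto_real Y" "n' \<in> upto_real Y" for n n'
  proof -
    have pos: "n > 0" "n' > 0" using n by (auto dest: upto_real_pos)
    \<comment> \<open>n' divides m n exactly when a divides m. Hence \<open>h n n'\<close> is a zeta
      sum of length X/a at the point s, times gcdk n n' * sqrt a and a factor of modulus 1.\<close>
    define g a where "g = gcd n n'" and "a = n' div g"
    have g: "g > 0" "n' = a * g" using pos by (auto simp: g_def a_def)
    have a: "a > 0" using g pos by auto
    have "a \<le> n'" using g by simp
    hence aY: "real a \<le> Y" using n(2) unfolding upto_real_def by (simp add: order_trans[of "real a" "real n'"])
    hence aX: "X / real a \<ge> 1" using Y a by (simp add: field_simps)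
    have dv: "n' dvd m * n \<longleftrightarrow> a dvd m" for m
    proof -
      obtain b where b: "n = b * g" unfolding g_def by (metis gcd_dvd1 dvdE mult.commute)
      have "coprime (n div g) (n' div g)" unfolding g_def using pos by (intro div_gcd_coprime) auto
      moreover have "n div g = b" "n' div g = a" using b g by simp_all
      ultimately have "coprime b a" by simp
      have "n' dvd m * n \<longleftrightarrow> a * g dvd (m * b) * g" using b g by (simp add: mult_ac)
      also have "... \<longleftrightarrow> a dvd m * b" using g(1) by simp
      also have "... \<longleftrightarrow> a dvd m" using \<open>coprime b a\<close> by (simp add: coprime_dvd_mult_left_iff coprime_commute)
      finally show ?thesis .
    qed
    have "h n n' = (\<Sum>m\<in>{m \<in> upto_real X. a dvd m}. cnj (chi u m) * of_real (sqrt (real n' / real (m * n))))"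
      by (simp add: h_def dv sum.If_cases Int_def)
    also have "... = (\<Sum>k\<in>upto_real (X / real a). (cnj (chi u a) * of_real (sqrt (real g / real n))) * npow s (real k))"
      unfolding sum_multiples[OF a]
    proof (intro sum.cong refl)
      fix k assume "k \<in> upto_real (X / real a)"
      hence k: "k > 0" by (rule upto_real_pos)
      have "npow s (real k) = of_real (exp (- (ln (real k) / 2))) * cis (u * ln (real k))"
        by (simp add: npow_def s_def cis_conv_exp exp_of_real[symmetric] exp_add[symmetric] algebra_simps)
      also have "exp (- (ln (real k) / 2)) = 1 / sqrt (real k)"
        using k by (simp add: exp_minus inverse_eq_divide ln_sqrt[symmetric])
      finally have nk: "npow s (real k) = of_real (1 / sqrt (real k)) * cnj (chi u k)"
        by (simp add: chi_def cis_cnj)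
      have "sqrt (real n' / real (a * k * n)) = sqrt (real g / real n) * (1 / sqrt (real k))"
        using g a k by (simp add: real_sqrt_divide real_sqrt_mult)
      thus "cnj (chi u (a * k)) * of_real (sqrt (real n' / real (a * k * n))) = (cnj (chi u a) * of_real (sqrt (real g / real n))) * npow s (real k)"
        using a k nk by (simp add: chi_mult)
    qed
    also have "... = (cnj (chi u a) * of_real (sqrt (real g / real n))) * (\<Sum>k=1..nat \<lfloor>X / real a\<rfloor>. npow s (real k))"
      by (simp add: sum_distrib_left upto_real_eq)
    finally have hn: "h n n' = (cnj (chi u a) * of_real (sqrt (real g / real n))) * (\<Sum>k=1..nat \<lfloor>X / real a\<rfloor>. npow s (real k))" .
    have ga: "gcdk n n' * sqrt (real a) = sqrt (real g / real n)"
    proof -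
      have "gcd n n' = g" by (simp add: g_def)
      thus ?thesis using pos g a unfolding gcdk_def by (simp add: real_sqrt_divide real_sqrt_mult field_simps)
    qed
    \<comment> \<open>The dependence of the main term (X/a)^(1-s) / (1-s) on a cancels against the
      prefactor, so all pairs n, n' share the same \<kappa> and the double sum becomes \<kappa>
      times the gcd sum.\<close>
    have "npow_prim s (X / real a) * (cnj (chi u a) * of_real (sqrt (real a))) = \<kappa>"
    proof -
      have "npow (s - 1) (X / real a) * npow (s - 1) (real a) = npow (s - 1) X"
        using X a by (simp add: npow_def ln_div exp_add[symmetric] algebra_simps)
      moreover have "npow (s - 1) (real a) = cnj (chi u a) * of_real (sqrt (real a))"
      proof -
        have "npow (s - 1) (real a) = of_real (exp (ln (real a) / 2)) * cis (u * ln (real a))"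
          by (simp add: npow_def s_def cis_conv_exp exp_of_real[symmetric] exp_add[symmetric] algebra_simps)
        thus ?thesis using a by (simp add: ln_sqrt[symmetric] chi_def cis_cnj mult.commute)
      qed
      ultimately show ?thesis by (simp add: \<kappa>_def npow_prim_def)
    qed
    hence "\<kappa> * of_real (gcdk n n') = (cnj (chi u a) * of_real (gcdk n n' * sqrt (real a))) * npow_prim s (X / real a)" by (simp add: mult_ac)
    hence "h n n' - \<kappa> * of_real (gcdk n n') = (cnj (chi u a) * of_real (sqrt (real g / real n))) * ((\<Sum>k=1..nat \<lfloor>X / real a\<rfloor>. npow s (real k)) - npow_prim s (X / real a))"
      unfolding hn ga by (simp only: right_diff_distrib)
    hence "norm (h n n' - \<kappa> * of_real (gcdk n n')) = sqrt (real g / real n) * norm ((\<Sum>k=1..nat \<lfloor>X / real a\<rfloor>. npow s (real k)) - npow_prim s (X / real a))"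
      by (simp add: norm_mult)
    also have "... \<le> sqrt (real g / real n) * 9" unfolding s_def using u aX by (intro mult_left_mono sum_npow_half) auto
    also have "... = 9 * gcdk n n' * sqrt (real a)" by (simp add: ga[symmetric])
    also have "... \<le> 9 * gcdk n n' * sqrt Y" using aY gcdk_nonneg by (intro mult_left_mono) auto
    finally show ?thesis by (simp add: mult_ac)
  qed
  define IP where "IP = (\<Sum>M\<in>T. c M * (cnj (chi u M) * of_real (e M)))"
  have IPeq: "IP = (\<Sum>n\<in>upto_real Y. \<Sum>n'\<in>upto_real Y. of_real (r n * r n') * h n n')"
  proof -
    let ?G = "\<lambda>m n n'. if n' dvd m * n then cnj (chi u m) * of_real (sqrt (real n' / real (m * n))) else 0"
    have "IP = (\<Sum>m\<in>upto_real X. \<Sum>n\<in>upto_real Y. (of_real (r n) * chi u n) * (cnj (chi u (m * n)) * of_real (e (m * n))))"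
      unfolding IP_def T_def c_def by (rule sum_group_mult)
    also have "... = (\<Sum>m\<in>upto_real X. \<Sum>n\<in>upto_real Y. \<Sum>n'\<in>upto_real Y. of_real (r n * r n') * 
        ?G m n n')"
    proof (intro sum.cong refl)
      fix m n assume mn: "m \<in> upto_real X" "n \<in> upto_real Y"
      have "chi u n * cnj (chi u (m * n)) = cnj (chi u m) * (chi u n * cnj (chi u n))"
        using mn by (simp add: chi_mult upto_real_pos)
      also have "chi u n * cnj (chi u n) = 1" by (simp add: complex_norm_square[symmetric])
      finally have *: "chi u n * cnj (chi u (m * n)) = cnj (chi u m)" by simp
      have "(of_real (r n) * chi u n) * (cnj (chi u (m * n)) * of_real (e (m * n))) = of_real (r n) * (chi u n * cnj (chi u (m * n))) * of_real (e (m * n))"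
        by (simp add: mult_ac)
      also have "... = of_real (r n) * cnj (chi u m) * of_real (e (m * n))" unfolding * ..
      also have "... = (\<Sum>n'\<in>upto_real Y. of_real (r n * r n') * ?G m n n')"
        unfolding e_def of_real_sum sum_distrib_left by (intro sum.cong refl) auto
      finally show "(of_real (r n) * chi u n) * (cnj (chi u (m * n)) * of_real (e (m * n))) = ..." .
    qed
    also have "... = (\<Sum>n\<in>upto_real Y. \<Sum>n'\<in>upto_real Y. \<Sum>m\<in>upto_real X. of_real (r n * r n') * 
        ?G m n n')"
      by (subst sum.swap) (intro sum.cong refl sum.swap)
    also have "... = (\<Sum>n\<in>upto_real Y. \<Sum>n'\<in>upto_real Y. of_real (r n * r n') * h n n')"
      unfolding h_def sum_distrib_left ..
    finally show ?thesis .
  qed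
  have "norm (IP - \<kappa> * of_real S) \<le> 9 * sqrt Y * S"
  proof -
    have "IP - \<kappa> * of_real S = (\<Sum>n\<in>upto_real Y. \<Sum>n'\<in>upto_real Y. of_real (r n * r n') * (h n n' - \<kappa> * of_real (gcdk n n')))"
      unfolding IPeq S_def gcdsum_def
      by (simp add: right_diff_distrib sum_subtractf sum_distrib_left mult_ac)
    also have "norm ... \<le> (\<Sum>n\<in>upto_real Y. \<Sum>n'\<in>upto_real Y. (r n * r n') * (9 * sqrt Y * gcdk n n'))"
      using h r by (intro sum_norm_le) (auto simp: norm_mult intro!: mult_left_mono)
    also have "... = 9 * sqrt Y * S" by (simp add: S_def gcdsum_def sum_distrib_left mult_ac)
    finally show ?thesis .
  qed
  moreover have "norm (\<kappa> * of_real S) \<le> norm IP + norm (IP - \<kappa> * of_real S)"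
    using norm_triangle_ineq4[of IP "IP - \<kappa> * of_real S"] by simp
  ultimately have ge: "norm \<kappa> * S - 9 * sqrt Y * S \<le> norm IP" using S0 by (simp add: norm_mult)
  have \<kappa>: "norm \<kappa> \<ge> 2/3 * sqrt X"
  proof -
    have "norm (npow (s - 1) X) = exp (ln X / 2)" by (simp add: norm_npow s_def)
    also have "... = sqrt X" using X by (simp add: ln_sqrt[symmetric])
    finally have 1: "norm \<kappa> = sqrt X / norm (1 - s)" by (simp add: \<kappa>_def npow_prim_def norm_divide)
    have "norm (1 - s) \<le> 1/2 + 1"
      using norm_triangle_ineq[of "1/2" "\<i> * of_real u"] u by (simp add: s_def norm_mult)
    moreover have "norm (1 - s) \<ge> 1/2" using norm_half_sub_ge[of u] by (simp add: s_def)
    ultimately have "sqrt X / norm (1 - s) \<ge> sqrt X / (3/2)" using X by (intro divide_left_mono) auto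
    thus ?thesis unfolding 1 by simp
  qed
  \<comment> \<open>729 = 27^2 makes the error 9 sqrt Y at most sqrt X / 3, half of the lower bound
    2/3 sqrt X for |\<kappa>|; the other half survives.\<close>
  have "27 * sqrt Y = sqrt (729 * Y)" by (simp add: real_sqrt_mult)
  also have "... \<le> sqrt X" using Y by simp
  finally have "9 * sqrt Y \<le> 1/3 * sqrt X" by simp
  hence "1/3 * sqrt X \<le> norm \<kappa> - 9 * sqrt Y" using \<kappa> by linarith
  hence "(1/3 * sqrt X) * S \<le> (norm \<kappa> - 9 * sqrt Y) * S" using S0 by (intro mult_right_mono)
  hence "(1/3 * sqrt X) * S \<le> norm IP" using ge by (simp add: left_diff_distrib)
  also have "norm IP \<le> (\<Sum>M\<in>T. norm (c M) * e M)"
    unfolding IP_def using e0 by (intro sum_norm_le) (simp add: norm_mult)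
  finally have "((1/3 * sqrt X) * S)^2 \<le> (\<Sum>M\<in>T. norm (c M) * e M)^2" using S0 X by (intro power_mono) auto
  also have "... \<le> (\<Sum>M\<in>T. (norm (c M))^2) * (\<Sum>M\<in>T. (e M)^2)" by (rule Cauchy_Schwarz_ineq_sum)
  also have "... \<le> (\<Sum>M\<in>T. (norm (c M))^2) * (S * L)" using enorm by (intro mult_left_mono sum_nonneg) auto
  finally have fin: "X / 9 * S^2 \<le> (\<Sum>M\<in>T. (norm (c M))^2) * (S * L)" using X by (simp add: power_mult_distrib power_divide)
  show ?thesis
  proof (cases "S = 0")
    case True
    thus ?thesis unfolding S_def by (auto intro: sum_nonneg)
  next
    case False
    hence "S > 0" using S0 by simp
    have "X / 9 * S * S \<le> ((\<Sum>M\<in>T. (norm (c M))^2) * L) * S" using fin by (simp add: power2_eq_square mult_ac)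
    hence "X / 9 * S \<le> (\<Sum>M\<in>T. (norm (c M))^2) * L" using \<open>S > 0\<close> by (rule mult_right_le_imp_le)
    hence "S * X / (9 * L) \<le> (\<Sum>M\<in>T. (norm (c M))^2)" using L by (simp add: field_simps)
    thus ?thesis by (simp add: S_def L_def T_def)
  qed
qed


section \<open>The gcd sum of one block, from its squarefree part\<close>

lemma sum_Pow_insert:
  assumes "finite I" "p \<notin> I"
  shows "(\<Sum>N\<in>Pow (insert p I). f N) = (\<Sum>N\<in>Pow I. f N + f (insert p N))"
proof -
  have "(\<Sum>N\<in>Pow (insert p I). f N) = (\<Sum>N\<in>Pow I. f N) + (\<Sum>N\<in>insert p ` Pow I. f N)"
    unfolding Pow_insert using assms by (intro sum.union_disjoint) auto
  also have "(\<Sum>N\<in>insert p ` Pow I. f N) = (\<Sum>N\<in>Pow I. f (insert p N))"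
    using assms by (subst sum.reindex) (auto intro!: inj_onI simp: insert_ident o_def)
  finally show ?thesis by (simp add: sum.distrib)
qed

text \<open>Each p lies in neither set, in exactly one (two ways), or in both, with factors 1,
  \<beta> w and \<beta>^2 w, as w counts once on the union. For w = 1/p these are the Euler factors
  of a sum weighted by 1/lcm.\<close>

lemma sum_pairs_subsets:
  fixes \<beta> :: real and w :: "'a \<Rightarrow> real"
  assumes "finite I"
  shows "(\<Sum>N\<in>Pow I. \<Sum>N'\<in>Pow I. \<beta> ^ (card N + card N') * (\<Prod>p\<in>N \<union> N'. w p)) = (\<Prod>p\<in>I. 1 + (\<beta>^2 + 2 * \<beta>) * w p)"
  using assms
proof (induction I)
  case (insert p I)
  let ?f = "\<lambda>N N'. \<beta> ^ (card N + card N') * (\<Prod>p\<in>N \<union> N'. w p)"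
  have "(\<Sum>N\<in>Pow (insert p I). \<Sum>N'\<in>Pow (insert p I). ?f N N')
     = (\<Sum>N\<in>Pow I. \<Sum>N'\<in>Pow I. ?f N N' + ?f N (insert p N') + (?f (insert p N) N' + ?f (insert p N) (insert p N')))"
    using insert.hyps by (simp add: sum_Pow_insert sum.distrib)
  also have "... = (\<Sum>N\<in>Pow I. \<Sum>N'\<in>Pow I. (1 + (\<beta>^2 + 2 * \<beta>) * w p) * ?f N N')"
  proof (intro sum.cong refl)
    fix N N' assume "N \<in> Pow I" "N' \<in> Pow I"
    hence *: "finite N" "finite N'" "p \<notin> N" "p \<notin> N'" using insert.hyps by (auto dest: finite_subset)
    show "?f N N' + ?f N (insert p N') + (?f (insert p N) N' + ?f (insert p N) (insert p N')) = (1 + (\<beta>^2 + 2 * \<beta>) * w p) * ?f N N'"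
      using * by (simp add: algebra_simps power2_eq_square)
  qed
  also have "... = (1 + (\<beta>^2 + 2 * \<beta>) * w p) * (\<Prod>p\<in>I. 1 + (\<beta>^2 + 2 * \<beta>) * w p)"
    unfolding insert.IH[symmetric] by (simp add: sum_distrib_left)
  finally show ?case using insert.hyps by simp
qed auto

text \<open>The coefficients of \<open>(1 + P/b)^n\<close>, where \<open>P\<close> is the sum of \<open>p^(-1/2-it)\<close> over \<open>p \<in> I\<close>.\<close>
fun rcoef :: "nat set \<Rightarrow> nat \<Rightarrow> nat \<Rightarrow> nat \<Rightarrow> real" where
  "rcoef I b 0 N = (if N = 1 then 1 else 0)"
| "rcoef I b (Suc n) N = rcoef I b n N + (\<Sum>p\<in>I. if p dvd N then rcoef I b n (N div p) / (real b * sqrt (real p)) else 0)"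

lemma rcoef_nonneg: "rcoef I b n N \<ge> 0"
  by (induction n arbitrary: N) (auto intro!: add_nonneg_nonneg sum_nonneg)

context
  fixes I :: "nat set" and y :: real
  assumes I: "finite I" "\<And>p. p \<in> I \<Longrightarrow> prime p" "\<And>p. p \<in> I \<Longrightarrow> real p \<le> y" and y: "y \<ge> 1"
begin

lemma rcoef_support: "rcoef I b n N \<noteq> 0 \<Longrightarrow> N \<in> upto_real (y ^ n)"
proof (induction n arbitrary: N)
  case 0
  thus ?case by (auto simp: upto_real_def split: if_splits)
next
  case (Suc n)
  show ?case
  proof (cases "rcoef I b n N = 0")
    case False
    hence "N \<in> upto_real (y ^ n)" by (rule Suc.IH)
    moreover have "y ^ n \<le> y ^ Suc n" using y by (intro power_increasing) auto
    ultimately show ?thesis by (auto simp: upto_real_def simp del: power_Suc)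
  next
    case True
    hence "(\<Sum>p\<in>I. if p dvd N then rcoef I b n (N div p) / (real b * sqrt (real p)) else 0) \<noteq> 0" using Suc.prems by simp
    then obtain p where "p \<in> I" "(if p dvd N then rcoef I b n (N div p) / (real b * sqrt (real p)) else 0) \<noteq> 0"
      by (rule sum.not_neutral_contains_not_neutral)
    hence p: "p \<in> I" "p dvd N" "rcoef I b n (N div p) \<noteq> 0" by (auto split: if_splits)
    hence "N div p \<in> upto_real (y ^ n)" using Suc.IH by blast
    moreover have "p \<in> upto_real y" using I p by (auto simp: upto_real_def prime_gt_0_nat)
    ultimately show ?thesis using upto_real_mult[of p y "N div p" "y ^ n"] p(2) by simp
  qed
qed

lemma rcoef_eval:
  "(\<Sum>N\<in>upto_real (y ^ n). of_real (rcoef I b n N) * chi t N) = (1 + psum I t / of_nat b) ^ n"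
proof (induction n)
  case 0
  have "upto_real 1 = {1}" by (auto simp: upto_real_eq)
  thus ?case by simp
next
  case (Suc n)
  have ext: "(\<Sum>N\<in>upto_real Z. of_real (rcoef I b n N) * f N) = (\<Sum>N\<in>upto_real (y ^ n). of_real (rcoef I b n N) * f N)" if "y ^ n \<le> Z" for Z and f :: "nat \<Rightarrow> complex"
  proof (rule sum.mono_neutral_right)
    show "upto_real (y ^ n) \<subseteq> upto_real Z" using that by (auto simp: upto_real_def)
    show "\<forall>N\<in>upto_real Z - upto_real (y ^ n). of_real (rcoef I b n N) * f N = 0" using rcoef_support[of b n] by auto
  qed simp
  have y1: "y ^ n \<le> y ^ Suc n" using y by (intro power_increasing) auto
  have "(\<Sum>N\<in>upto_real (y ^ Suc n). of_real (rcoef I b (Suc n) N) * chi t N) = 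
     (\<Sum>N\<in>upto_real (y ^ Suc n). of_real (rcoef I b n N) * chi t N) + 
     (\<Sum>N\<in>upto_real (y ^ Suc n). \<Sum>p\<in>I. if p dvd N then of_real (rcoef I b n (N div p) / (real b * sqrt (real p))) * chi t N else 0)"
    unfolding sum.distrib[symmetric]
    by (intro sum.cong refl) (simp add: distrib_right sum_distrib_right if_distrib if_distribR cong: if_cong)
  also have "(\<Sum>N\<in>upto_real (y ^ Suc n). \<Sum>p\<in>I. if p dvd N then of_real (rcoef I b n (N div p) / (real b * sqrt (real p))) * chi t N else 0)
     = (\<Sum>p\<in>I. \<Sum>N\<in>upto_real (y ^ Suc n). if p dvd N then of_real (rcoef I b n (N div p) / (real b * sqrt (real p))) * chi t N else 0)"
    by (rule sum.swap)
  also have "... = (\<Sum>p\<in>I. of_real (1 / sqrt (real p)) * chi t p / of_nat b * (\<Sum>N\<in>upto_real (y ^ n). of_real (rcoef I b n N) * chi t N))"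
  proof (intro sum.cong refl)
    fix p assume p: "p \<in> I"
    hence p0: "p > 0" using I by (auto simp: prime_gt_0_nat)
    have "y ^ n * real p \<le> y ^ n * y" using p I y by (intro mult_left_mono) auto
    hence yn: "y ^ n \<le> y ^ Suc n / real p" using p0 by (simp add: field_simps)
    have "(\<Sum>N\<in>upto_real (y ^ Suc n). if p dvd N then of_real (rcoef I b n (N div p) / (real b * sqrt (real p))) * chi t N else 0)
      = (\<Sum>N\<in>{N \<in> upto_real (y ^ Suc n). p dvd N}. of_real (rcoef I b n (N div p) / (real b * sqrt (real p))) * chi t N)"
      by (simp add: sum.If_cases Int_def del: power_Suc)
    also have "... = (\<Sum>m\<in>upto_real (y ^ Suc n / real p). of_real (rcoef I b n m) * (of_real (1 / (real b * sqrt (real p))) * chi t p * chi t m))"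
      unfolding sum_multiples[OF p0] using p0
      by (intro sum.cong refl) (simp add: chi_mult upto_real_pos)
    also have "... = (\<Sum>m\<in>upto_real (y ^ n). of_real (rcoef I b n m) * (of_real (1 / (real b * sqrt (real p))) * chi t p * chi t m))"
      by (rule ext[OF yn])
    also have "... = of_real (1 / sqrt (real p)) * chi t p / of_nat b * (\<Sum>N\<in>upto_real (y ^ n). of_real (rcoef I b n N) * chi t N)"
      by (simp add: sum_distrib_left mult_ac)
    finally show "(\<Sum>N\<in>upto_real (y ^ Suc n). if p dvd N then of_real (rcoef I b n (N div p) / (real b * sqrt (real p))) * chi t N else 0) = ..." .
  qed
  also have "... = psum I t / of_nat b * (1 + psum I t / of_nat b) ^ n"
    unfolding Suc.IH by (simp add: psum_def sum_distrib_right sum_divide_distrib)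
  also have "(\<Sum>N\<in>upto_real (y ^ Suc n). of_real (rcoef I b n N) * chi t N) = (1 + psum I t / of_nat b) ^ n"
    unfolding ext[OF y1] by (rule Suc.IH)
  finally show ?case by (simp add: distrib_right)
qed

lemma prime_dvd_prod_iff:
  assumes "N \<subseteq> I" "p \<in> I"
  shows "p dvd \<Prod>N \<longleftrightarrow> p \<in> N"
proof
  assume "p dvd \<Prod>N"
  moreover have "finite N" using assms I(1) by (auto dest: finite_subset)
  ultimately obtain q where "q \<in> N" "p dvd q" using prime_dvd_prod_iff[of N p id] I(2)[OF assms(2)] by auto
  thus "p \<in> N" using primes_dvd_imp_eq[of p q] I(2) assms by blast
qed (use assms I(1) in \<open>auto intro!: dvd_prodI simp: finite_subset\<close>)

lemma prod_pos_primes: "N \<subseteq> I \<Longrightarrow> \<Prod>N > 0"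
  using I by (intro prod_pos) (auto simp: prime_gt_0_nat)

text \<open>A product of i distinct primes arises by choosing i of the n factors and an order of the
  primes, in (n choose i) i! ways. For the other coefficients nonnegativity is enough, since a lower
  bound may drop them.\<close>

lemma rcoef_squarefree:
  assumes "b > 0" "N \<subseteq> I"
  shows "rcoef I b n (\<Prod>N) = bcoef n b (card N) / sqrt (real (\<Prod>N))"
  using assms(2)
proof (induction n arbitrary: N)
  case 0
  have fin: "finite N" using 0 I(1) by (auto dest: finite_subset)
  show ?case
  proof (cases "N = {}")
    case False
    then obtain p where p: "p \<in> N" by auto
    hence "p dvd \<Prod>N" using fin by (intro dvd_prodI) 
    hence "\<Prod>N \<noteq> 1" using I(2)[of p] p 0 by auto
    moreover have "card N > 0" using False fin by (simp add: card_gt_0_iff)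
    ultimately show ?thesis by (simp add: bcoef_eq_0)
  qed simp
next
  case (Suc n)
  have fin: "finite N" using Suc.prems I(1) by (auto dest: finite_subset)
  define P where "P = \<Prod>N"
  have P: "P > 0" unfolding P_def using Suc.prems by (rule prod_pos_primes)
  have "(\<Sum>p\<in>I. if p dvd P then rcoef I b n (P div p) / (real b * sqrt (real p)) else 0)
     = (\<Sum>p\<in>I. if p \<in> N then rcoef I b n (P div p) / (real b * sqrt (real p)) else 0)"
    unfolding P_def by (intro sum.cong refl) (simp add: prime_dvd_prod_iff[OF Suc.prems])
  also have "... = (\<Sum>p\<in>N. rcoef I b n (P div p) / (real b * sqrt (real p)))"
    using Suc.prems I(1) by (simp add: sum.If_cases Int_absorb1)
  also have "... = (\<Sum>p\<in>N. bcoef n b (card N - 1) / real b / sqrt (real P))"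
  proof (intro sum.cong refl)
    fix p assume p: "p \<in> N"
    have p0: "p > 0" using p Suc.prems I(2) by (auto simp: prime_gt_0_nat)
    have Pp: "P = p * \<Prod>(N - {p})" unfolding P_def using fin p by (simp add: prod.remove)
    have "rcoef I b n (P div p) = bcoef n b (card (N - {p})) / sqrt (real (\<Prod>(N - {p})))"
    proof -
      have "N - {p} \<subseteq> I" using Suc.prems by auto
      from Suc.IH[OF this] show ?thesis using p0 by (simp add: Pp del: of_nat_prod)
    qed
    also have "card (N - {p}) = card N - 1" using fin p by simp
    also have "bcoef n b (card N - 1) / sqrt (real (\<Prod>(N - {p}))) / (real b * sqrt (real p)) = bcoef n b (card N - 1) / real b / sqrt (real P)"
      by (simp add: Pp real_sqrt_mult mult_ac)
    finally show "rcoef I b n (P div p) / (real b * sqrt (real p)) = bcoef n b (card N - 1) / real b / sqrt (real P)" by simp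
  qed
  also have "... = (real (card N) * bcoef n b (card N - 1) / real b) / sqrt (real P)" by simp
  finally have "rcoef I b (Suc n) P = (bcoef n b (card N) + real (card N) * bcoef n b (card N - 1) / real b) / sqrt (real P)"
    using Suc.IH[OF Suc.prems, folded P_def] by (simp add: add_divide_distrib)
  also have "bcoef n b (card N) + real (card N) * bcoef n b (card N - 1) / real b = bcoef (Suc n) b (card N)"
    using assms(1) by (cases "card N") (simp_all add: bcoef_def field_simps)
  finally show ?case by (simp add: P_def)
qed

text \<open>On squarefree integers the gcd sum becomes the Euler product \<open>E\<close>, up to the
  defect of \<open>bcoef\<close> against powers of \<alpha>. The pair (1, 1) alone contributes 1,
  which rescues the blocks whose \<open>b\<close> is too small for the first bound.\<close>

theorem gpoly_block_power:
  assumes V: "(\<Sum>p\<in>I. 1 / real p) \<le> V" and \<alpha>: "\<alpha> \<ge> 1" and b: "b > 0"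
    and n: "\<alpha> * real b - 1 \<le> real n"
  defines "E \<equiv> (\<Prod>p\<in>I. 1 + (\<alpha>^2 + 2 * \<alpha>) * (1 / real p))"
  defines "K \<equiv> 2 * exp (((2 * \<alpha>)^2 + 2 * (2 * \<alpha>)) * V)"
  shows "gpoly (y ^ n) (max 1 (E - 2 * K / real b)) (\<lambda>t. (1 + psum I t / of_nat b) ^ n)"
proof -
  define r where "r = rcoef I b n"
  have r0: "r N \<ge> 0" for N by (simp add: r_def rcoef_nonneg)
  have yn: "y ^ n \<ge> 1" using y by simp
  define w where "w p = 1 / real p" for p :: nat
  let ?W = "\<lambda>N N'. \<Prod>p\<in>N \<union> N'. w p"
  have inj: "inj_on Prod (Pow I)"
  proof (rule inj_onI)
    fix N N' assume "N \<in> Pow I" "N' \<in> Pow I" "\<Prod>N = \<Prod>N'"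
    thus "N = N'" using prime_dvd_prod_iff[of N] prime_dvd_prod_iff[of N'] by (metis Pow_iff subsetD subset_antisym subsetI)
  qed
  let ?U = "upto_real (y ^ n)"
  define Q where "Q = {N \<in> Pow I. \<Prod>N \<in> ?U}"
  have Q: "finite Q" "Q \<subseteq> Pow I" "Prod ` Q \<subseteq> ?U" using I(1) by (auto simp: Q_def)
  have injQ: "inj_on Prod Q" using inj Q(2) by (rule inj_on_subset)
  have "(\<Sum>N\<in>Pow I. \<Sum>N'\<in>Pow I. bcoef n b (card N) * bcoef n b (card N') * ?W N N')
     = (\<Sum>N\<in>Q. \<Sum>N'\<in>Q. bcoef n b (card N) * bcoef n b (card N') * ?W N N')"
  proof -
    \<comment> \<open>A product outside the length has \<open>rcoef\<close> equal to 0, and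
      \<open>rcoef_squarefree\<close> turns this into a vanishing \<open>bcoef\<close>; passing from
      all subsets to \<open>Q\<close> loses nothing.\<close>
    have z: "bcoef n b (card N) = 0" if "N \<in> Pow I - Q" for N
    proof -
      have "r (\<Prod>N) = 0" using that rcoef_support[of b n "\<Prod>N"] by (auto simp: Q_def r_def)
      thus ?thesis using rcoef_squarefree[OF b, of N n] that prod_pos_primes[of N] by (auto simp: r_def simp del: of_nat_prod)
    qed
    show ?thesis by (intro sum.mono_neutral_cong_right) (use I(1) Q z in auto)
  qed
  also have "... \<le> (\<Sum>N\<in>Q. \<Sum>N'\<in>Q. r (\<Prod>N) * r (\<Prod>N') * gcdk (\<Prod>N) (\<Prod>N'))"
  proof (intro sum_mono)
    fix N N' assume N: "N \<in> Q" "N' \<in> Q"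
    hence sub: "N \<subseteq> I" "N' \<subseteq> I" "finite N" "finite N'" using Q I(1) by (auto intro: finite_subset)
    have pos: "\<Prod>N > 0" "\<Prod>N' > 0" "\<Prod>(N \<union> N') > 0" "\<Prod>(N \<inter> N') > 0" by (rule prod_pos_primes; use sub in auto)+
    have "\<Prod>(N \<inter> N') dvd gcd (\<Prod>N) (\<Prod>N')" using sub by (intro gcd_greatest prod_dvd_prod_subset) auto
    hence "\<Prod>(N \<inter> N') \<le> gcd (\<Prod>N) (\<Prod>N')" using pos by (intro dvd_imp_le) auto
    hence g: "real (\<Prod>(N \<inter> N')) \<le> real (gcd (\<Prod>N) (\<Prod>N'))" by (simp only: of_nat_le_iff)
    have "\<Prod>(N \<union> N') * \<Prod>(N \<inter> N') = \<Prod>N * \<Prod>N'" using prod.union_inter[OF sub(3,4), of "\<lambda>x. x"] by simp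
    hence ui: "real (\<Prod>(N \<union> N')) * real (\<Prod>(N \<inter> N')) = real (\<Prod>N) * real (\<Prod>N')" by (metis of_nat_mult)
    have "?W N N' = 1 / real (\<Prod>(N \<union> N'))" by (simp add: w_def prod_dividef)
    also have "... = real (\<Prod>(N \<inter> N')) / (real (\<Prod>N) * real (\<Prod>N'))" unfolding ui[symmetric] using pos by (simp del: of_nat_prod)
    also have "... \<le> real (gcd (\<Prod>N) (\<Prod>N')) / (real (\<Prod>N) * real (\<Prod>N'))" using g by (intro divide_right_mono mult_nonneg_nonneg of_nat_0_le_iff)
    also have "... = gcdk (\<Prod>N) (\<Prod>N') / (sqrt (real (\<Prod>N)) * sqrt (real (\<Prod>N')))"
    proof -
      have gen: "g / (x * y) = g / sqrt (x * y) / (sqrt x * sqrt y)" if "x \<ge> 0" "y \<ge> 0" for g x y :: real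
      proof -
        have "sqrt (x * y) * (sqrt x * sqrt y) = x * y" using that by (simp add: real_sqrt_mult[symmetric])
        thus ?thesis by (simp only: divide_divide_eq_left)
      qed
      show ?thesis unfolding gcdk_def by (rule gen) (rule of_nat_0_le_iff)+
    qed
    finally have "bcoef n b (card N) * bcoef n b (card N') * ?W N N' \<le> bcoef n b (card N) * bcoef n b (card N') * (gcdk (\<Prod>N) (\<Prod>N') / (sqrt (real (\<Prod>N)) * sqrt (real (\<Prod>N'))))"
      using bcoef_nonneg by (intro mult_left_mono) auto
    thus "bcoef n b (card N) * bcoef n b (card N') * ?W N N' \<le> r (\<Prod>N) * r (\<Prod>N') * gcdk (\<Prod>N) (\<Prod>N')"
      unfolding r_def rcoef_squarefree[OF b sub(1)] rcoef_squarefree[OF b sub(2)] by (simp only: times_divide_eq_left times_divide_eq_right divide_divide_eq_left mult_ac)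
  qed
  also have "... = (\<Sum>x\<in>Prod ` Q. \<Sum>x'\<in>Prod ` Q. r x * r x' * gcdk x x')" by (simp add: sum.reindex[OF injQ])
  also have "... \<le> gcdsum (y ^ n) r"
    unfolding gcdsum_def using Q r0 gcdk_nonneg
    by (intro order_trans[OF sum_mono[OF sum_mono2] sum_mono2]) (auto intro!: sum_nonneg)
  finally have main: "(\<Sum>N\<in>Pow I. \<Sum>N'\<in>Pow I. bcoef n b (card N) * bcoef n b (card N') * ?W N N') \<le> gcdsum (y ^ n) r" .
  have w0: "(\<Prod>p\<in>A. w p) \<ge> 0" for A by (intro prod_nonneg) (auto simp: w_def)
  \<comment> \<open>The defect (i^2 + j^2)/b is at most 4 * 2^(i+j) / b, so the error is the main
    sum with 2\<alpha> for \<alpha>, and both sums are products by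
    \<open>sum_pairs_subsets\<close>.\<close>
  have "E - 2 * K / real b \<le> (\<Sum>N\<in>Pow I. \<Sum>N'\<in>Pow I. \<alpha> ^ (card N + card N') * ?W N N' - 4 / real b * ((2 * \<alpha>) ^ (card N + card N') * ?W N N'))"
  proof -
    have "(\<Prod>p\<in>I. 1 + ((2 * \<alpha>)^2 + 2 * (2 * \<alpha>)) * w p) \<le> (\<Prod>p\<in>I. exp (((2 * \<alpha>)^2 + 2 * (2 * \<alpha>)) * w p))"
      using \<alpha> by (intro prod_mono conjI exp_ge_add_one_self) (auto simp: w_def)
    also have "... = exp (((2 * \<alpha>)^2 + 2 * (2 * \<alpha>)) * (\<Sum>p\<in>I. 1 / real p))"
      using I(1) by (simp add: exp_sum w_def sum_distrib_left)
    also have "... \<le> exp (((2 * \<alpha>)^2 + 2 * (2 * \<alpha>)) * V)"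
      unfolding exp_le_cancel_iff using \<alpha> by (intro mult_left_mono V) auto
    finally have "4 / real b * (\<Prod>p\<in>I. 1 + ((2 * \<alpha>)^2 + 2 * (2 * \<alpha>)) * w p) \<le> 4 / real b * exp (((2 * \<alpha>)^2 + 2 * (2 * \<alpha>)) * V)"
      by (intro mult_left_mono) auto
    also have "... = 2 * K / real b" by (simp add: K_def)
    finally have 1: "4 / real b * (\<Prod>p\<in>I. 1 + ((2 * \<alpha>)^2 + 2 * (2 * \<alpha>)) * w p) \<le> 2 * K / real b" .
    have E': "E = (\<Prod>p\<in>I. 1 + (\<alpha>^2 + 2 * \<alpha>) * w p)" by (simp add: E_def w_def)
    show ?thesis
      unfolding sum_subtractf sum_distrib_left[symmetric] sum_pairs_subsets[OF I(1)] E' using 1 by linarith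
  qed
  also have "... \<le> (\<Sum>N\<in>Pow I. \<Sum>N'\<in>Pow I. bcoef n b (card N) * bcoef n b (card N') * ?W N N')"
  proof (intro sum_mono)
    fix N N' :: "nat set"
    define i j where "i = card N" and "j = card N'"
    have sq: "(real i)^2 / real b \<le> 2 * 2 ^ (i + j) / real b" "(real j)^2 / real b \<le> 2 * 2 ^ (i + j) / real b"
    proof -
      have "2 * 2 ^ i \<le> (2 * 2 ^ (i + j) :: real)" "2 * 2 ^ j \<le> (2 * 2 ^ (i + j) :: real)" by (intro mult_left_mono power_increasing; simp)+
      hence "(real i)^2 \<le> 2 * 2 ^ (i + j)" "(real j)^2 \<le> 2 * 2 ^ (i + j)"
        by (auto intro!: order_trans[OF square_le_two_power] simp del: power_add)
      thus "(real i)^2 / real b \<le> 2 * 2 ^ (i + j) / real b" "(real j)^2 / real b \<le> 2 * 2 ^ (i + j) / real b"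
        by (auto intro!: divide_right_mono)
    qed
    define \<epsilon> where "\<epsilon> = 2 * 2 ^ (i + j) / real b"
    have "\<alpha> ^ i * \<alpha> ^ j * (1 - 2 * \<epsilon>) \<le> \<alpha> ^ i * \<alpha> ^ j * (1 - ((real i)^2 / real b + (real j)^2 / real b))"
      using sq \<alpha> unfolding \<epsilon>_def[symmetric] by (intro mult_left_mono) auto
    also have "... \<le> bcoef n b i * bcoef n b j" using b n \<alpha> by (intro bcoef_mult_ge)
    finally have gen: "\<alpha> ^ i * \<alpha> ^ j * (1 - 2 * \<epsilon>) \<le> bcoef n b i * bcoef n b j" .
    have "\<alpha> ^ (i + j) - 4 / real b * (2 * \<alpha>) ^ (i + j) = \<alpha> ^ i * \<alpha> ^ j * (1 - 2 * \<epsilon>)"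
      by (simp add: \<epsilon>_def power_add power_mult_distrib right_diff_distrib mult_ac)
    hence "\<alpha> ^ (i + j) - 4 / real b * (2 * \<alpha>) ^ (i + j) \<le> bcoef n b i * bcoef n b j" using gen by simp
    from mult_right_mono[OF this w0[of "N \<union> N'"]]
    show "\<alpha> ^ (card N + card N') * ?W N N' - 4 / real b * ((2 * \<alpha>) ^ (card N + card N') * ?W N N')
      \<le> bcoef n b (card N) * bcoef n b (card N') * ?W N N'"
      by (simp add: i_def j_def algebra_simps)
  qed
  also note main
  finally have lower: "E - 2 * K / real b \<le> gcdsum (y ^ n) r" .
  have "1 \<le> gcdsum (y ^ n) r"
  proof -
    have "r 1 = 1" using rcoef_squarefree[OF b, of "{}" n] by (simp add: r_def)
    have one_in: "1 \<in> upto_real (y ^ n)" using yn by (simp add: upto_real_def)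
    from \<open>r 1 = 1\<close> have "1 = (\<Sum>m\<in>{1}. \<Sum>m'\<in>{1}. r m * r m' * gcdk m m')" by (simp add: gcdk_def)
    also have "... \<le> gcdsum (y ^ n) r"
      unfolding gcdsum_def using one_in r0 gcdk_nonneg
      by (intro order_trans[OF sum_mono[OF sum_mono2] sum_mono2]) (auto intro!: sum_nonneg)
    finally show ?thesis .
  qed
  with lower show ?thesis unfolding gpoly_def
    by (intro exI[of _ r]) (auto simp: r_def rcoef_nonneg rcoef_eval[symmetric])
qed

end

section \<open>The resonator\<close>

text \<open>
  \<open>bden J j\<close> and \<open>bpow \<alpha> J j\<close> are \<open>b\<^sub>j\<close> and \<open>n\<^sub>j\<close> of the introduction, \<open>bfac J j\<close> is \<open>1 + P\<^sub>j/b\<^sub>j\<close>, and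
  \<open>reson \<alpha> J\<close> is \<open>R\<close>.
\<close>

definition blk :: "nat \<Rightarrow> nat set" where
  "blk j = {p. prime p \<and> 2 ^ j / 2 < ln (real p) \<and> ln (real p) \<le> 2 ^ j}"

definition bden :: "nat \<Rightarrow> nat \<Rightarrow> nat" where
  "bden J j = (J - j + 1)^2"

definition bpow :: "real \<Rightarrow> nat \<Rightarrow> nat \<Rightarrow> nat" where
  "bpow \<alpha> J j = nat \<lfloor>\<alpha> * real (bden J j)\<rfloor>"

definition bfac :: "nat \<Rightarrow> nat \<Rightarrow> real \<Rightarrow> complex" where
  "bfac J j t = 1 + psum (blk j) t / of_nat (bden J j)"

definition reson :: "real \<Rightarrow> nat \<Rightarrow> real \<Rightarrow> complex" where
  "reson \<alpha> J t = (\<Prod>j\<le>J. bfac J j t ^ bpow \<alpha> J j)"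

section \<open>The blocks of primes and the choice of their denominators\<close>

lemma blk_prime: "p \<in> blk j \<Longrightarrow> prime p" by (simp add: blk_def)

lemma blk_le: "p \<in> blk j \<Longrightarrow> real p \<le> exp (2 ^ j)"
  unfolding blk_def by (metis (mono_tags, lifting) exp_le_cancel_iff exp_ln mem_Collect_eq of_nat_0_less_iff prime_gt_0_nat)

lemma finite_blk: "finite (blk j)"
proof (rule finite_subset)
  show "blk j \<subseteq> primes_upto (exp (2 ^ j))" by (auto simp: primes_upto_def blk_prime blk_le)
qed simp

lemma blk_disjoint: "i \<noteq> j \<Longrightarrow> blk i \<inter> blk j = {}"
proof -
  have *: "blk i \<inter> blk j = {}" if "i < j" for i j
  proof -
    have "(2::real) ^ Suc i \<le> 2 ^ j" using that by (intro power_increasing) auto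
    thus ?thesis by (auto simp: blk_def)
  qed
  show "i \<noteq> j \<Longrightarrow> blk i \<inter> blk j = {}" using *[of i j] *[of j i] by (cases "i < j") auto
qed

lemma Union_blk: "(\<Union>j\<le>J. blk j) = primes_upto (exp (2 ^ J))"
proof (intro equalityI subsetI)
  fix p assume "p \<in> (\<Union>j\<le>J. blk j)"
  then obtain j where j: "j \<le> J" "p \<in> blk j" by auto
  have "(2::real) ^ j \<le> 2 ^ J" using j by (intro power_increasing) auto
  hence "exp ((2::real) ^ j) \<le> exp (2 ^ J)" by simp
  hence "real p \<le> exp (2 ^ J)" by (rule order_trans[OF blk_le[OF j(2)]])
  thus "p \<in> primes_upto (exp (2 ^ J))" using blk_prime[OF j(2)] by (simp add: primes_upto_def)
next
  fix p assume p: "p \<in> primes_upto (exp (2 ^ J))"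
  hence p2: "prime p" "real p \<le> exp (2 ^ J)" "p \<ge> 2" by (auto simp: primes_upto_def prime_ge_2_nat)
  have J: "ln (real p) \<le> 2 ^ J" using p2 ln_mono[of "real p" "exp (2 ^ J)"] by simp
  define j where "j = (LEAST j. ln (real p) \<le> 2 ^ j)"
  have j: "ln (real p) \<le> 2 ^ j" unfolding j_def using J by (rule LeastI)
  have jJ: "j \<le> J" unfolding j_def using J by (rule Least_le)
  have "2 ^ j / 2 < ln (real p)"
  proof (cases j)
    case 0
    \<comment> \<open>The lowest block begins at 1/2 < ln 2, so the prime 2 is not lost.\<close>
    have "ln 2 \<le> ln (real p)" using p2 by simp
    thus ?thesis using 0 ln2_ge_two_thirds by simp
  next
    case (Suc i)
    hence "\<not> ln (real p) \<le> 2 ^ i" using not_less_Least[of i "\<lambda>j. ln (real p) \<le> 2 ^ j"] by (simp add: j_def)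
    thus ?thesis using Suc by simp
  qed
  thus "p \<in> (\<Union>j\<le>J. blk j)" using j jJ p2 by (auto simp: blk_def)
qed

lemma sum_blk: "(\<Sum>j\<le>J. \<Sum>p\<in>blk j. f p) = (\<Sum>p\<in>primes_upto (exp (2 ^ J)). f p)" for f :: "nat \<Rightarrow> real"
  unfolding Union_blk[symmetric] by (rule sum.UNION_disjoint[symmetric]) (use finite_blk blk_disjoint in auto)

lemma blk_sum_le: "(\<Sum>p\<in>blk j. 1 / real p) \<le> 909"
  unfolding blk_def by (rule prime_inverse_sum_range) simp

lemma bden_pos: "bden J j > 0" by (simp add: bden_def)

text \<open>The sum is 2^(J+1) times the partial sum of i^2 / 2^i up to i = J + 1; the full series
  has the value 6, whence 12, and the quadratic correction makes the induction exact.\<close>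

lemma sum_bden_aux: "(\<Sum>j\<le>J. 2 ^ j * bden J j) + (J^2 + 6 * J + 11) = 12 * 2 ^ J"
proof (induction J)
  case (Suc J)
  have "(\<Sum>j\<le>Suc J. 2 ^ j * bden (Suc J) j) = (J + 2)^2 + 2 * (\<Sum>j\<le>J. 2 ^ j * bden J j)"
    by (subst sum.atMost_Suc_shift) (simp add: bden_def sum_distrib_left mult_ac)
  thus ?case using Suc by (simp add: power2_eq_square algebra_simps)
qed (simp add: bden_def)

lemma sum_bden: "(\<Sum>j\<le>J. 2 ^ j * real (bden J j)) \<le> 12 * 2 ^ J"
proof -
  have "(\<Sum>j\<le>J. 2 ^ j * bden J j) \<le> 12 * 2 ^ J" using sum_bden_aux[of J] by simp
  hence "real (\<Sum>j\<le>J. 2 ^ j * bden J j) \<le> real (12 * 2 ^ J)" by (simp only: of_nat_le_iff)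
  thus ?thesis by simp
qed

lemma sum_inverse_bden: "(\<Sum>j\<le>J. 1 / real (bden J j)) \<le> 3"
proof -
  have "(\<Sum>j\<le>J. 1 / real (bden J j)) = (\<Sum>i\<in>{1..Suc J}. 1 / (real i)^2)"
    by (rule sum.reindex_bij_witness[where i = "\<lambda>i. J + 1 - i" and j = "\<lambda>j. J + 1 - j"]) (auto simp: bden_def Suc_diff_le)
  also have "... \<le> 3" by (rule sum_inverse_squares_primes) auto
  finally show ?thesis .
qed

section \<open>Norm and gcd sum of the whole resonator\<close>

context
  fixes \<alpha> :: real
  assumes \<alpha>: "\<alpha> > 1"
begin

lemma bpow_bounds: "\<alpha> * real (bden J j) - 1 \<le> real (bpow \<alpha> J j)" "real (bpow \<alpha> J j) \<le> \<alpha> * real (bden J j)"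
proof -
  have "\<alpha> * real (bden J j) \<ge> 0" using \<alpha> by simp
  thus "\<alpha> * real (bden J j) - 1 \<le> real (bpow \<alpha> J j)" "real (bpow \<alpha> J j) \<le> \<alpha> * real (bden J j)" unfolding bpow_def by linarith+
qed

lemma bpow_pos: "bpow \<alpha> J j > 0"
proof -
  have "\<alpha> * 1 \<le> \<alpha> * real (bden J j)" using \<alpha> bden_pos[of J j] by (intro mult_left_mono) auto
  thus ?thesis using bpow_bounds(1)[of J j] \<alpha> by linarith
qed

text \<open>The exponent leaves room for b_j further factors beside the n_j of R, so one length
  serves R itself and its products with powers of shifted factors. For \<alpha> = k - 1 it is exp
  (12 k 2^J).\<close>

lemma length_reson: "(\<Prod>j\<le>J. exp (2 ^ j) ^ (bpow \<alpha> J j + bden J j)) \<le> exp (12 * (\<alpha> + 1) * 2 ^ J)"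
proof -
  have "(\<Prod>j\<le>J. exp (2 ^ j) ^ (bpow \<alpha> J j + bden J j)) = exp (\<Sum>j\<le>J. real (bpow \<alpha> J j + bden J j) * 2 ^ j)"
    by (subst exp_sum, simp, intro prod.cong refl) (simp only: exp_of_nat_mult)
  also have "... \<le> exp (12 * (\<alpha> + 1) * 2 ^ J)"
  proof -
    have "(\<Sum>j\<le>J. real (bpow \<alpha> J j + bden J j) * 2 ^ j) \<le> (\<Sum>j\<le>J. (\<alpha> + 1) * (2 ^ j * real (bden J j)))"
    proof (intro sum_mono)
      fix j
      have "real (bpow \<alpha> J j + bden J j) \<le> (\<alpha> + 1) * real (bden J j)" using bpow_bounds(2)[of J j] by (simp add: distrib_right)
      hence "real (bpow \<alpha> J j + bden J j) * 2 ^ j \<le> (\<alpha> + 1) * real (bden J j) * 2 ^ j" by (intro mult_right_mono) auto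
      thus "real (bpow \<alpha> J j + bden J j) * 2 ^ j \<le> (\<alpha> + 1) * (2 ^ j * real (bden J j))" by (simp add: mult_ac)
    qed
    also have "... = (\<alpha> + 1) * (\<Sum>j\<le>J. 2 ^ j * real (bden J j))" by (simp add: sum_distrib_left)
    also have "... \<le> (\<alpha> + 1) * (12 * 2 ^ J)" using \<alpha> by (intro mult_left_mono sum_bden) auto
    also have "... = 12 * (\<alpha> + 1) * 2 ^ J" by simp
    finally show ?thesis unfolding exp_le_cancel_iff .
  qed
  finally show ?thesis .
qed

text \<open>The exponents \<open>m j\<close> are b_j or b_j - 1 independently in each block, since
  AM-GM in every block produces all such choices. The errors K/b_j add up to a constant, and the W_j
  add up to sums over all primes up to exp (2^J), which \<open>prime_cos_sum_upper\<close> bounds at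
  the frequencies 0 and u - v.\<close>

lemma dpoly_resonator_pair:
  "\<exists>C>0. \<forall>J m (u :: real) v. (\<forall>j. m j = bden J j \<or> m j = bden J j - 1) \<longrightarrow> \<bar>u - v\<bar> \<le> 1 \<longrightarrow>
     dpoly (smooth_upto (primes_upto (exp (2 ^ J))) (exp (12 * (\<alpha> + 1) * 2 ^ J)))
        (sqrt (C * (2 ^ J) powr (\<alpha>^2 + 1) * norm (Complex (1 / 2 ^ J) (u - v)) powr (- 2 * \<alpha>)))
        (\<lambda>t. \<Prod>j\<le>J. bfac J j (t + u) ^ bpow \<alpha> J j * bfac J j (t + v) ^ m j)"
proof -
  define K where "K = 4 * exp (8 * ((\<alpha> + 1) * sqrt 909)^2)"
  define C where "C = exp (585 * (\<alpha> + 1)^2 + 6 * K)"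
  have K0: "K > 0" by (simp add: K_def)
  show ?thesis
  proof (intro exI[of _ C] conjI allI impI)
    show "C > 0" by (simp add: C_def)
  next
    fix J :: nat and m and u v :: real assume m: "\<forall>j. m j = bden J j \<or> m j = bden J j - 1" and uv: "\<bar>u - v\<bar> \<le> 1"
    let ?P = "primes_upto (exp (2 ^ J))"
    define W where "W j = (\<Sum>p\<in>blk j. (\<alpha>^2 + 1 + 2 * \<alpha> * cos ((u - v) * ln (real p))) / real p)" for j
    have W0: "W j \<ge> 0" for j unfolding W_def
    proof (intro sum_nonneg divide_nonneg_nonneg)
      fix p
      have "2 * \<alpha> * (-1) \<le> 2 * \<alpha> * cos ((u - v) * ln (real p))" using \<alpha> by (intro mult_left_mono) auto
      moreover have "(\<alpha> - 1)^2 \<ge> 0" by simp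
      ultimately show "0 \<le> \<alpha>^2 + 1 + 2 * \<alpha> * cos ((u - v) * ln (real p))" unfolding power2_diff by simp
    qed auto
    define D where "D = (\<Prod>j\<le>J. exp (W j / 2 + K / real (bden J j)))"
    have each: "dpoly (smooth_upto (blk j) (exp (2 ^ j) ^ (bpow \<alpha> J j + bden J j))) (exp (W j / 2 + K / real (bden J j)))
       (\<lambda>t. bfac J j (t + u) ^ bpow \<alpha> J j * bfac J j (t + v) ^ m j)" for j
    proof -
      have mj: "real (bden J j) - 1 \<le> real (m j)" "real (m j) \<le> real (bden J j)" using m[rule_format, of j] bden_pos[of J j] by (auto simp: of_nat_diff)
      have 1: "dpoly (\<Union>M\<le>bpow \<alpha> J j + m j. layer (blk j) M) (exp (W j / 2) + K / real (bden J j)) (\<lambda>t. bfac J j (t + u) ^ bpow \<alpha> J j * bfac J j (t + v) ^ m j)"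
        unfolding bfac_def W_def K_def
        by (rule dpoly_block_power[OF finite_blk blk_prime blk_sum_le]) (use \<alpha> bden_pos bpow_bounds mj in auto)
      show ?thesis
      proof (rule dpoly_mono[OF 1])
        \<comment> \<open>W_j >= 0 turns the additive error of the block into a relative
          one.\<close>
        have "exp (W j / 2) + K / real (bden J j) \<le> exp (W j / 2) * (1 + K / real (bden J j))"
          using W0[of j] K0 mult_right_mono[of 1 "exp (W j / 2)" "K / real (bden J j)"] by (simp add: distrib_left)
        also have "... \<le> exp (W j / 2) * exp (K / real (bden J j))" by (intro mult_left_mono exp_ge_add_one_self) auto
        finally show "exp (W j / 2) + K / real (bden J j) \<le> exp (W j / 2 + K / real (bden J j))" by (simp add: exp_add)
        show "(\<Union>M\<le>bpow \<alpha> J j + m j. layer (blk j) M) \<subseteq> smooth_upto (blk j) (exp (2 ^ j) ^ (bpow \<alpha> J j + bden J j))"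
        proof (rule UN_least)
          fix M assume "M \<in> {..bpow \<alpha> J j + m j}"
          hence "M \<le> bpow \<alpha> J j + bden J j" using mj by simp
          hence "exp ((2::real) ^ j) ^ M \<le> exp (2 ^ j) ^ (bpow \<alpha> J j + bden J j)" by (intro power_increasing) auto
          moreover have "layer (blk j) M \<subseteq> smooth_upto (blk j) (exp (2 ^ j) ^ M)"
            by (rule layer_subset_smooth_upto[OF finite_blk blk_prime blk_le])
          ultimately show "layer (blk j) M \<subseteq> smooth_upto (blk j) (exp (2 ^ j) ^ (bpow \<alpha> J j + bden J j))"
            using smooth_upto_mono subset_trans by blast
        qed
      qed (auto intro: smooth_upto_pos)
    qed
    have "dpoly (smooth_upto (\<Union>j\<le>J. blk j) (\<Prod>j\<le>J. exp (2 ^ j) ^ (bpow \<alpha> J j + bden J j))) D (\<lambda>t. \<Prod>j\<le>J. bfac J j (t + u) ^ bpow \<alpha> J j * bfac J j (t + v) ^ m j)"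
      unfolding D_def by (rule dpoly_prod) (use each blk_disjoint in auto)
    moreover have "D \<le> sqrt (C * (2 ^ J) powr (\<alpha>^2 + 1) * norm (Complex (1 / 2 ^ J) (u - v)) powr (- 2 * \<alpha>))"
    proof (rule real_le_rsqrt)
      let ?z = "norm (Complex (1 / 2 ^ J) (u - v))"
      have z: "?z > 0" by (simp add: complex_eq_iff)
      have pow: "exp (2 ^ J :: real) > 0" "(2::real) ^ J \<ge> 1" by auto
      have "(\<Sum>j\<le>J. W j) = (\<Sum>p\<in>?P. (\<alpha>^2 + 1 + 2 * \<alpha> * cos ((u - v) * ln (real p))) / real p)"
        unfolding W_def by (rule sum_blk)
      also have "... = (\<alpha>^2 + 1) * (\<Sum>p\<in>?P. cos (0 * ln (real p)) / real p) + 2 * \<alpha> * (\<Sum>p\<in>?P. cos ((u - v) * ln (real p)) / real p)"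
        by (simp add: sum_distrib_left add_divide_distrib sum.distrib)
      also have "... \<le> (\<alpha>^2 + 1) * (- ln (norm (Complex (1 / 2 ^ J) 0)) + 585) + 2 * \<alpha> * (- ln ?z + 585)"
        using \<alpha> uv pow by (intro add_mono mult_left_mono prime_cos_sum_upper) auto
      also have "... = (\<alpha>^2 + 1) * ln (2 ^ J) + (- 2 * \<alpha>) * ln ?z + 585 * (\<alpha> + 1)^2"
      proof -
        have "norm (Complex (1 / 2 ^ J) 0) = 1 / 2 ^ J" by (subst cmod_eq_Re) auto
        hence "- ln (norm (Complex (1 / 2 ^ J) 0)) = ln (2 ^ J)" by (simp add: ln_div)
        thus ?thesis by (simp add: power2_eq_square algebra_simps)
      qed
      finally have WW: "(\<Sum>j\<le>J. W j) \<le> (\<alpha>^2 + 1) * ln (2 ^ J) + (- 2 * \<alpha>) * ln ?z + 585 * (\<alpha> + 1)^2" .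
      have "D = exp (\<Sum>j\<le>J. W j / 2 + K / real (bden J j))" unfolding D_def by (simp add: exp_sum)
      hence "D^2 = exp (2 * (\<Sum>j\<le>J. W j / 2 + K / real (bden J j)))" by (simp only: exp_double)
      also have "2 * (\<Sum>j\<le>J. W j / 2 + K / real (bden J j)) = (\<Sum>j\<le>J. W j) + 2 * K * (\<Sum>j\<le>J. 1 / real (bden J j))"
        by (simp add: sum.distrib sum_distrib_left)
      also have "exp ... \<le> exp (((\<alpha>^2 + 1) * ln (2 ^ J) + (- 2 * \<alpha>) * ln ?z + 585 * (\<alpha> + 1)^2) + 2 * K * 3)"
        unfolding exp_le_cancel_iff using WW K0 by (intro add_mono mult_left_mono sum_inverse_bden) auto
      also have "... = C * (2 ^ J) powr (\<alpha>^2 + 1) * ?z powr (- 2 * \<alpha>)"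
        using z by (simp add: C_def powr_def exp_add[symmetric] algebra_simps)
      finally show "D^2 \<le> C * (2 ^ J) powr (\<alpha>^2 + 1) * ?z powr (- 2 * \<alpha>)" .
    qed
    ultimately show "dpoly (smooth_upto (?P) (exp (12 * (\<alpha> + 1) * 2 ^ J)))
        (sqrt (C * (2 ^ J) powr (\<alpha>^2 + 1) * norm (Complex (1 / 2 ^ J) (u - v)) powr (- 2 * \<alpha>)))
        (\<lambda>t. \<Prod>j\<le>J. bfac J j (t + u) ^ bpow \<alpha> J j * bfac J j (t + v) ^ m j)"
      unfolding Union_blk by (rule dpoly_mono[OF _ _ smooth_upto_mono[OF length_reson]]) (auto intro: smooth_upto_pos)
  qed
qed

lemma gpoly_resonator: "\<exists>c>0. \<forall>J. gpoly (exp (12 * (\<alpha> + 1) * 2 ^ J)) (c * (2 ^ J) powr (\<alpha>^2 + 2 * \<alpha>)) (reson \<alpha> J)"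
proof -
  define \<gamma> where "\<gamma> = \<alpha>^2 + 2 * \<alpha>"
  have \<gamma>: "\<gamma> > 0" unfolding \<gamma>_def using \<alpha> by (intro add_pos_pos) auto
  define K where "K = 2 * (2 * exp (((2 * \<alpha>)^2 + 2 * (2 * \<alpha>)) * 909))"
  have K0: "K > 0" by (simp add: K_def)
  \<comment> \<open>\<open>M\<close> covers two cases. If K/b_j <= 1/2, then E_j - K/b_j >= E_j exp
    (-2K/b_j) because E_j >= 1. Otherwise b_j <= 2K, and exp (-M/b_j) undoes the largest possible
    E_j, so that s_j >= 1 suffices.\<close>
  define M where "M = 2 * K * (1 + \<gamma> * 909)"
  \<comment> \<open>222 comes from \<open>prime_inverse_sum_lower\<close>, 3 \<gamma>^2 from the
    squares in exp (y - y^2) <= 1 + y, and 3 M from the sum of 1/b_j.\<close>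
  define c where "c = exp (- 222 * \<gamma> - 3 * \<gamma>^2 - 3 * M)"
  define E where "E j = (\<Prod>p\<in>blk j. 1 + \<gamma> * (1 / real p))" for j
  show ?thesis
  proof (intro exI[of _ c] conjI allI)
    show "c > 0" by (simp add: c_def)
  next
    fix J :: nat
    let ?P = "primes_upto (exp (2 ^ J))"
    define s where "s j = max 1 (E j - K / real (bden J j))" for j
    have each: "gpoly (exp (2 ^ j) ^ bpow \<alpha> J j) (s j) (\<lambda>t. bfac J j t ^ bpow \<alpha> J j)" for j
    proof -
      have "gpoly (exp (2 ^ j) ^ bpow \<alpha> J j) (max 1 ((\<Prod>p\<in>blk j. 1 + (\<alpha>^2 + 2 * \<alpha>) * (1 / real p)) - 2 * (2 * exp (((2 * \<alpha>)^2 + 2 * (2 * \<alpha>)) * 909)) / real (bden J j))) (\<lambda>t. (1 + psum (blk j) t / of_nat (bden J j)) ^ bpow \<alpha> J j)"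
        by (rule gpoly_block_power[OF finite_blk blk_prime blk_le _ blk_sum_le]) (use \<alpha> bden_pos bpow_bounds in auto)
      thus ?thesis by (simp add: s_def bfac_def K_def \<gamma>_def E_def)
    qed
    have "gpoly (\<Prod>j\<le>J. exp (2 ^ j) ^ bpow \<alpha> J j) (\<Prod>j\<le>J. s j) (\<lambda>t. \<Prod>j\<le>J. bfac J j t ^ bpow \<alpha> J j)"
      by (rule gpoly_prod) (use each in \<open>auto simp: s_def\<close>)
    hence RPR: "gpoly (\<Prod>j\<le>J. exp (2 ^ j) ^ bpow \<alpha> J j) (\<Prod>j\<le>J. s j) (reson \<alpha> J)" by (simp add: reson_def[abs_def])
    have E1: "1 \<le> E j" "E j \<le> exp (\<gamma> * 909)" for j
    proof -
      show "1 \<le> E j" unfolding E_def using \<gamma> by (intro prod_ge_1) auto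
      have "E j \<le> (\<Prod>p\<in>blk j. exp (\<gamma> * (1 / real p)))" unfolding E_def using \<gamma>
        by (intro prod_mono conjI exp_ge_add_one_self) (auto intro!: add_nonneg_nonneg)
      also have "... = exp (\<gamma> * (\<Sum>p\<in>blk j. 1 / real p))" using finite_blk by (simp add: exp_sum sum_distrib_left)
      also have "... \<le> exp (\<gamma> * 909)" using \<gamma> blk_sum_le[of j] by simp
      finally show "E j \<le> exp (\<gamma> * 909)" .
    qed
    have sj: "s j \<ge> E j * exp (- M / real (bden J j))" for j
    proof (cases "K / real (bden J j) \<le> 1/2")
      case True
      define \<epsilon> where "\<epsilon> = K / real (bden J j)"
      have \<epsilon>: "0 \<le> \<epsilon>" "\<epsilon> \<le> 1/2" using True K0 by (simp_all add: \<epsilon>_def)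
      have "- 2 * \<epsilon> \<le> ln (1 - \<epsilon>)"
      proof -
        have "- \<epsilon> - 2 * \<epsilon>^2 \<le> ln (1 - \<epsilon>)" using \<epsilon> by (rule ln_one_minus_pos_lower_bound)
        moreover have "2 * \<epsilon>^2 \<le> \<epsilon>" using \<epsilon> mult_right_mono[of \<epsilon> "1/2" \<epsilon>] by (simp add: power2_eq_square)
        ultimately show ?thesis by linarith
      qed
      hence "exp (- 2 * \<epsilon>) \<le> exp (ln (1 - \<epsilon>))" by (simp only: exp_le_cancel_iff)
      hence e2: "exp (- 2 * \<epsilon>) \<le> 1 - \<epsilon>" using \<epsilon> by simp
      have "- M / real (bden J j) \<le> - 2 * \<epsilon>"
      proof -
        have "2 * K * 1 \<le> M" unfolding M_def using K0 \<gamma> by (intro mult_left_mono) auto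
        hence "2 * K / real (bden J j) \<le> M / real (bden J j)" by (intro divide_right_mono) auto
        thus ?thesis by (simp add: \<epsilon>_def)
      qed
      hence "exp (- M / real (bden J j)) \<le> exp (- 2 * \<epsilon>)" by (simp only: exp_le_cancel_iff)
      hence "exp (- M / real (bden J j)) \<le> 1 - \<epsilon>" using e2 by (rule order_trans)
      hence "E j * exp (- M / real (bden J j)) \<le> E j * (1 - \<epsilon>)" using E1(1)[of j] by (intro mult_left_mono) auto
      also have "... \<le> E j - \<epsilon>" using E1(1)[of j] \<epsilon> mult_right_mono[of 1 "E j" \<epsilon>] by (simp add: right_diff_distrib)
      also have "... \<le> s j" by (simp add: s_def \<epsilon>_def)
      finally show ?thesis .
    next
      case False
      hence "real (bden J j) \<le> 2 * K" using bden_pos[of J j] by (simp add: field_simps)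
      hence "\<gamma> * 909 * real (bden J j) \<le> \<gamma> * 909 * (2 * K)" using \<gamma> by (intro mult_left_mono) auto
      also have "... \<le> M" unfolding M_def using K0 by (simp add: distrib_left)
      finally have "\<gamma> * 909 \<le> M / real (bden J j)" using bden_pos[of J j] by (simp add: field_simps)
      hence "exp (- M / real (bden J j)) \<le> exp (- (\<gamma> * 909))" by simp
      hence "E j * exp (- M / real (bden J j)) \<le> exp (\<gamma> * 909) * exp (- (\<gamma> * 909))" using E1[of j] by (intro mult_mono) auto
      also have "... = 1" by (simp flip: exp_add)
      also have "... \<le> s j" by (simp add: s_def)
      finally show ?thesis .
    qed
    have "c * (2 ^ J) powr \<gamma> \<le> (\<Prod>j\<le>J. s j)"
    proof -
      have xx: "exp (x - x^2) \<le> 1 + x" if "x \<ge> 0" for x :: real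
      proof (cases "x \<le> 1")
        case True
        hence "exp (x - x^2) \<le> exp (ln (1 + x))" unfolding exp_le_cancel_iff using that by (intro ln_one_plus_pos_lower_bound)
        thus ?thesis using that by simp
      next
        case False
        hence "x * 1 \<le> x * x" by (intro mult_left_mono) auto
        hence "exp (x - x^2) \<le> exp 0" unfolding exp_le_cancel_iff by (simp add: power2_eq_square)
        also have "... \<le> 1 + x" using that by simp
        finally show ?thesis .
      qed
      have "c * (2 ^ J) powr \<gamma> = exp ((\<gamma> * (ln (2 ^ J) - 222) - \<gamma>^2 * 3) + (- M) * 3)"
        by (simp add: c_def powr_def exp_add[symmetric] algebra_simps)
      also have "... \<le> exp ((\<gamma> * (\<Sum>p\<in>?P. 1 / real p) - \<gamma>^2 * (\<Sum>p\<in>?P. 1 / (real p)^2)) + (- M) * (\<Sum>j\<le>J. 1 / real (bden J j)))"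
        unfolding exp_le_cancel_iff
      proof (rule add_mono[OF diff_mono])
        show "\<gamma> * (ln (2 ^ J) - 222) \<le> \<gamma> * (\<Sum>p\<in>?P. 1 / real p)"
          using \<gamma> by (intro mult_left_mono prime_inverse_sum_lower) auto
        show "\<gamma>^2 * (\<Sum>p\<in>?P. 1 / (real p)^2) \<le> \<gamma>^2 * 3"
          by (intro mult_left_mono sum_inverse_squares_primes) (auto dest: primes_upto_ge_1)
        show "- M * 3 \<le> - M * (\<Sum>j\<le>J. 1 / real (bden J j))"
          using K0 \<gamma> by (intro mult_left_mono_neg sum_inverse_bden) (simp add: M_def)
      qed
      also have "\<gamma> * (\<Sum>p\<in>?P. 1 / real p) - \<gamma>^2 * (\<Sum>p\<in>?P. 1 / (real p)^2) = (\<Sum>j\<le>J. \<Sum>p\<in>blk j. \<gamma> * (1 / real p) - (\<gamma> * (1 / real p))^2)"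
        unfolding sum_blk by (simp add: sum_subtractf sum_distrib_left power_mult_distrib power_divide)
      also have "exp ((\<Sum>j\<le>J. \<Sum>p\<in>blk j. \<gamma> * (1 / real p) - (\<gamma> * (1 / real p))^2) + (- M) * (\<Sum>j\<le>J. 1 / real (bden J j)))
          = (\<Prod>j\<le>J. (\<Prod>p\<in>blk j. exp (\<gamma> * (1 / real p) - (\<gamma> * (1 / real p))^2)) * exp (- M / real (bden J j)))"
        using finite_blk by (simp add: exp_add exp_sum prod.distrib sum_distrib_left)
      also have "... \<le> (\<Prod>j\<le>J. E j * exp (- M / real (bden J j)))"
        unfolding E_def using \<gamma> by (intro prod_mono conjI mult_right_mono xx) (auto intro!: mult_nonneg_nonneg prod_nonneg)
      also have "... \<le> (\<Prod>j\<le>J. s j)" using sj E1(1) by (intro prod_mono conjI mult_nonneg_nonneg) (auto intro: order_trans[of 0 1])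
      finally show ?thesis .
    qed
    moreover have "(\<Prod>j\<le>J. exp (2 ^ j) ^ bpow \<alpha> J j) \<le> exp (12 * (\<alpha> + 1) * 2 ^ J)"
    proof -
      have "(\<Prod>j\<le>J. exp ((2::real) ^ j) ^ bpow \<alpha> J j) \<le> (\<Prod>j\<le>J. exp (2 ^ j) ^ (bpow \<alpha> J j + bden J j))"
        by (intro prod_mono conjI power_increasing) auto
      thus ?thesis using length_reson[of J] by linarith
    qed
    ultimately show "gpoly (exp (12 * (\<alpha> + 1) * 2 ^ J)) (c * (2 ^ J) powr (\<alpha>^2 + 2 * \<alpha>)) (reson \<alpha> J)"
      using gpoly_mono[OF RPR] by (simp add: \<gamma>_def)
  qed
qed

end

section \<open>The moment\<close>

lemma dpoly_integral_upper:
  assumes "dpoly S K A" "\<And>n. n \<in> S \<Longrightarrow> real n \<le> Y" "4 * Y * (1 + ln Y) \<le> T" "T > 0"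
  shows "integral {T..2*T} (\<lambda>t. (norm (A t))^2) \<le> 2 * T * K^2"
proof -
  obtain a where a: "finite S" "\<And>n. n \<in> S \<Longrightarrow> n > 0" "A = (\<lambda>t. \<Sum>n\<in>S. a n * chi t n)" "(\<Sum>n\<in>S. (norm (a n))^2) \<le> K^2"
    by (rule dpolyE[OF assms(1)]) blast
  let ?q = "\<Sum>n\<in>S. (norm (a n))^2"
  have "\<bar>integral {T..2*T} (\<lambda>t. (norm (\<Sum>n\<in>S. a n * cis (- t * ln (real n))))^2) - T * ?q\<bar> \<le> 4 * Y * (1 + ln Y) * ?q"
    using a assms by (intro dirichlet_mean_value) (auto simp: Suc_le_eq)
  also have "... \<le> T * ?q" using assms by (intro mult_right_mono sum_nonneg) auto
  finally have "integral {T..2*T} (\<lambda>t. (norm (A t))^2) \<le> 2 * T * ?q" by (simp add: a chi_def)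
  also have "... \<le> 2 * T * K^2" using a assms by (intro mult_left_mono) auto
  finally show ?thesis .
qed

lemma dirichlet_integral_lower:
  assumes S: "finite S" "\<And>n. n \<in> S \<Longrightarrow> 1 \<le> n \<and> real n \<le> Y" and "4 * Y * (1 + ln Y) \<le> T / 2" "T > 0"
  shows "integral {T..2*T} (\<lambda>t. (norm (\<Sum>n\<in>S. a n * chi t n))^2) \<ge> T / 2 * (\<Sum>n\<in>S. (norm (a n))^2)"
proof -
  let ?q = "\<Sum>n\<in>S. (norm (a n))^2"
  have "\<bar>integral {T..2*T} (\<lambda>t. (norm (\<Sum>n\<in>S. a n * cis (- t * ln (real n))))^2) - T * ?q\<bar> \<le> 4 * Y * (1 + ln Y) * ?q"
    using assms by (intro dirichlet_mean_value)
  also have "... \<le> T / 2 * ?q" using assms by (intro mult_right_mono sum_nonneg) auto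
  finally have "T / 2 * ?q \<le> integral {T..2*T} (\<lambda>t. (norm (\<Sum>n\<in>S. a n * cis (- t * ln (real n))))^2)"
    by (auto dest: abs_le_D2 simp only:)
  thus ?thesis by (simp only: chi_def)
qed

definition zsum :: "real \<Rightarrow> real \<Rightarrow> complex" where
  "zsum x t = (\<Sum>n\<in>upto_real x. chi t n)"

lemma gpoly_integral_lower:
  assumes "gpoly Y s R" "\<bar>u\<bar> \<le> 1" "Y \<ge> 1" "729 * Y \<le> x" "4 * (x * Y) * (1 + ln (x * Y)) \<le> T / 2" "T > 0"
  shows "integral {T..2*T} (\<lambda>t. (norm (zsum x t * R (t + u)))^2) \<ge> T / 2 * (s * x / (9 * (1 + ln (x * Y))))"
proof -
  from assms(1) obtain r where r: "\<And>n. r n \<ge> 0" "\<And>t. R t = (\<Sum>n\<in>upto_real Y. of_real (r n) * chi t n)" "s \<le> gcdsum Y r"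
    unfolding gpoly_def by blast
  define c where "c = (\<lambda>M. \<Sum>(m,n)\<in>{z \<in> upto_real x \<times> upto_real Y. fst z * snd z = M}. of_real (r n) * chi u n)"
  have "zsum x t * R (t + u) = (\<Sum>M\<in>upto_real (x * Y). c M * chi t M)" for t
  proof -
    have "(\<Sum>M\<in>upto_real (x * Y). c M * chi t M) = (\<Sum>m\<in>upto_real x. \<Sum>n\<in>upto_real Y. of_real (r n) * chi u n * chi t (m * n))"
      unfolding c_def by (rule sum_group_mult)
    also have "... = (\<Sum>m\<in>upto_real x. \<Sum>n\<in>upto_real Y. chi t m * (of_real (r n) * chi (t + u) n))"
      by (intro sum.cong refl) (simp add: chi_mult chi_add upto_real_pos)
    finally show ?thesis by (simp add: zsum_def r sum_product)
  qed
  hence eq: "integral {T..2*T} (\<lambda>t. (norm (zsum x t * R (t + u)))^2) = integral {T..2*T} (\<lambda>t. (norm (\<Sum>M\<in>upto_real (x * Y). c M * chi t M))^2)"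
    by simp
  have "1 * 1 \<le> x * Y" using assms by (intro mult_mono) auto
  hence "ln (x * Y) \<ge> 0" by simp
  hence "s * x / (9 * (1 + ln (x * Y))) \<le> gcdsum Y r * x / (9 * (1 + ln (x * Y)))"
    using assms r by (intro divide_right_mono mult_right_mono) auto
  also have "... \<le> (\<Sum>M\<in>upto_real (x * Y). (norm (c M))^2)"
    unfolding c_def using assms r by (intro twisted_norm_lower)
  finally have "T / 2 * (s * x / (9 * (1 + ln (x * Y)))) \<le> T / 2 * (\<Sum>M\<in>upto_real (x * Y). (norm (c M))^2)"
    using assms by (intro mult_left_mono) auto
  also have "... \<le> integral {T..2*T} (\<lambda>t. (norm (\<Sum>M\<in>upto_real (x * Y). c M * chi t M))^2)"
    using assms by (intro dirichlet_integral_lower finite_upto_real) (auto simp: upto_real_def)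
  finally show ?thesis unfolding eq .
qed

lemma continuous_on_bfac: "continuous_on A (bfac J j)"
  unfolding bfac_def[abs_def] psum_def chi_def using bden_pos[of J j] by (intro continuous_intros) auto

lemma continuous_on_bfac_shift: "continuous_on A (\<lambda>t. bfac J j (t + u))"
  by (rule continuous_on_compose2[OF continuous_on_bfac[of UNIV]]) (auto intro!: continuous_intros)

lemma continuous_on_reson_shift: "continuous_on A (\<lambda>t. reson \<alpha> J (t + u))"
  unfolding reson_def by (intro continuous_intros continuous_on_bfac_shift)

lemma continuous_on_zsum: "continuous_on A (zsum x)"
  unfolding zsum_def[abs_def] chi_def by (intro continuous_intros)

section \<open>Fractional powers of the resonator\<close>

lemma powr_sum_le:
  fixes f :: "'a \<Rightarrow> real"
  assumes "0 < \<theta>" "\<theta> \<le> 1" "finite A" "\<And>i. i \<in> A \<Longrightarrow> f i \<ge> 0"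
  shows "(\<Sum>i\<in>A. f i) powr \<theta> \<le> (\<Sum>i\<in>A. f i powr \<theta>)"
proof -
  have two: "(a + b) powr \<theta> \<le> a powr \<theta> + b powr \<theta>" if "a \<ge> 0" "b \<ge> 0" for a b :: real
  proof (cases "a = 0 \<or> b = 0")
    case False
    hence ab: "a > 0" "b > 0" using that by auto
    have "(a + b) powr \<theta> = (a + b) * (a + b) powr (\<theta> - 1)" using ab by (simp add: powr_mult_base)
    also have "... = a * (a + b) powr (\<theta> - 1) + b * (a + b) powr (\<theta> - 1)" by (simp add: distrib_right)
    also have "... \<le> a * a powr (\<theta> - 1) + b * b powr (\<theta> - 1)"
      using ab assms by (intro add_mono mult_left_mono powr_mono2') auto
    also have "... = a powr \<theta> + b powr \<theta>" using ab by (simp add: powr_mult_base)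
    finally show ?thesis .
  qed auto
  show ?thesis using assms(3,4)
  proof (induction A)
    case (insert i A)
    have "(\<Sum>i\<in>insert i A. f i) powr \<theta> = (f i + (\<Sum>i\<in>A. f i)) powr \<theta>" using insert.hyps by simp
    also have "... \<le> f i powr \<theta> + (\<Sum>i\<in>A. f i) powr \<theta>" using insert by (intro two sum_nonneg) auto
    also have "... \<le> f i powr \<theta> + (\<Sum>i\<in>A. f i powr \<theta>)" using insert by (intro add_left_mono insert.IH) auto
    finally show ?case using insert.hyps by simp
  qed auto
qed

context
  fixes \<alpha> :: real
  assumes \<alpha>: "\<alpha> > 1"
begin

text \<open>\<open>w\<close> is the weight that writes n_j / \<alpha> as a mean of b_j and b_j - 1;
  it lies in [0, 1] because \<alpha> b_j - 1 <= n_j <= \<alpha> b_j and 1/\<alpha> <= 1.\<close>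

lemma fractional_power_le:
  fixes a :: real and J j :: nat
  assumes "a \<ge> 0"
  defines "w \<equiv> real (bpow \<alpha> J j) / \<alpha> - (real (bden J j) - 1)"
  shows "(a ^ bpow \<alpha> J j) powr (1 / \<alpha>) \<le> w * a ^ bden J j + (1 - w) * a ^ (bden J j - 1)" "0 \<le> w" "w \<le> 1"
proof -
  let ?n = "bpow \<alpha> J j" and ?b = "bden J j"
  have "(\<alpha> * real ?b - 1) / \<alpha> \<le> real ?n / \<alpha>" using bpow_bounds(1)[OF \<alpha>, of J j] \<alpha> by (intro divide_right_mono) auto
  hence "real ?b - 1 / \<alpha> \<le> real ?n / \<alpha>" using \<alpha> by (simp add: diff_divide_distrib)
  moreover have "1 / \<alpha> \<le> 1" using \<alpha> by simp
  ultimately show w0: "0 \<le> w" by (simp add: w_def)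
  have "real ?n / \<alpha> \<le> real ?b" using bpow_bounds(2)[OF \<alpha>, of J j] \<alpha> by (simp add: field_simps)
  thus w1: "w \<le> 1" by (simp add: w_def)
  show "(a ^ ?n) powr (1 / \<alpha>) \<le> w * a ^ ?b + (1 - w) * a ^ (?b - 1)"
  proof (cases "a = 0")
    \<comment> \<open>The bound is also claimed at the zeros of a block factor; the left side
      vanishes there because n_j > 0.\<close>
    case True
    thus ?thesis using bpow_pos[OF \<alpha>, of J j] w0 w1 by (simp add: power_0_left)
  next
    case False
    hence a: "a > 0" using assms by simp
    have b1: "real (?b - 1) = real ?b - 1" using bden_pos[of J j] by (simp add: of_nat_diff)
    have "(a ^ ?n) powr (1 / \<alpha>) = a powr (real ?n / \<alpha>)" using a by (simp add: powr_realpow[symmetric] powr_powr)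
    also have "real ?n / \<alpha> = real ?b * w + real (?b - 1) * (1 - w)"     proof -
      have "real ?b * w + (real ?b - 1) * (1 - w) = w + (real ?b - 1)" by (simp add: algebra_simps)
      thus ?thesis unfolding b1 by (simp add: w_def)
    qed
    also have "a powr ... = (a ^ ?b) powr w * (a ^ (?b - 1)) powr (1 - w)"
      using a by (simp add: powr_realpow[symmetric] powr_powr powr_add)
    also have "... \<le> w * a ^ ?b + (1 - w) * a ^ (?b - 1)"
      using a w0 w1 by (intro Youngs_inequality_0) auto
    finally show ?thesis .
  qed
qed

text \<open>Multiplied out, the means over single blocks become one mean over the sets
  \<open>X\<close> of blocks that receive b_j rather than b_j - 1. The weights \<open>c X\<close>
  sum to 1, so the 2^(J+1) terms cost nothing.\<close>

lemma integral_reson_fractional_le: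
  assumes "\<And>m. (\<forall>j. m j = bden J j \<or> m j = bden J j - 1) \<Longrightarrow>
      integral {a..b} (\<lambda>t. (norm (\<Prod>j\<le>J. bfac J j (t + u) ^ bpow \<alpha> J j * bfac J j (t + v) ^ m j))^2) \<le> B"
  shows "integral {a..b} (\<lambda>t. (norm (reson \<alpha> J (t + u)))^2 * ((norm (reson \<alpha> J (t + v)))^2) powr (1 / \<alpha>)) \<le> B"
proof -
  let ?n = "bpow \<alpha> J"
  define w where "w j = real (?n j) / \<alpha> - (real (bden J j) - 1)" for j
  have w: "0 \<le> w j" "w j \<le> 1" for j using fractional_power_le(2,3)[of 0 J j] by (simp_all add: w_def)
  define M where "M X j = (if j \<in> X then bden J j else bden J j - 1)" for X :: "nat set" and j
  define F where "F X t = (norm (\<Prod>j\<le>J. bfac J j (t + u) ^ ?n j * bfac J j (t + v) ^ M X j))^2" for X t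
  define c where "c X = (\<Prod>j\<in>X. w j) * (\<Prod>j\<in>{..J} - X. 1 - w j)" for X
  have c0: "c X \<ge> 0" for X unfolding c_def using w by (intro mult_nonneg_nonneg prod_nonneg) (auto simp: le_diff_eq)
  have csum: "(\<Sum>X\<in>Pow {..J}. c X) = 1"
  proof -
    have "(\<Sum>X\<in>Pow {..J}. c X) = (\<Prod>j\<le>J. w j + (1 - w j))" unfolding c_def by (rule prod_add[symmetric]) simp
    thus ?thesis by simp
  qed
  have pt: "(norm (reson \<alpha> J (t + u)))^2 * ((norm (reson \<alpha> J (t + v)))^2) powr (1 / \<alpha>) \<le> (\<Sum>X\<in>Pow {..J}. c X * F X t)" for t
  proof -
    define p q where "p j = (norm (bfac J j (t + u)))^2" and "q j = (norm (bfac J j (t + v)))^2" for j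
    have pq: "p j \<ge> 0" "q j \<ge> 0" for j by (auto simp: p_def q_def)
    have R: "(norm (reson \<alpha> J (t + u)))^2 = (\<Prod>j\<le>J. p j ^ ?n j)" "(norm (reson \<alpha> J (t + v)))^2 = (\<Prod>j\<le>J. q j ^ ?n j)"
      by (simp_all add: reson_def p_def q_def prod_norm[symmetric] norm_power prod_power_distrib power_mult[symmetric] mult.commute)
    have F: "F X t = (\<Prod>j\<le>J. p j ^ ?n j * q j ^ M X j)" for X
      by (simp add: F_def p_def q_def prod_norm[symmetric] norm_mult norm_power prod_power_distrib power_mult[symmetric] power_mult_distrib mult.commute)
    have "(\<Prod>j\<le>J. q j ^ ?n j) powr (1 / \<alpha>) = (\<Prod>j\<le>J. (q j ^ ?n j) powr (1 / \<alpha>))"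
      using pq by (simp add: prod_powr_distrib)
    hence "(norm (reson \<alpha> J (t + u)))^2 * ((norm (reson \<alpha> J (t + v)))^2) powr (1 / \<alpha>) = (\<Prod>j\<le>J. p j ^ ?n j * (q j ^ ?n j) powr (1 / \<alpha>))"
      by (simp add: R prod.distrib)
    also have "... \<le> (\<Prod>j\<le>J. p j ^ ?n j * (w j * q j ^ bden J j + (1 - w j) * q j ^ (bden J j - 1)))"
      unfolding w_def using pq by (intro prod_mono conjI mult_left_mono fractional_power_le(1) mult_nonneg_nonneg) auto
    also have "... = (\<Prod>j\<le>J. w j * (p j ^ ?n j * q j ^ bden J j) + (1 - w j) * (p j ^ ?n j * q j ^ (bden J j - 1)))"
      by (simp add: algebra_simps)
    also have "... = (\<Sum>X\<in>Pow {..J}. (\<Prod>j\<in>X. w j * (p j ^ ?n j * q j ^ bden J j)) * (\<Prod>j\<in>{..J}-X. (1 - w j) * (p j ^ ?n j * q j ^ (bden J j - 1))))"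
      by (rule prod_add) simp
    also have "... = (\<Sum>X\<in>Pow {..J}. c X * F X t)"
    proof (intro sum.cong refl)
      fix X assume "X \<in> Pow {..J}"
      hence X: "X \<subseteq> {..J}" by simp
      have "F X t = (\<Prod>j\<in>{..J}-X. p j ^ ?n j * q j ^ M X j) * (\<Prod>j\<in>X. p j ^ ?n j * q j ^ M X j)"
        unfolding F by (rule prod.subset_diff[OF X]) simp
      also have "(\<Prod>j\<in>{..J}-X. p j ^ ?n j * q j ^ M X j) = (\<Prod>j\<in>{..J}-X. p j ^ ?n j * q j ^ (bden J j - 1))"
        by (intro prod.cong refl) (simp add: M_def)
      also have "(\<Prod>j\<in>X. p j ^ ?n j * q j ^ M X j) = (\<Prod>j\<in>X. p j ^ ?n j * q j ^ bden J j)"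
        by (intro prod.cong refl) (simp add: M_def)
      finally show "(\<Prod>j\<in>X. w j * (p j ^ ?n j * q j ^ bden J j)) * (\<Prod>j\<in>{..J}-X. (1 - w j) * (p j ^ ?n j * q j ^ (bden J j - 1))) = c X * F X t"
        unfolding c_def prod.distrib by (simp add: mult_ac)
    qed
    finally show ?thesis .
  qed
  have Fint: "F X integrable_on {a..b}" for X
    unfolding F_def[abs_def] by (intro integrable_continuous_real continuous_intros continuous_on_bfac_shift)
  have cFint: "(\<lambda>t. c X * F X t) integrable_on {a..b}" for X
    using integrable_on_cmult_left[OF Fint, of "c X"] by simp
  have "integral {a..b} (\<lambda>t. (norm (reson \<alpha> J (t + u)))^2 * ((norm (reson \<alpha> J (t + v)))^2) powr (1 / \<alpha>)) \<le> integral {a..b} (\<lambda>t. \<Sum>X\<in>Pow {..J}. c X * F X t)"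
  proof (rule integral_le)
    show "(\<lambda>t. (norm (reson \<alpha> J (t + u)))^2 * ((norm (reson \<alpha> J (t + v)))^2) powr (1 / \<alpha>)) integrable_on {a..b}"
      using \<alpha> by (intro integrable_continuous_real continuous_intros continuous_on_reson_shift continuous_on_powr') auto
    show "(\<lambda>t. \<Sum>X\<in>Pow {..J}. c X * F X t) integrable_on {a..b}" by (intro integrable_sum cFint) auto
  qed (rule pt)
  also have "... = (\<Sum>X\<in>Pow {..J}. c X * integral {a..b} (F X))"
    by (subst integral_sum) (auto intro: cFint)
  also have "... \<le> (\<Sum>X\<in>Pow {..J}. c X * B)"
  proof (intro sum_mono mult_left_mono c0)
    fix X
    show "integral {a..b} (F X) \<le> B" unfolding F_def[abs_def] by (rule assms) (auto simp: M_def)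
  qed
  also have "... = B" using csum by (simp flip: sum_distrib_right)
  finally show ?thesis .
qed

end

section \<open>The weight over all shifts and the final bounds\<close>

lemma sum_inverse_max_squares: "(\<Sum>i<N. 1 / (max 1 \<bar>real i - real i0\<bar>)^2) \<le> 7"
proof -
  have "(\<Sum>i<N. 1 / (max 1 \<bar>real i - real i0\<bar>)^2) \<le> (\<Sum>i\<in>{..<i0} \<union> ({i0} \<union> {i0<..<i0+N+1}). 1 / (max 1 \<bar>real i - real i0\<bar>)^2)"
    by (intro sum_mono2) auto
  also have "... = (\<Sum>i\<in>{..<i0}. 1 / (max 1 \<bar>real i - real i0\<bar>)^2) + ((\<Sum>i\<in>{i0}. 1 / (max 1 \<bar>real i - real i0\<bar>)^2) + (\<Sum>i\<in>{i0<..<i0+N+1}. 1 / (max 1 \<bar>real i - real i0\<bar>)^2))"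
    by (subst sum.union_disjoint, simp, simp, fastforce, subst sum.union_disjoint) auto
  also have "(\<Sum>i\<in>{..<i0}. 1 / (max 1 \<bar>real i - real i0\<bar>)^2) = (\<Sum>d\<in>{1..i0}. 1 / (real d)^2)"
    by (rule sum.reindex_bij_witness[where i="\<lambda>d. i0 - d" and j="\<lambda>i. i0 - i"]) (auto simp: of_nat_diff max_def)
  also have "... \<le> 3" by (rule sum_inverse_squares_primes) auto
  also have "(\<Sum>i\<in>{i0<..<i0+N+1}. 1 / (max 1 \<bar>real i - real i0\<bar>)^2) = (\<Sum>d\<in>{1..N}. 1 / (real d)^2)"
    by (rule sum.reindex_bij_witness[where i="\<lambda>d. i0 + d" and j="\<lambda>i. i - i0"]) (auto simp: of_nat_diff max_def)
  also have "... \<le> 3" by (rule sum_inverse_squares_primes) auto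
  finally show ?thesis by simp
qed

lemma moment_large_x:
  fixes k :: real
  assumes "k > 2"
  shows "\<exists>c>0. \<forall>T x. T > 0 \<longrightarrow> x > 0 \<longrightarrow> ln x \<ge> 1000 * k \<longrightarrow> 4 * x powr (11/10) * (1 + ln (x powr (11/10))) \<le> T / 2 \<longrightarrow>
     integral {T..2*T} (\<lambda>t. ((norm (zsum x t))^2) powr k) \<ge> c * T * x powr k * ln x powr ((k - 1)^2)"
proof -
  define \<alpha> where "\<alpha> = k - 1"
  have \<alpha>: "\<alpha> > 1" using assms by (simp add: \<alpha>_def)
  define \<gamma> where "\<gamma> = \<alpha>^2 + 2 * \<alpha>"
  have \<gamma>: "\<gamma> > 0" unfolding \<gamma>_def using \<alpha> by (intro add_pos_pos) auto
  obtain C where C: "C > 0" "\<And>J m u v. (\<forall>j. m j = bden J j \<or> m j = bden J j - 1) \<Longrightarrow> \<bar>u - v\<bar> \<le> 1 \<Longrightarrow>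
     dpoly (smooth_upto (primes_upto (exp (2 ^ J))) (exp (12 * k * 2 ^ J)))
        (sqrt (C * (2 ^ J) powr (\<alpha>^2 + 1) * norm (Complex (1 / 2 ^ J) (u - v)) powr (- 2 * \<alpha>)))
        (\<lambda>t. \<Prod>j\<le>J. bfac J j (t + u) ^ bpow \<alpha> J j * bfac J j (t + v) ^ m j)"
    using dpoly_resonator_pair[OF \<alpha>] by (auto simp: \<alpha>_def)
  obtain c where c: "c > 0" "\<And>J. gpoly (exp (12 * k * 2 ^ J)) (c * (2 ^ J) powr \<gamma>) (reson \<alpha> J)"
    using gpoly_resonator[OF \<alpha>] by (auto simp: \<alpha>_def \<gamma>_def)
  \<comment> \<open>72 = 2 * 2 * 18 collects N >= L/2, the T/2 of the mean value and the divisor 18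
    L; 240 k bounds L / 2^J. In \<open>b1\<close> below, 14 = 2 * 7 joins the mean value bound with
    \<open>sum_inverse_max_squares\<close>.\<close>
  define a1 where "a1 = c / (72 * (240 * k) powr \<gamma>)"
  have a1: "a1 > 0" using c assms by (simp add: a1_def)
  define b1 where "b1 = 14 * C"
  have b1: "b1 > 0" using C by (simp add: b1_def)
  show ?thesis
  proof (intro exI[of _ "a1 powr k / b1 powr (k - 1)"] conjI allI impI)
    show "a1 powr k / b1 powr (k - 1) > 0" using a1 b1 by simp
  next
    fix T x :: real assume T: "T > 0" and x: "x > 0" "ln x \<ge> 1000 * k" and Tx: "4 * x powr (11/10) * (1 + ln (x powr (11/10))) \<le> T / 2"
    let ?X = "x powr (11/10)"
    define L where "L = ln x"
    have L: "L \<ge> 1000 * k" "L \<ge> 2000" using x assms by (simp_all add: L_def)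
    have xL: "x = exp L" using x by (simp add: L_def)
    \<comment> \<open>With 2^J <= L/(120 k) the length exp (12 k 2^J) is at most x^(1/10), while 2^J
      >= L/(240 k) keeps powers of 2^J and of L comparable.\<close>
    obtain J :: nat where J: "2 ^ J \<le> L / (120 * k)" "L / (120 * k) < 2 ^ Suc J"
    proof -
      have "1 \<le> L / (120 * k)" using L assms by (simp add: field_simps)
      moreover obtain n where "L / (120 * k) < 2 ^ n" using real_arch_pow[of 2 "L / (120 * k)"] by auto
      ultimately have ex: "\<exists>n. L / (120 * k) < 2 ^ n" "\<not> L / (120 * k) < 2 ^ 0" by auto
      define m where "m = (LEAST n. L / (120 * k) < 2 ^ n)"
      have m: "L / (120 * k) < 2 ^ m" unfolding m_def using ex(1) by (rule LeastI_ex)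
      hence "m \<noteq> 0" using ex(2) by metis
      then obtain i where i: "m = Suc i" by (cases m) auto
      hence "\<not> L / (120 * k) < 2 ^ i" using not_less_Least[of i "\<lambda>n. L / (120 * k) < 2 ^ n"] by (simp add: m_def)
      thus ?thesis using m i by (intro that[of i]) auto
    qed
    define l :: real where "l = 2 ^ J"
    have l: "l \<ge> 1" "12 * k * l \<le> L / 10" "L / (240 * k) \<le> l" "l \<le> L"
    proof -
      show "l \<ge> 1" by (simp add: l_def)
      show *: "12 * k * l \<le> L / 10" using J(1) assms by (simp add: l_def field_simps)
      show "L / (240 * k) \<le> l" using J(2) assms by (simp add: l_def field_simps)
      have "1 * l \<le> 12 * k * l" using assms \<open>l \<ge> 1\<close> by (intro mult_right_mono) auto
      thus "l \<le> L" using * L by linarith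
    qed
    define Y where "Y = exp (12 * k * l)"
    have Y1: "Y \<ge> 1" using l assms by (simp add: Y_def)
    have YL: "Y \<le> exp (L / 10)" using l by (simp add: Y_def)
    have xY: "x * Y \<le> ?X"
    proof -
      have "x * Y \<le> exp L * exp (L / 10)" unfolding xL using YL by (intro mult_left_mono) auto
      also have "... = ?X" by (simp add: xL powr_def flip: exp_add)
      finally show ?thesis .
    qed
    have x1: "x \<ge> 1" using L by (simp add: xL)
    have xY1: "x * Y \<ge> 1" using mult_mono[of 1 x 1 Y] x1 Y1 by simp
    have lenmono: "4 * z * (1 + ln z) \<le> T / 2" if "1 \<le> z" "z \<le> ?X" for z
    proof -
      have "4 * z * (1 + ln z) \<le> 4 * ?X * (1 + ln (?X))"
        using that by (intro mult_mono add_left_mono ln_mono) (auto intro!: add_nonneg_nonneg)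
      thus ?thesis using Tx by linarith
    qed
    have lnxY: "1 + ln (x * Y) \<le> 2 * L"
    proof -
      have "ln (x * Y) \<le> ln (?X)" using xY xY1 by (intro ln_mono) auto
      also have "... = 11/10 * L" using x by (simp add: L_def ln_powr)
      finally show ?thesis using L by linarith
    qed
    have Y729: "729 * Y \<le> x"
    proof -
      have "729 \<le> exp (9/10 * L)" using exp_ge_add_one_self[of "9/10 * L"] L by linarith
      hence "729 * Y \<le> exp (9/10 * L) * exp (L / 10)" using YL Y1 by (intro mult_mono) auto
      also have "... = x" by (simp add: xL flip: exp_add)
      finally show ?thesis .
    qed
    define N where "N = nat \<lfloor>L\<rfloor>"
    have N: "real N \<le> L" "real N \<ge> L / 2"
    proof -
      show "real N \<le> L" using L by (simp add: N_def)
      have "real N > L - 1" using L unfolding N_def by linarith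
      thus "real N \<ge> L / 2" using L by linarith
    qed
    define u where "u i = real i / L" for i :: nat
    have u: "0 \<le> u i" "u i \<le> 1" if "i < N" for i using that N L by (auto simp: u_def field_simps)
    define g where "g t = (\<Sum>i<N. (norm (reson \<alpha> J (t + u i)))^2)" for t
    have g0: "g t \<ge> 0" for t unfolding g_def by (intro sum_nonneg) auto
    have contg: "continuous_on {T..2*T} g" unfolding g_def[abs_def] by (intro continuous_intros continuous_on_reson_shift)
    have contD: "continuous_on {T..2*T} (\<lambda>t. (norm (zsum x t))^2)" by (intro continuous_intros continuous_on_zsum)
    define A where "A = a1 * T * x * L powr \<gamma>"
    define B where "B = b1 * T * L powr (k^2 + 1)"
    have lower: "A \<le> integral {T..2*T} (\<lambda>t. (norm (zsum x t))^2 * g t)"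
    proof -
      define s where "s = c * l powr \<gamma>"
      have s: "s \<ge> c * (L / (240 * k)) powr \<gamma>" unfolding s_def
        using c l L assms \<gamma> by (intro mult_left_mono powr_mono2) auto
      have s0: "s \<ge> 0" using c by (simp add: s_def)
      have each: "T / 2 * (s * x / (18 * L)) \<le> integral {T..2*T} (\<lambda>t. (norm (zsum x t * reson \<alpha> J (t + u i)))^2)" if "i < N" for i
      proof -
        have "gpoly Y s (reson \<alpha> J)" using c(2)[of J] by (simp add: Y_def s_def l_def)
        hence "T / 2 * (s * x / (9 * (1 + ln (x * Y)))) \<le> integral {T..2*T} (\<lambda>t. (norm (zsum x t * reson \<alpha> J (t + u i)))^2)"
          using u[OF that] Y1 Y729 lenmono[OF xY1 xY] T by (intro gpoly_integral_lower) auto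
        moreover have "s * x / (18 * L) \<le> s * x / (9 * (1 + ln (x * Y)))"
          using lnxY xY1 s0 x1 L by (intro divide_left_mono mult_pos_pos) (auto intro!: add_pos_nonneg)
        hence "T / 2 * (s * x / (18 * L)) \<le> T / 2 * (s * x / (9 * (1 + ln (x * Y))))" using T by (intro mult_left_mono) auto
        ultimately show ?thesis by linarith
      qed
      have "A \<le> real N * (T / 2 * (s * x / (18 * L)))"
      proof -
        have "A = (L / 2) * (T / 2 * ((c * (L / (240 * k)) powr \<gamma>) * x / (18 * L)))"
          using L assms by (simp add: A_def a1_def powr_divide field_simps)
        also have "... \<le> real N * (T / 2 * (s * x / (18 * L)))"
          using N s T x L c by (intro mult_mono divide_right_mono mult_left_mono mult_right_mono) auto
        finally show ?thesis .
      qed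
      also have "... = (\<Sum>i<N. T / 2 * (s * x / (18 * L)))" by simp
      also have "... \<le> (\<Sum>i<N. integral {T..2*T} (\<lambda>t. (norm (zsum x t * reson \<alpha> J (t + u i)))^2))"
        by (intro sum_mono each) auto
      also have "... = integral {T..2*T} (\<lambda>t. \<Sum>i<N. (norm (zsum x t * reson \<alpha> J (t + u i)))^2)"
        by (rule integral_sum[symmetric])
           (auto intro!: integrable_continuous_real continuous_intros continuous_on_zsum continuous_on_reson_shift)
      also have "... = integral {T..2*T} (\<lambda>t. (norm (zsum x t))^2 * g t)"
        by (simp add: g_def norm_mult power_mult_distrib sum_distrib_left)
      finally show ?thesis .
    qed
    have upper: "integral {T..2*T} (\<lambda>t. g t powr (k / (k - 1))) \<le> B"
    proof -
      define h where "h i j t = (norm (reson \<alpha> J (t + u i)))^2 * ((norm (reson \<alpha> J (t + u j)))^2) powr (1 / \<alpha>)" for i j t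
      have inth: "h i j integrable_on {T..2*T}" for i j unfolding h_def[abs_def]
        using \<alpha> by (intro integrable_continuous_real continuous_intros continuous_on_reson_shift continuous_on_powr') auto
      have pt: "g t powr (k / (k - 1)) \<le> (\<Sum>i<N. \<Sum>j<N. h i j t)" for t
      proof -
        have "k / (k - 1) = 1 + 1 / \<alpha>" using assms by (simp add: \<alpha>_def field_simps)
        hence "g t powr (k / (k - 1)) = g t * g t powr (1 / \<alpha>)" using g0 by (simp add: powr_mult_base)
        also have "... \<le> g t * (\<Sum>j<N. ((norm (reson \<alpha> J (t + u j)))^2) powr (1 / \<alpha>))"
          unfolding g_def using \<alpha> by (intro mult_left_mono powr_sum_le sum_nonneg) auto
        also have "... = (\<Sum>i<N. \<Sum>j<N. h i j t)" by (simp add: g_def h_def sum_product)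
        finally show ?thesis .
      qed
      have each: "integral {T..2*T} (h i j) \<le> 2 * T * C * L powr (\<alpha>^2 + 1 + 2 * \<alpha>) * (1 / (max 1 \<bar>real j - real i\<bar>)^2)" if ij: "i < N" "j < N" for i j
      proof -
        have uv: "\<bar>u i - u j\<bar> \<le> 1" using u[OF ij(1)] u[OF ij(2)] by linarith
        define z where "z = norm (Complex (1 / l) (u i - u j))"
        define d where "d = max 1 \<bar>real j - real i\<bar>"
        have d1: "d \<ge> 1" by (simp add: d_def)
        \<comment> \<open>The real part 1/l covers neighbouring shifts and the imaginary part the
          distant ones. The decay d^(-2\<alpha>) that follows is weakened to d^(-2), whose sum over
          the shifts is bounded.\<close>
        have zd: "z \<ge> d / L"
        proof -
          have "z \<ge> 1 / l" using abs_Re_le_cmod[of "Complex (1 / l) (u i - u j)"] l by (simp add: z_def)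
          moreover have "1 / l \<ge> 1 / L" using l by (intro divide_left_mono) auto
          moreover have "z \<ge> \<bar>u i - u j\<bar>" using abs_Im_le_cmod[of "Complex (1 / l) (u i - u j)"] by (simp add: z_def)
          moreover have "\<bar>u i - u j\<bar> = \<bar>real j - real i\<bar> / L"
            using L by (simp add: u_def diff_divide_distrib[symmetric] abs_minus_commute)
          ultimately show ?thesis by (auto simp: d_def max_def)
        qed
        have zp: "z powr (- 2 * \<alpha>) \<le> L powr (2 * \<alpha>) * (1 / d^2)"
        proof -
          have "z powr (- 2 * \<alpha>) \<le> (d / L) powr (- 2 * \<alpha>)" using zd d1 L \<alpha> by (intro powr_mono2') auto
          also have "... = L powr (2 * \<alpha>) * d powr (- 2 * \<alpha>)"
            using d1 L by (simp add: powr_divide powr_minus field_simps)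
          also have "... \<le> L powr (2 * \<alpha>) * d powr (- 2)" using d1 \<alpha> by (intro mult_left_mono powr_mono) auto
          also have "d powr (- 2) = 1 / d^2" using d1 by (simp add: powr_minus divide_inverse)
          finally show ?thesis .
        qed
        have "integral {T..2*T} (h i j) \<le> 2 * T * (C * l powr (\<alpha>^2 + 1) * z powr (- 2 * \<alpha>))"
          unfolding h_def[abs_def]
        proof (rule integral_reson_fractional_le[OF \<alpha>])
          fix m assume m: "\<forall>j. m j = bden J j \<or> m j = bden J j - 1"
          have YT: "4 * Y * (1 + ln Y) \<le> T / 2"
          proof (rule lenmono[OF Y1])
            have "1 * Y \<le> x * Y" using x1 Y1 by (intro mult_right_mono) auto
            thus "Y \<le> ?X" using xY by linarith
          qed
          have "integral {T..2*T} (\<lambda>t. (norm (\<Prod>j'\<le>J. bfac J j' (t + u i) ^ bpow \<alpha> J j' * bfac J j' (t + u j) ^ m j'))^2) \<le>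
              2 * T * (sqrt (C * (2 ^ J) powr (\<alpha>^2 + 1) * norm (Complex (1 / 2 ^ J) (u i - u j)) powr (- 2 * \<alpha>)))^2"
            by (rule dpoly_integral_upper[OF C(2)[OF m uv], of Y]) (use YT T in \<open>auto simp: smooth_upto_def Y_def l_def\<close>)
          thus "integral {T..2*T} (\<lambda>t. (norm (\<Prod>j'\<le>J. bfac J j' (t + u i) ^ bpow \<alpha> J j' * bfac J j' (t + u j) ^ m j'))^2) \<le> 2 * T * (C * l powr (\<alpha>^2 + 1) * z powr (- 2 * \<alpha>))"
            using C(1) by (simp add: l_def z_def)
        qed
        also have "... \<le> 2 * T * (C * L powr (\<alpha>^2 + 1) * (L powr (2 * \<alpha>) * (1 / d^2)))"
          using zp T C l by (intro mult_left_mono mult_mono powr_mono2) auto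
        also have "... = 2 * T * C * L powr (\<alpha>^2 + 1 + 2 * \<alpha>) * (1 / d^2)"
          by (simp add: powr_add mult_ac)
        finally show ?thesis by (simp add: d_def)
      qed
      define Q where "Q = 2 * T * C * L powr (\<alpha>^2 + 1 + 2 * \<alpha>)"
      have Q: "Q \<ge> 0" using T C by (simp add: Q_def)
      have "integral {T..2*T} (\<lambda>t. g t powr (k / (k - 1))) \<le> integral {T..2*T} (\<lambda>t. \<Sum>i<N. \<Sum>j<N. h i j t)"
      proof (rule integral_le)
        show "(\<lambda>t. g t powr (k / (k - 1))) integrable_on {T..2*T}"
          using contg g0 assms by (intro integrable_continuous_real continuous_on_powr' continuous_intros) auto
        show "(\<lambda>t. \<Sum>i<N. \<Sum>j<N. h i j t) integrable_on {T..2*T}" by (intro integrable_sum inth) auto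
      qed (rule pt)
      also have "... = (\<Sum>i<N. \<Sum>j<N. integral {T..2*T} (h i j))"
        by (subst integral_sum, simp, intro integrable_sum inth, simp, intro sum.cong refl, subst integral_sum) (auto intro: inth)
      also have "... \<le> (\<Sum>i<N. \<Sum>j<N. Q * (1 / (max 1 \<bar>real j - real i\<bar>)^2))"
        unfolding Q_def by (intro sum_mono each) auto
      also have "... \<le> (\<Sum>i<N. Q * 7)"
        unfolding sum_distrib_left[symmetric] by (intro sum_mono mult_left_mono sum_inverse_max_squares Q)
      also have "... = real N * (Q * 7)" by simp
      also have "... \<le> L * (Q * 7)" using N Q by (intro mult_right_mono) auto
      also have "... = B"
      proof -
        have e: "\<alpha>^2 + 1 + 2 * \<alpha> = k^2" by (simp add: \<alpha>_def power2_eq_square algebra_simps)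
        have "L * L powr (k^2) = L powr (k^2 + 1)" using L by (simp add: powr_mult_base add.commute)
        moreover have "Q = 2 * T * C * L powr (k^2)" by (simp only: Q_def e)
        ultimately show ?thesis by (simp add: B_def b1_def)
      qed
      finally show ?thesis .
    qed
    have AB: "A > 0" "B > 0" using a1 b1 T x L by (simp_all add: A_def B_def)
    have "A powr k / B powr (k - 1) \<le> integral {T..2*T} (\<lambda>t. ((norm (zsum x t))^2) powr k)"
      by (rule moment_lower_bound[OF _ contD contg _ _ AB lower upper]) (use assms g0 in auto)
    moreover have "A powr k / B powr (k - 1) = a1 powr k / b1 powr (k - 1) * T * x powr k * L powr ((k - 1)^2)"
    proof -
      have "A powr k = a1 powr k * T powr k * x powr k * L powr (\<gamma> * k)"
        using a1 T x L by (simp add: A_def powr_mult powr_powr)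
      moreover have "B powr (k - 1) = b1 powr (k - 1) * T powr (k - 1) * L powr ((k^2 + 1) * (k - 1))"
        using b1 T L by (simp add: B_def powr_mult powr_powr)
      moreover have "T powr k = T * T powr (k - 1)" using T by (simp add: powr_mult_base)
      moreover have "L powr (\<gamma> * k) = L powr ((k - 1)^2) * L powr ((k^2 + 1) * (k - 1))"
        by (simp add: powr_add[symmetric] \<gamma>_def \<alpha>_def power2_eq_square algebra_simps)
      moreover have "T powr (k - 1) > 0" "L powr ((k^2 + 1) * (k - 1)) > 0" using T L by auto
      ultimately show ?thesis by (simp add: field_simps)
    qed
    ultimately show "a1 powr k / b1 powr (k - 1) * T * x powr k * ln x powr ((k - 1)^2) \<le> integral {T..2*T} (\<lambda>t. ((norm (zsum x t))^2) powr k)"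
      by (simp add: L_def)
  qed
qed

text \<open>The weight g = 1 with B = T, that is, the second moment alone. The power of ln x is
  missing, so this serves when ln x is bounded in terms of k.\<close>

lemma moment_all_x:
  fixes k :: real
  assumes k: "k > 1" and T: "T > 0" and x: "x \<ge> 1" "4 * x * (1 + ln x) \<le> T / 2"
  shows "integral {T..2*T} (\<lambda>t. ((norm (zsum x t))^2) powr k) \<ge> T * (x / 4) powr k"
proof -
  have "T / 2 * (\<Sum>n\<in>upto_real x. (norm (1 :: complex))^2) \<le> integral {T..2*T} (\<lambda>t. (norm (\<Sum>n\<in>upto_real x. 1 * chi t n))^2)"
    using T x by (intro dirichlet_integral_lower finite_upto_real) (auto simp: upto_real_def)
  moreover have "(\<Sum>n\<in>upto_real x. (norm (1 :: complex))^2) = real (nat \<lfloor>x\<rfloor>)" by (simp add: upto_real_eq)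
  moreover have "real (nat \<lfloor>x\<rfloor>) \<ge> x / 2"
  proof -
    have "1 \<le> real_of_int \<lfloor>x\<rfloor>" using x(1) by simp
    moreover have "x - 1 < real_of_int \<lfloor>x\<rfloor>" by linarith
    ultimately have "x / 2 \<le> real_of_int \<lfloor>x\<rfloor>" by argo
    thus ?thesis using x(1) by simp
  qed
  hence "T / 2 * real (nat \<lfloor>x\<rfloor>) \<ge> T / 2 * (x / 2)" using T by (intro mult_left_mono) auto
  ultimately have 1: "T * x / 4 \<le> integral {T..2*T} (\<lambda>t. (norm (zsum x t))^2 * 1)" by (simp add: zsum_def)
  have "(T * x / 4) powr k / T powr (k - 1) \<le> integral {T..2*T} (\<lambda>t. ((norm (zsum x t))^2) powr k)"
    by (rule moment_lower_bound[OF k _ _ _ _ _ _ 1])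
       (use T x in \<open>auto intro!: continuous_intros continuous_on_zsum\<close>)
  moreover have "(T * x / 4) powr k = T * T powr (k - 1) * (x / 4) powr k"
    using T x by (simp add: powr_mult powr_divide powr_mult_base)
  ultimately show ?thesis using T by simp
qed

theorem theorem1p1:
  fixes k :: real
  assumes "k > 2"
  shows "\<exists>T\<^sub>0 c :: real. c > 0 \<and>
    (\<forall>T x :: real. T \<ge> T\<^sub>0 \<longrightarrow> 2 \<le> x \<longrightarrow> x \<le> T powr (1 / 2) \<longrightarrow>
      1 / T * integral {T..2 * T}
        (\<lambda>t. norm (\<Sum>n | 1 \<le> n \<and> real n \<le> x. of_nat n powr (- \<i> * of_real t)) powr (2 * k))
      \<ge> c * x powr k * ln x powr ((k - 1)\<^sup>2))"
proof -
  obtain c1 where c1: "c1 > 0" "\<And>T x. T > 0 \<Longrightarrow> x > 0 \<Longrightarrow> ln x \<ge> 1000 * k \<Longrightarrow> 4 * x powr (11/10) * (1 + ln (x powr (11/10))) \<le> T / 2 \<Longrightarrow>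
     integral {T..2*T} (\<lambda>t. ((norm (zsum x t))^2) powr k) \<ge> c1 * T * x powr k * ln x powr ((k - 1)^2)"
    using moment_large_x[OF assms] by blast
  \<comment> \<open>The denominator absorbs the largest power of ln x that occurs while ln x < 1000
    k.\<close>
  define c2 where "c2 = (1 / 4) powr k / (1000 * k) powr ((k - 1)^2)"
  have c2: "c2 > 0" using assms by (simp add: c2_def)
  define c where "c = min c1 c2"
  \<comment> \<open>11/20 is half of 11/10, the exponent of x in the length of D times R. Beyond
    \<open>T1\<close> the error factor 4Y (1 + ln Y) of the mean value theorem is at most T/2 for
    all lengths up to T^(11/20).\<close>
  have "eventually (\<lambda>T::real. 4 * T powr (11/20) * (1 + ln (T powr (11/20))) \<le> T / 2) at_top" by real_asymp
  then obtain T1 :: real where T1: "\<And>T. T \<ge> T1 \<Longrightarrow> 4 * T powr (11/20) * (1 + ln (T powr (11/20))) \<le> T / 2"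
    unfolding eventually_at_top_linorder by blast
  show ?thesis
  proof (rule exI[of _ "max 1 T1"], rule exI[of _ c], intro conjI allI impI)
    show "c > 0" using c1 c2 by (simp add: c_def)
  next
    fix T x :: real assume T: "T \<ge> max 1 T1" and x: "2 \<le> x" "x \<le> T powr (1 / 2)"
    have T0: "T > 0" using T by simp
    have eq: "norm (\<Sum>n | 1 \<le> n \<and> real n \<le> x. of_nat n powr (- \<i> * of_real t)) powr (2 * k) = ((norm (zsum x t))^2) powr k" for t
    proof -
      have "(\<Sum>n | 1 \<le> n \<and> real n \<le> x. of_nat n powr (- \<i> * complex_of_real t)) = zsum x t"
        unfolding zsum_def upto_real_def
      proof (intro sum.cong)
        fix n :: nat assume "n \<in> {n. n > 0 \<and> real n \<le> x}"
        hence n: "n > 0" by simp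
        have "Ln (of_nat n) = of_real (ln (real n))" using n Ln_of_real[of "real n"] by simp
        thus "of_nat n powr (- \<i> * complex_of_real t) = chi t n" using n by (simp add: powr_def chi_def cis_conv_exp mult_ac)
      qed auto
      thus ?thesis by (simp add: powr_powr flip: powr_numeral)
    qed
    have xT: "x powr (11/10) \<le> T powr (11/20)"
    proof -
      have "x powr (11/10) \<le> (T powr (1/2)) powr (11/10)" using x by (intro powr_mono2) auto
      thus ?thesis by (simp add: powr_powr)
    qed
    have lenmono: "4 * z * (1 + ln z) \<le> T / 2" if "1 \<le> z" "z \<le> x powr (11/10)" for z
    proof -
      have "4 * z * (1 + ln z) \<le> 4 * T powr (11/20) * (1 + ln (T powr (11/20)))"
        using that xT by (intro mult_mono add_left_mono ln_mono) (auto intro!: add_nonneg_nonneg)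
      also have "... \<le> T / 2" using T by (intro T1) auto
      finally show ?thesis .
    qed
    have x11: "1 \<le> x powr (11/10)" "x \<le> x powr (11/10)" using x powr_mono[of 1 "11/10" x] by (auto intro: ge_one_powr_ge_zero)
    have "c * T * x powr k * ln x powr ((k - 1)^2) \<le> integral {T..2*T} (\<lambda>t. ((norm (zsum x t))^2) powr k)"
    proof (cases "ln x \<ge> 1000 * k")
      case True
      have "c * T * x powr k * ln x powr ((k - 1)^2) \<le> c1 * T * x powr k * ln x powr ((k - 1)^2)"
        using T0 by (intro mult_right_mono) (auto simp: c_def)
      also have "... \<le> integral {T..2*T} (\<lambda>t. ((norm (zsum x t))^2) powr k)"
        using True T0 x x11 lenmono[of "x powr (11/10)"] by (intro c1(2)) auto
      finally show ?thesis .
    next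
      case False
      have "c * T * x powr k * ln x powr ((k - 1)^2) \<le> c2 * T * x powr k * (1000 * k) powr ((k - 1)^2)"
        using T0 False x c2 assms by (intro mult_mono powr_mono2) (auto simp: c_def)
      also have "... = T * (x / 4) powr k" using assms x by (simp add: c2_def powr_divide)
      also have "... \<le> integral {T..2*T} (\<lambda>t. ((norm (zsum x t))^2) powr k)"
        using T0 x x11 assms lenmono[of x] by (intro moment_all_x) auto
      finally show ?thesis .
    qed
    thus "c * x powr k * ln x powr ((k - 1)^2) \<le> 1 / T * integral {T..2 * T}
        (\<lambda>t. norm (\<Sum>n | 1 \<le> n \<and> real n \<le> x. of_nat n powr (- \<i> * of_real t)) powr (2 * k))"
      unfolding eq using T0 by (simp add: field_simps)
  qed
qed

end
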